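(* A map $u \in (\mathbf{L}^\infty \cap \mathcal{TR}^\infty)([0,T]\times\Omega;\mathbb{R})$ is an E-solution to the initial-boundary value problem (IBVP) if and only if $u$ is a BLN-solution to the IBVP.
   Context: **Setting.** $N\ge 1$; $\Omega\subset\mathbb{R}^N$ is a bounded open set with smooth boundary $\partial\Omega$; $\nu(\xi)$ is the exterior (unit) normal at $\xi\in\partial\Omega$; $T>0$; $\mathbb{R}_+=[0,+\infty[$; $]a,b[$ denotes an open interval; $\mathrm{d}\xi$ is surface measure on $\partial\Omega$. The IBVP is $$\partial_t u+\nabla\cdot f(t,x,u)=F(t,x,u)\ \text{ in }\Omega,\qquad u(0,x)=u_o(x)\ (x\in\Omega),\qquad u(t,\xi)=u_b(t,\xi)\ (\xi\in\partial\Omega),$$ considered on the time interval $[0,T]$. Here $\nabla\cdot f(t,x,u(t,x))=\mathrm{div} f(t,x,u(t,x))+\partial_u f(t,x,u(t,x))\cdot\nabla u(t,x)$, i.e. $\mathrm{div}$ is the divergence with respect to the explicit variable $x$ only, with the remaining arguments frozen (also for entropy fluxes $q$). **Standing assumptions.** $u_o\in \mathbf{L}^\infty(\Omega;\mathbb{R})$; $u_b\in\mathbf{L}^\infty([0,T]\times\partial\Omega;\mathbb{R})$; $f\in\mathbf{C}^2([0,T]\times\overline\Omega\times\mathbb{R};\mathbb{R}^N)$ with $\partial_u f\in\mathbf{L}^\infty_{\mathrm{loc}}([0,T]\times\Omega\times\mathbb{R};\mathbb{R}^N)$ and $\nabla_x\partial_u f\in\mathbf{L}^\infty([0,T]\times\Omega\times\mathbb{R};\mathbb{R}^{N\times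 N})$; $F\in\mathbf{C}^2([0,T]\times\overline\Omega\times\mathbb{R};\mathbb{R})$ with $\partial_u F\in\mathbf{L}^\infty([0,T]\times\Omega\times\mathbb{R};\mathbb{R})$. **Notation.** $\partial_i$ is the partial derivative with respect to the $i$-th argument (so $\partial_3 f=\partial_u f$). $\mathrm{sgn}(s)=1,0,-1$ for $s>0$, $s=0$, $s<0$ respectively. "Test function" means $\phi\in\mathbf{C}^1_c(]-\infty,T[\times\mathbb{R}^N;\mathbb{R}_+)$. **Traces.** $u\in\mathcal{TR}^\infty([0,T]\times\Omega;\mathbb{R})$ if there is a function $\mathrm{tr}\,u\in\mathbf{L}^\infty([0,T]\times\partial\Omega;\mathbb{R})$ with $\operatorname{ess\,lim}_{r\to0^+}\int_0^T\int_{\partial\Omega}|u(t,\xi-r\,\nu(\xi))-\mathrm{tr}\,u(t,\xi)|\,\mathrm{d}\xi\,\mathrm{d}t=0$. **Entropy-entropy flux pair (with respect to $f$).** A pair $(\eta,q)\in\mathbf{C}^2(\mathbb{R};\mathbb{R})\times\mathbf{C}^2([0,T]\times\overline\Omega\times\mathbb{R};\mathbb{R}^N)$ with $\eta$ convex and $\partial_3 q(t,x,z)=\eta'(z)\,\partial_3 f(t,x,z)$ for all $t\in[0,T]$, $x\in\Omega$, $z\in\mathbb{R}$. **E-solution.** $u\in(\mathbf{L}^\infty\cap\mathcal{TR}^\infty)([0,T]\times\Omega;\mathbb{R})$ such that for every entropy-entropy flux pair $(\eta,q)$ and every test function $\phi$, $$\begin{aligned}&\int_0^T\!\!\int_\Omega\big[\eta(u)\,\partial_t\phi+q(t,x,u)\cdot\nabla\phi\big]\mathrm{d}x\,\mathrm{d}t+\int_0^T\!\!\int_\Omega\eta'(u)\big[F(t,x,u)-\mathrm{div}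 f(t,x,u)\big]\phi\,\mathrm{d}x\,\mathrm{d}t\\&+\int_0^T\!\!\int_\Omega\mathrm{div}\,q(t,x,u)\,\phi\,\mathrm{d}x\,\mathrm{d}t+\int_\Omega\eta(u_o(x))\,\phi(0,x)\,\mathrm{d}x-\int_0^T\!\!\int_{\partial\Omega}q(t,\xi,u_b(t,\xi))\cdot\nu(\xi)\,\phi(t,\xi)\,\mathrm{d}\xi\,\mathrm{d}t\\&+\int_0^T\!\!\int_{\partial\Omega}\eta'(u_b(t,\xi))\big(f(t,\xi,u_b(t,\xi))-f(t,\xi,\mathrm{tr}\,u(t,\xi))\big)\cdot\nu(\xi)\,\phi(t,\xi)\,\mathrm{d}\xi\,\mathrm{d}t\ge0,\end{aligned}$$ where $u=u(t,x)$, $\phi=\phi(t,x)$ in the integrals over $\Omega$. **BLN-solution.** $u\in(\mathbf{L}^\infty\cap\mathcal{TR}^\infty)([0,T]\times\Omega;\mathbb{R})$ such that for every $k\in\mathbb{R}$ and every test function $\phi$, $$\begin{aligned}&\int_0^T\!\!\int_\Omega|u-k|\,\partial_t\phi\,\mathrm{d}x\,\mathrm{d}t+\int_0^T\!\!\int_\Omega\mathrm{sgn}(u-k)\,(f(t,x,u)-f(t,x,k))\cdot\nabla\phi\,\mathrm{d}x\,\mathrm{d}t\\&+\int_0^T\!\!\int_\Omega\mathrm{sgn}(u-k)\big[F(t,x,u)-\mathrm{div} f(t,x,k)\big]\phi\,\mathrm{d}x\,\mathrm{d}t+\int_\Omega|u_o(x)-k|\,\phi(0,x)\,\mathrm{d}x\\&-\int_0^T\!\!\int_{\partial\Omega}\mathrm{sgn}(u_b(t,\xi)-k)\big(f(t,\xi,\mathrm{tr}\,u(t,\xi))-f(t,\xi,k)\big)\cdot\nu(\xi)\,\phi(t,\xi)\,\mathrm{d}\xi\,\mathrm{d}t\ge0.\end{aligned}$$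 *)

theory Defs
  imports "HOL-Analysis.Analysis"
begin

section \<open>Regularity classes\<close>

text \<open>
  \<open>C_k k S f\<close>: all derivatives of \<open>f\<close> up to order \<open>k\<close> exist and are continuous on \<open>S\<close>.
  Derivatives are taken \<^emph>\<open>within\<close> \<open>S\<close>, so the definition covers open sets and also the closed set
  \<open>[0,T] \<times> closure \<Omega> \<times> \<real>\<close>, where the one-sided derivatives are uniquely determined.
\<close>

primrec C_k :: "nat \<Rightarrow> 'a::euclidean_space set \<Rightarrow> ('a \<Rightarrow> 'b::real_normed_vector) \<Rightarrow> bool" where
  "C_k 0 S f \<longleftrightarrow> continuous_on S f"
| "C_k (Suc k) S f \<longleftrightarrow>
     (\<exists>D. (\<forall>x\<in>S. (f has_derivative D x) (at x within S)) \<and> (\<forall>b\<in>Basis. C_k k S (\<lambda>x. D x b)))"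

definition smooth :: "('a::euclidean_space \<Rightarrow> real) \<Rightarrow> bool" where
  "smooth f \<longleftrightarrow> (\<forall>k. C_k k UNIV f)"

text \<open>
  Elements of \<open>L\<^sup>\<infinity>\<close> are represented by functions. The measures used below are
  restrictions of \<^const>\<open>lborel\<close>, so the representatives are Borel functions;
  every equivalence class contains one.
\<close>

definition L_infinity :: "'a measure \<Rightarrow> ('a \<Rightarrow> 'b::real_normed_vector) set" where
  "L_infinity M = {f \<in> borel_measurable M. \<exists>C. AE x in M. norm (f x) \<le> C}"

definition L_infinity_loc ::
  "'a::euclidean_space set \<Rightarrow> ('a \<Rightarrow> 'b::real_normed_vector) set" where
  "L_infinity_loc S =
     {f. \<forall>K. compact K \<and> K \<subseteq> S \<longrightarrow> f \<in> L_infinity (restrict_space lborel K)}"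

section \<open>Differential operators\<close>

definition grad :: "('a::euclidean_space \<Rightarrow> real) \<Rightarrow> 'a \<Rightarrow> 'a" where
  "grad g x = (\<Sum>b\<in>Basis. frechet_derivative g (at x) b *\<^sub>R b)"

text \<open>Divergence with respect to the explicit variable \<open>x\<close> only, \<open>t\<close> and \<open>z\<close> being frozen.\<close>

definition div_x :: "(real \<times> 'a::euclidean_space \<times> real \<Rightarrow> 'a) \<Rightarrow> real \<Rightarrow> 'a \<Rightarrow> real \<Rightarrow> real" where
  "div_x g t x z = (\<Sum>b\<in>Basis. frechet_derivative (\<lambda>y. g (t, y, z)) (at x) b \<bullet> b)"

definition partial_u ::
  "(real \<times> 'a \<times> real \<Rightarrow> 'b::real_normed_vector) \<Rightarrow> real \<times> 'a \<times> real \<Rightarrow> 'b" where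
  "partial_u g = (\<lambda>(t, x, z). vector_derivative (\<lambda>s. g (t, x, s)) (at z))"

definition partial_x ::
  "'a \<Rightarrow> (real \<times> 'a::euclidean_space \<times> real \<Rightarrow> 'b::real_normed_vector)
    \<Rightarrow> real \<times> 'a \<times> real \<Rightarrow> 'b" where
  "partial_x b g = (\<lambda>(t, x, z). frechet_derivative (\<lambda>y. g (t, y, z)) (at x) b)"

section \<open>Smooth boundary, exterior normal, surface measure\<close>

text \<open>
  In the open set \<open>V\<close>, after relabelling and reorienting the coordinate axes so that \<open>e\<close> is the
  last one, \<open>\<Omega>\<close> is the part below the graph of \<open>\<gamma>\<close>, and hence \<open>frontier \<Omega>\<close> is the graph. A function
  of the \<open>N - 1\<close> remaining coordinates is represented by a function on the whole space that is
  constant in direction \<open>e\<close>; in particular \<open>grad \<gamma>\<close> is orthogonal to \<open>e\<close>.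
\<close>

definition boundary_chart ::
  "'a::euclidean_space set \<Rightarrow> 'a set \<Rightarrow> 'a \<Rightarrow> ('a \<Rightarrow> real) \<Rightarrow> bool" where
  "boundary_chart \<Omega> V e \<gamma> \<longleftrightarrow>
     open V \<and> (e \<in> Basis \<or> - e \<in> Basis) \<and>
     smooth \<gamma> \<and> (\<forall>x s. \<gamma> (x + s *\<^sub>R e) = \<gamma> x) \<and>
     \<Omega> \<inter> V = {x \<in> V. x \<bullet> e < \<gamma> x}"

definition smooth_boundary :: "'a::euclidean_space set \<Rightarrow> bool" where
  "smooth_boundary \<Omega> \<longleftrightarrow> (\<forall>\<xi>\<in>frontier \<Omega>. \<exists>V e \<gamma>. \<xi> \<in> V \<and> boundary_chart \<Omega> V e \<gamma>)"

text \<open>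
  The normalised gradient of the local defining function \<open>x \<bullet> e - \<gamma> x\<close>, which is negative in \<open>\<Omega>\<close>;
  it does not depend on the chart.
\<close>

definition exterior_normal :: "'a::euclidean_space set \<Rightarrow> 'a \<Rightarrow> 'a" where
  "exterior_normal \<Omega> \<xi> =
     (THE n. \<exists>V e \<gamma>. \<xi> \<in> V \<and> boundary_chart \<Omega> V e \<gamma> \<and>
        n = (e - grad \<gamma> \<xi>) /\<^sub>R sqrt (1 + (norm (grad \<gamma> \<xi>))\<^sup>2))"

text \<open>
  \<open>\<sigma>\<close> is the surface measure on \<open>frontier \<Omega>\<close>: in every chart it is given by the area element
  \<open>sqrt (1 + |grad \<gamma>|\<^sup>2)\<close> integrated over the parameter domain in \<open>\<real>\<^sup>N\<^sup>-\<^sup>1\<close>. The point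
  \<open>x + (\<gamma> x - x \<bullet> e) *\<^sub>R e\<close> is the graph point above or below \<open>x\<close>; as the integrand is constant in
  direction \<open>e\<close>, integrating it over the slab \<open>0 \<le> x \<bullet> e \<le> 1\<close> of thickness \<open>1\<close> in \<open>\<real>\<^sup>N\<close> amounts to
  integrating it over \<open>\<real>\<^sup>N\<^sup>-\<^sup>1\<close> (for \<open>N = 1\<close> this gives the counting measure). For bounded \<open>\<Omega>\<close> with smooth
  boundary there is exactly one such \<open>\<sigma>\<close>.
\<close>

definition surface_measure :: "'a::euclidean_space set \<Rightarrow> 'a measure \<Rightarrow> bool" where
  "surface_measure \<Omega> \<sigma> \<longleftrightarrow>
     sets \<sigma> = sets (restrict_space borel (frontier \<Omega>)) \<and>
     (\<forall>V e \<gamma> A. boundary_chart \<Omega> V e \<gamma> \<and> A \<in> sets \<sigma> \<and> A \<subseteq> V \<longrightarrow>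
        emeasure \<sigma> A =
          (\<integral>\<^sup>+x. ennreal (sqrt (1 + (norm (grad \<gamma> x))\<^sup>2)) *
             indicator {x. 0 \<le> x \<bullet> e \<and> x \<bullet> e \<le> 1 \<and> x + (\<gamma> x - x \<bullet> e) *\<^sub>R e \<in> A} x \<partial>lborel))"

definition interior_measure :: "real \<Rightarrow> 'a::euclidean_space set \<Rightarrow> (real \<times> 'a) measure" where
  "interior_measure T \<Omega> = restrict_space lborel ({0..T} \<times> \<Omega>)"

definition lateral_measure :: "real \<Rightarrow> 'a::euclidean_space measure \<Rightarrow> (real \<times> 'a) measure" where
  "lateral_measure T \<sigma> = restrict_space lborel {0..T} \<Otimes>\<^sub>M \<sigma>"

section \<open>Traces\<close>

text \<open>
  The filter \<open>inf (at_right 0) (ae_filter lborel)\<close> renders the essential limit as \<open>r \<rightarrow> 0+\<close>: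
  exceptional null sets of \<open>r\<close> are ignored.
\<close>

definition is_trace ::
  "real \<Rightarrow> 'a::euclidean_space set \<Rightarrow> 'a measure \<Rightarrow> (real \<times> 'a \<Rightarrow> real) \<Rightarrow> (real \<times> 'a \<Rightarrow> real) \<Rightarrow> bool"
where
  "is_trace T \<Omega> \<sigma> u w \<longleftrightarrow>
     w \<in> L_infinity (lateral_measure T \<sigma>) \<and>
     ((\<lambda>r. \<integral>\<^sup>+(t, \<xi>). ennreal \<bar>u (t, \<xi> - r *\<^sub>R exterior_normal \<Omega> \<xi>) - w (t, \<xi>)\<bar>
            \<partial>lateral_measure T \<sigma>) \<longlongrightarrow> 0)
       (inf (at_right 0) (ae_filter lborel))"

definition TR_infinity ::
  "real \<Rightarrow> 'a::euclidean_space set \<Rightarrow> 'a measure \<Rightarrow> (real \<times> 'a \<Rightarrow> real) set" where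
  "TR_infinity T \<Omega> \<sigma> = {u. \<exists>w. is_trace T \<Omega> \<sigma> u w}"

text \<open>The trace is unique up to null sets; the choice of representative is irrelevant.\<close>

definition tr ::
  "real \<Rightarrow> 'a::euclidean_space set \<Rightarrow> 'a measure \<Rightarrow> (real \<times> 'a \<Rightarrow> real) \<Rightarrow> real \<times> 'a \<Rightarrow> real" where
  "tr T \<Omega> \<sigma> u = (SOME w. is_trace T \<Omega> \<sigma> u w)"

section \<open>Entropies, test functions and solutions\<close>

definition entropy_flux_pair ::
  "real \<Rightarrow> 'a::euclidean_space set \<Rightarrow> (real \<times> 'a \<times> real \<Rightarrow> 'a)
    \<Rightarrow> (real \<Rightarrow> real) \<Rightarrow> (real \<times> 'a \<times> real \<Rightarrow> 'a) \<Rightarrow> bool" where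
  "entropy_flux_pair T \<Omega> f \<eta> q \<longleftrightarrow>
     C_k 2 UNIV \<eta> \<and> C_k 2 ({0..T} \<times> closure \<Omega> \<times> UNIV) q \<and> convex_on UNIV \<eta> \<and>
     (\<forall>t\<in>{0..T}. \<forall>x\<in>\<Omega>. \<forall>z. partial_u q (t, x, z) = deriv \<eta> z *\<^sub>R partial_u f (t, x, z))"

text \<open>Test functions on \<open>]-\<infinity>,T[ \<times> \<real>\<^sup>N\<close> are extended by \<open>0\<close> to times \<open>t \<ge> T\<close>.\<close>

definition test_function :: "real \<Rightarrow> (real \<times> 'a::euclidean_space \<Rightarrow> real) \<Rightarrow> bool" where
  "test_function T \<phi> \<longleftrightarrow>
     C_k 1 ({..<T} \<times> UNIV) \<phi> \<and> (\<forall>p. 0 \<le> \<phi> p) \<and>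
     (\<exists>K. compact K \<and> K \<subseteq> {..<T} \<times> UNIV \<and> (\<forall>p. p \<notin> K \<longrightarrow> \<phi> p = 0))"

definition E_solution ::
  "real \<Rightarrow> 'a::euclidean_space set \<Rightarrow> 'a measure
    \<Rightarrow> (real \<times> 'a \<times> real \<Rightarrow> 'a) \<Rightarrow> (real \<times> 'a \<times> real \<Rightarrow> real)
    \<Rightarrow> ('a \<Rightarrow> real) \<Rightarrow> (real \<times> 'a \<Rightarrow> real) \<Rightarrow> (real \<times> 'a \<Rightarrow> real) \<Rightarrow> bool" where
  "E_solution T \<Omega> \<sigma> f F u\<^sub>o u\<^sub>b u \<longleftrightarrow>
     u \<in> L_infinity (interior_measure T \<Omega>) \<inter> TR_infinity T \<Omega> \<sigma> \<and>
     (\<forall>\<eta> q \<phi>. entropy_flux_pair T \<Omega> f \<eta> q \<and> test_function T \<phi> \<longrightarrow>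
        (\<integral>(t, x). \<eta> (u (t, x)) * deriv (\<lambda>s. \<phi> (s, x)) t
                 + q (t, x, u (t, x)) \<bullet> grad (\<lambda>y. \<phi> (t, y)) x \<partial>interior_measure T \<Omega>)
        + (\<integral>(t, x). deriv \<eta> (u (t, x)) * (F (t, x, u (t, x)) - div_x f t x (u (t, x))) * \<phi> (t, x)
             \<partial>interior_measure T \<Omega>)
        + (\<integral>(t, x). div_x q t x (u (t, x)) * \<phi> (t, x) \<partial>interior_measure T \<Omega>)
        + (\<integral>x. \<eta> (u\<^sub>o x) * \<phi> (0, x) \<partial>restrict_space lborel \<Omega>)
        - (\<integral>(t, \<xi>). (q (t, \<xi>, u\<^sub>b (t, \<xi>)) \<bullet> exterior_normal \<Omega> \<xi>) * \<phi> (t, \<xi>) \<partial>lateral_measure T \<sigma>)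
        + (\<integral>(t, \<xi>). deriv \<eta> (u\<^sub>b (t, \<xi>)) *
             ((f (t, \<xi>, u\<^sub>b (t, \<xi>)) - f (t, \<xi>, tr T \<Omega> \<sigma> u (t, \<xi>))) \<bullet> exterior_normal \<Omega> \<xi>) * \<phi> (t, \<xi>)
             \<partial>lateral_measure T \<sigma>)
        \<ge> 0)"

definition BLN_solution ::
  "real \<Rightarrow> 'a::euclidean_space set \<Rightarrow> 'a measure
    \<Rightarrow> (real \<times> 'a \<times> real \<Rightarrow> 'a) \<Rightarrow> (real \<times> 'a \<times> real \<Rightarrow> real)
    \<Rightarrow> ('a \<Rightarrow> real) \<Rightarrow> (real \<times> 'a \<Rightarrow> real) \<Rightarrow> (real \<times> 'a \<Rightarrow> real) \<Rightarrow> bool" where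
  "BLN_solution T \<Omega> \<sigma> f F u\<^sub>o u\<^sub>b u \<longleftrightarrow>
     u \<in> L_infinity (interior_measure T \<Omega>) \<inter> TR_infinity T \<Omega> \<sigma> \<and>
     (\<forall>k \<phi>. test_function T \<phi> \<longrightarrow>
        (\<integral>(t, x). \<bar>u (t, x) - k\<bar> * deriv (\<lambda>s. \<phi> (s, x)) t \<partial>interior_measure T \<Omega>)
        + (\<integral>(t, x). sgn (u (t, x) - k) *
             ((f (t, x, u (t, x)) - f (t, x, k)) \<bullet> grad (\<lambda>y. \<phi> (t, y)) x) \<partial>interior_measure T \<Omega>)
        + (\<integral>(t, x). sgn (u (t, x) - k) * (F (t, x, u (t, x)) - div_x f t x k) * \<phi> (t, x)
             \<partial>interior_measure T \<Omega>)
        + (\<integral>x. \<bar>u\<^sub>o x - k\<bar> * \<phi> (0, x) \<partial>restrict_space lborel \<Omega>)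
        - (\<integral>(t, \<xi>). sgn (u\<^sub>b (t, \<xi>) - k) *
             ((f (t, \<xi>, tr T \<Omega> \<sigma> u (t, \<xi>)) - f (t, \<xi>, k)) \<bullet> exterior_normal \<Omega> \<xi>) * \<phi> (t, \<xi>)
             \<partial>lateral_measure T \<sigma>)
        \<ge> 0)"

end

theory Submission
  imports Defs
begin

text \<open>
  Both inequalities are the nonnegativity of one functional \<open>J\<close> of \<open>(\<eta>, \<eta>', q, div q)\<close>. Kruzhkov's entropy
  \<open>\<bar>z - k\<bar>\<close> is the limit of the smooth entropies \<open>sqrt ((z - k)\<^sup>2 + \<epsilon>\<^sup>2)\<close>, and \<open>J\<close> passes to the limit by
  dominated convergence. Conversely, on an interval \<open>[-K, K]\<close> containing all values of the solution and the data,
  a convex \<open>C\<^sup>2\<close> entropy is up to a constant a superposition of Kruzhkov's entropies with nonnegative weights, and by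
  Fubini \<open>J\<close> is the same superposition, up to the contribution of that constant and of a field \<open>c(t, x)\<close> by which
  the fluxes may differ. That contribution vanishes by the divergence theorem on \<open>[0,T] \<times> \<Omega>\<close>.

  The divergence theorem is proved in charts, by a shear that flattens the boundary and the fundamental theorem of
  calculus on lines, and globalised by a partition of unity. Admissible fluxes, which have to be \<open>C\<^sup>2\<close> up to the
  boundary, come from differentiating under the integral sign on \<open>[0,T] \<times> closure \<Omega> \<times> \<real>\<close>.
\<close>

section \<open>The classes C_k\<close>

text \<open>\<open>J\<close> is linear in its four arguments, so both directions are questions about
  approximating and decomposing entropies. Three points shape the proof. First, the sets where
  \<open>u\<close>, \<open>u\<^sub>o\<close> or \<open>u\<^sub>b\<close> equals \<open>k\<close> may
  have positive measure, so the limit towards Kruzhkov's entropy must be correct at every point,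
  with \<open>sgn 0 = 0\<close>; the regularisation is even about \<open>k\<close> and its
  derivative is exactly zero there. Second, an entropy pair prescribes only the derivative of
  \<open>q\<close> in the last variable, and only over the open set \<Omega>; continuity carries the
  relation to the boundary, but a field depending on time and space stays free. With the constant
  part of the entropy this field forms a pair whose entropy has derivative zero; for such a pair
  \<open>J\<close> is not merely nonnegative but zero for every test function. Third, the trace
  occurs only inside \<open>f\<close>, multiplied by the derivative of the entropy at
  \<open>u\<^sub>b\<close>. It is carried along as a factor and never decomposed, so
  \<open>K\<close> has to dominate \<open>u\<close>, \<open>u\<^sub>o\<close> and
  \<open>u\<^sub>b\<close> only.\<close>

lemma C_k_SucI:
  assumes "\<And>x. x \<in> S \<Longrightarrow> (f has_derivative D x) (at x within S)"
    and "\<And>b. b \<in> Basis \<Longrightarrow> C_k k S (\<lambda>x. D x b)"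
  shows "C_k (Suc k) S f"
  unfolding C_k.simps using assms by blast

lemma C_k_SucE:
  assumes "C_k (Suc k) S f"
  obtains D where "\<And>x. x \<in> S \<Longrightarrow> (f has_derivative D x) (at x within S)"
    and "\<And>b. b \<in> Basis \<Longrightarrow> C_k k S (\<lambda>x. D x b)"
  using assms unfolding C_k.simps by blast

declare C_k.simps(2) [simp del]

lemma C_k_imp_continuous: "C_k k S f \<Longrightarrow> continuous_on S f"
proof (cases k)
  case (Suc m)
  assume "C_k k S f"
  then show ?thesis unfolding Suc
    by (elim C_k_SucE) (meson continuous_on_eq_continuous_within has_derivative_continuous)
qed simp

lemma C_k_Suc_imp: "C_k (Suc k) S f \<Longrightarrow> C_k k S f"
proof (induction k arbitrary: f)
  case 0
  then show ?case using C_k_imp_continuous by fastforce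
next
  case (Suc k)
  from Suc.prems show ?case by (rule C_k_SucE) (rule C_k_SucI, assumption, rule Suc.IH)
qed

lemma C_k_mono: "C_k k S f \<Longrightarrow> j \<le> k \<Longrightarrow> C_k j S f"
  by (induction k) (auto simp: le_Suc_eq dest: C_k_Suc_imp)

text \<open>All derivatives are taken within \<open>S\<close>, so values outside \<open>S\<close>
  are irrelevant and the derivative of \<open>f\<close> serves for \<open>g\<close> as well.\<close>

lemma C_k_cong:
  assumes "C_k k S f" "\<And>x. x \<in> S \<Longrightarrow> f x = g x"
  shows "C_k k S g"
proof (cases k)
  case 0
  then show ?thesis using assms by (simp cong: continuous_on_cong)
next
  case (Suc m)
  from assms(1)[unfolded Suc] show ?thesis unfolding Suc
    by (rule C_k_SucE) (rule C_k_SucI, rule has_derivative_transform[where f = f], simp_all add: assms(2))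
qed

lemma C_k_const: "C_k k S (\<lambda>_. c)"
proof (induction k arbitrary: c)
  case (Suc k)
  show ?case by (rule C_k_SucI[where D = "\<lambda>_ _. 0"]) (auto intro: Suc)
qed simp

lemma C_k_bounded_linear:
  assumes "bounded_linear L" shows "C_k k S L"
proof (cases k)
  case 0
  then show ?thesis using assms by (simp add: linear_continuous_on)
next
  case (Suc m)
  show ?thesis unfolding Suc
    by (rule C_k_SucI[where D = "\<lambda>_. L"]) (auto intro: C_k_const bounded_linear_imp_has_derivative assms)
qed

lemma C_k_add: "C_k k S f \<Longrightarrow> C_k k S g \<Longrightarrow> C_k k S (\<lambda>x. f x + g x)"
proof (induction k arbitrary: f g)
  case 0
  then show ?case by (auto intro: continuous_intros)
next
  case (Suc k)
  from Suc.prems(1) obtain Df where f: "\<And>x. x \<in> S \<Longrightarrow> (f has_derivative Df x) (at x within S)"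
    "\<And>b. b \<in> Basis \<Longrightarrow> C_k k S (\<lambda>x. Df x b)" by (rule C_k_SucE) (rule that, assumption+)
  from Suc.prems(2) obtain Dg where g: "\<And>x. x \<in> S \<Longrightarrow> (g has_derivative Dg x) (at x within S)"
    "\<And>b. b \<in> Basis \<Longrightarrow> C_k k S (\<lambda>x. Dg x b)" by (rule C_k_SucE) (rule that, assumption+)
  show ?case
    by (rule C_k_SucI[where D = "\<lambda>x v. Df x v + Dg x v"]) (intro has_derivative_add f g Suc.IH; assumption)+
qed

text \<open>The Leibniz rule yields two terms of the same shape, with one factor differentiated;
  both factors have lost at most one order, so the induction closes.\<close>

lemma C_k_bilinear:
  fixes f :: "'d::euclidean_space \<Rightarrow> 'a::real_normed_vector" and g :: "'d \<Rightarrow> 'b::real_normed_vector"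
    and B :: "'a \<Rightarrow> 'b \<Rightarrow> 'c::real_normed_vector"
  assumes "bounded_bilinear B"
  shows "C_k k S f \<Longrightarrow> C_k k S g \<Longrightarrow> C_k k S (\<lambda>x. B (f x) (g x))"
proof (induction k arbitrary: f g)
  case 0
  then show ?case by (auto intro: bounded_bilinear.continuous_on[OF assms])
next
  case (Suc k)
  from Suc.prems(1) obtain Df where f: "\<And>x. x \<in> S \<Longrightarrow> (f has_derivative Df x) (at x within S)"
    "\<And>b. b \<in> Basis \<Longrightarrow> C_k k S (\<lambda>x. Df x b)" by (rule C_k_SucE) (rule that, assumption+)
  from Suc.prems(2) obtain Dg where g: "\<And>x. x \<in> S \<Longrightarrow> (g has_derivative Dg x) (at x within S)"
    "\<And>b. b \<in> Basis \<Longrightarrow> C_k k S (\<lambda>x. Dg x b)" by (rule C_k_SucE) (rule that, assumption+)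
  show ?case
  proof (rule C_k_SucI)
    fix x assume "x \<in> S"
    then show "((\<lambda>x. B (f x) (g x)) has_derivative (\<lambda>v. B (f x) (Dg x v) + B (Df x v) (g x))) (at x within S)"
      by (intro bounded_bilinear.FDERIV[OF assms] f(1) g(1))
  next
    fix b :: 'd assume "b \<in> Basis"
    then show "C_k k S (\<lambda>x. B (f x) (Dg x b) + B (Df x b) (g x))"
      by (intro C_k_add Suc.IH f(2) g(2) C_k_Suc_imp[OF Suc.prems(1)] C_k_Suc_imp[OF Suc.prems(2)])
  qed
qed

lemmas C_k_mult = C_k_bilinear[OF bounded_bilinear_mult]
lemmas C_k_scaleR = C_k_bilinear[OF bounded_bilinear_scaleR]

lemma C_k_diff:
  assumes "C_k k S f" "C_k k S g" shows "C_k k S (\<lambda>x. f x - g x)"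
  using C_k_add[OF assms(1) C_k_scaleR[OF C_k_const assms(2)], of "-1"] by simp

section \<open>Geometry of smooth boundaries\<close>

lemma C_k_1E:
  assumes "C_k 1 S f"
  obtains D where "\<And>x. x \<in> S \<Longrightarrow> (f has_derivative D x) (at x within S)"
    "\<And>b. b \<in> Basis \<Longrightarrow> continuous_on S (\<lambda>x. D x b)"
  using assms unfolding One_nat_def by (elim C_k_SucE) (auto dest: C_k_imp_continuous)

text \<open>\<open>C_k\<close> controls derivatives in basis directions only. Expanding the argument
  in the basis gives every direction, even one that varies with the point.\<close>

lemma continuous_on_linear_Basis:
  fixes D :: "'c::topological_space \<Rightarrow> 'a::euclidean_space \<Rightarrow> 'b::real_normed_vector"
  assumes "\<And>x. x \<in> S \<Longrightarrow> linear (D x)" "\<And>b. b \<in> Basis \<Longrightarrow> continuous_on S (\<lambda>x. D x b)"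
    "continuous_on S v"
  shows "continuous_on S (\<lambda>x. D x (v x))"
proof -
  have "continuous_on S (\<lambda>x. \<Sum>b\<in>Basis. (v x \<bullet> b) *\<^sub>R D x b)"
    using assms by (intro continuous_intros) auto
  moreover have "D x (v x) = (\<Sum>b\<in>Basis. (v x \<bullet> b) *\<^sub>R D x b)" if "x \<in> S" for x
  proof -
    have "D x (v x) = D x (\<Sum>b\<in>Basis. (v x \<bullet> b) *\<^sub>R b)" by (simp add: euclidean_representation)
    also have "\<dots> = (\<Sum>b\<in>Basis. (v x \<bullet> b) *\<^sub>R D x b)"
      using assms(1)[OF that] by (simp add: linear_sum linear_cmul)
    finally show ?thesis .
  qed
  ultimately show ?thesis by (simp cong: continuous_on_cong)
qed

text \<open>The representing vector is the one from which \<open>grad\<close> is built.\<close>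

lemma linear_eq_inner_sum:
  fixes D :: "'a::euclidean_space \<Rightarrow> real"
  assumes "linear D"
  shows "D v = (\<Sum>b\<in>Basis. D b *\<^sub>R b) \<bullet> v"
proof -
  have "D v = D (\<Sum>b\<in>Basis. (v \<bullet> b) *\<^sub>R b)" by (simp add: euclidean_representation)
  also have "\<dots> = (\<Sum>b\<in>Basis. (v \<bullet> b) *\<^sub>R D b)"
    using assms by (simp add: linear_sum linear_cmul)
  finally show ?thesis by (subst inner_commute) (simp add: inner_sum_right mult.commute)
qed

section \<open>Calculus in a single boundary chart\<close>

locale chart =
  fixes \<Omega> V :: "'a::euclidean_space set" and e :: 'a and \<gamma> :: "'a \<Rightarrow> real"
  assumes chart: "boundary_chart \<Omega> V e \<gamma>"
begin

lemma open_V: "open V" and e_Basis: "e \<in> Basis \<or> - e \<in> Basis"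
  and inv: "\<gamma> (x + s *\<^sub>R e) = \<gamma> x" and below: "\<Omega> \<inter> V = {x \<in> V. x \<bullet> e < \<gamma> x}"
  using chart by (auto simp: boundary_chart_def)

lemma ee [simp]: "e \<bullet> e = 1" and norm_e [simp]: "norm e = 1"
proof -
  show n: "norm e = 1" using e_Basis norm_Basis[of e] norm_Basis[of "- e"] by auto
  show "e \<bullet> e = 1" using n by (simp add: norm_eq_1)
qed

lemma deriv_\<gamma>: "(\<gamma> has_derivative (\<lambda>v. grad \<gamma> x \<bullet> v)) (at x)"
  and cont_grad: "continuous_on UNIV (grad \<gamma>)"
proof -
  have "C_k 1 UNIV \<gamma>" using chart by (auto simp: boundary_chart_def smooth_def)
  then obtain D where D': "\<And>x. x \<in> UNIV \<Longrightarrow> (\<gamma> has_derivative D x) (at x)"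
    and D2: "\<And>b. b \<in> Basis \<Longrightarrow> continuous_on UNIV (\<lambda>x. D x b)"
    by (rule C_k_1E) blast
  note D = D'[OF UNIV_I]
  have eq: "frechet_derivative \<gamma> (at x) = D x" for x
    using frechet_derivative_at[OF D, of x] by simp
  have "D x v = grad \<gamma> x \<bullet> v" for v
    unfolding grad_def eq by (rule linear_eq_inner_sum[OF has_derivative_linear[OF D]])
  then have "D x = (\<lambda>v. grad \<gamma> x \<bullet> v)" by (rule ext)
  then show "(\<gamma> has_derivative (\<lambda>v. grad \<gamma> x \<bullet> v)) (at x)" using D[of x] by simp
  show "continuous_on UNIV (grad \<gamma>)"
    unfolding grad_def[abs_def] eq using D2 by (intro continuous_intros)
qed

lemma cont_\<gamma>: "continuous_on S \<gamma>"
  by (intro continuous_at_imp_continuous_on ballI has_derivative_continuous[OF deriv_\<gamma>])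

lemma grad_inv: "grad \<gamma> (x + s *\<^sub>R e) = grad \<gamma> x"
proof -
  have "((\<lambda>y. \<gamma> (y + s *\<^sub>R e)) has_derivative (\<lambda>v. grad \<gamma> (x + s *\<^sub>R e) \<bullet> v)) (at x)"
    by (rule has_derivative_eq_rhs, rule has_derivative_compose[OF _ deriv_\<gamma>])
       (auto intro!: derivative_eq_intros)
  then have "(\<gamma> has_derivative (\<lambda>v. grad \<gamma> (x + s *\<^sub>R e) \<bullet> v)) (at x)"
    by (simp add: inv)
  then have "(\<lambda>v. grad \<gamma> (x + s *\<^sub>R e) \<bullet> v) = (\<lambda>v. grad \<gamma> x \<bullet> v)"
    by (rule has_derivative_unique[OF _ deriv_\<gamma>])
  then show ?thesis by (metis inner_commute vector_eq_ldot)
qed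

lemma grad_e: "grad \<gamma> x \<bullet> e = 0"
proof -
  have "((\<lambda>s. \<gamma> (x + s *\<^sub>R e)) has_derivative (\<lambda>s. grad \<gamma> (x + 0 *\<^sub>R e) \<bullet> (s *\<^sub>R e))) (at 0)"
    by (rule has_derivative_compose[OF _ deriv_\<gamma>]) (auto intro!: derivative_eq_intros)
  moreover have "((\<lambda>s. \<gamma> (x + s *\<^sub>R e)) has_derivative (\<lambda>s::real. 0)) (at 0)"
    by (simp add: inv)
  ultimately have "(\<lambda>s. grad \<gamma> (x + 0 *\<^sub>R e) \<bullet> (s *\<^sub>R e)) = (\<lambda>s::real. 0)"
    by (rule has_derivative_unique)
  from fun_cong[OF this, of 1] show ?thesis by simp
qed

text \<open>The projection along \<open>e\<close> onto the graph of \<gamma>;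
  \<open>surface_measure\<close> pulls sets back to the slab under this map.\<close>

definition graph :: "'a \<Rightarrow> 'a" where "graph x = x + (\<gamma> x - x \<bullet> e) *\<^sub>R e"

lemma graph_e: "graph x \<bullet> e = \<gamma> x" and gamma_graph [simp]: "\<gamma> (graph x) = \<gamma> x"
  and grad_graph [simp]: "grad \<gamma> (graph x) = grad \<gamma> x"
  by (auto simp: graph_def inner_add_left inv grad_inv)

lemma cont_graph: "continuous_on S graph"
  unfolding graph_def[abs_def] by (intro continuous_intros cont_\<gamma>)

text \<open>As \<open>V\<close> is open, points of the closure in \<open>V\<close> are limits from
  \<Omega> inside \<open>V\<close>. Conversely, a small step in direction \<open>- e\<close> keeps
  \<gamma> fixed and makes the inequality strict.\<close>

lemma closure_V: "closure \<Omega> \<inter> V = {x \<in> V. x \<bullet> e \<le> \<gamma> x}"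
proof (intro set_eqI iffI)
  fix x assume x: "x \<in> closure \<Omega> \<inter> V"
  have "x \<in> closure (\<Omega> \<inter> V)"
    using x open_Int_closure_subset[OF open_V, of \<Omega>] by (auto simp: Int_commute)
  moreover have "closed {x. x \<bullet> e \<le> \<gamma> x}"
    by (intro closed_Collect_le continuous_intros cont_\<gamma>)
  then have "closure (\<Omega> \<inter> V) \<subseteq> {x. x \<bullet> e \<le> \<gamma> x}"
    by (intro closure_minimal) (auto simp: below)
  ultimately show "x \<in> {x \<in> V. x \<bullet> e \<le> \<gamma> x}" using x by auto
next
  fix x assume x: "x \<in> {x \<in> V. x \<bullet> e \<le> \<gamma> x}"
  then obtain r where r: "r > 0" "ball x r \<subseteq> V" using open_V by (auto simp: open_contains_ball)
  have "x \<in> closure \<Omega>"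
    unfolding closure_approachable
  proof (intro allI impI)
    fix d :: real assume "d > 0"
    define s where "s = min d r / 2"
    have s: "0 < s" "s < d" "s < r" using \<open>d > 0\<close> r by (auto simp: s_def)
    have "x + (-s) *\<^sub>R e \<in> V" using r s by (auto simp: dist_norm subset_iff)
    moreover have "(x + (-s) *\<^sub>R e) \<bullet> e < \<gamma> (x + (-s) *\<^sub>R e)"
      unfolding inv using x s by (auto simp: inner_diff_left)
    ultimately have "x + (-s) *\<^sub>R e \<in> \<Omega>" using below by blast
    then show "\<exists>y\<in>\<Omega>. dist y x < d" using s by (intro bexI) (auto simp: dist_norm)
  qed
  then show "x \<in> closure \<Omega> \<inter> V" using x by auto
qed

lemma frontier_V: "open \<Omega> \<Longrightarrow> frontier \<Omega> \<inter> V = {x \<in> V. x \<bullet> e = \<gamma> x}"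
proof -
  assume "open \<Omega>"
  then have "frontier \<Omega> \<inter> V = closure \<Omega> \<inter> V - \<Omega> \<inter> V" by (auto simp: frontier_def interior_open)
  also have "\<dots> = {x \<in> V. x \<bullet> e = \<gamma> x}" unfolding closure_V below by auto
  finally show ?thesis .
qed

definition normal :: "'a \<Rightarrow> 'a" where
  "normal x = (e - grad \<gamma> x) /\<^sub>R sqrt (1 + (norm (grad \<gamma> x))\<^sup>2)"

text \<open>Pythagoras, since the gradient is orthogonal to \<open>e\<close>. The length of the
  unnormalised normal is therefore the area element.\<close>

lemma norm_e_grad: "norm (e - grad \<gamma> x) = sqrt (1 + (norm (grad \<gamma> x))\<^sup>2)"
proof -
  have "(norm (e - grad \<gamma> x))\<^sup>2 = 1 + (norm (grad \<gamma> x))\<^sup>2"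
    using grad_e[of x] by (simp add: power2_norm_eq_inner inner_diff_left inner_diff_right inner_commute)
  then show ?thesis by (metis norm_ge_zero real_sqrt_unique)
qed

lemma sqrt_pos: "sqrt (1 + (norm (grad \<gamma> x))\<^sup>2) > 0"
  by (simp add: add_pos_nonneg)

lemma norm_normal: "norm (normal x) = 1"
  unfolding normal_def norm_scaleR norm_e_grad abs_inverse abs_of_pos[OF sqrt_pos]
  by (rule left_inverse) (rule less_imp_neq[OF sqrt_pos, symmetric])

lemma cont_normal: "continuous_on S normal"
  unfolding normal_def[abs_def]
  by (intro continuous_intros continuous_on_subset[OF cont_grad] subset_UNIV ballI less_imp_neq[OF sqrt_pos, symmetric])

lemma deriv_defining:
  "((\<lambda>x. x \<bullet> e - \<gamma> x) has_derivative (\<lambda>v. (e - grad \<gamma> \<xi>) \<bullet> v)) (at \<xi>)"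
  by (rule has_derivative_eq_rhs, (rule derivative_eq_intros deriv_\<gamma> refl)+)
     (simp add: inner_diff_left inner_diff_right inner_commute)

text \<open>Along a ray the local defining function starts at zero with a slope of the sign of
  \<open>normal x \<bullet> v\<close>. Whether the ray enters or leaves depends on \<Omega> alone,
  which ties the normal to \<Omega> and not to the chart.\<close>

lemma line_sign:
  assumes "x \<in> V" "x \<bullet> e = \<gamma> x"
  shows "normal x \<bullet> v < 0 \<Longrightarrow> eventually (\<lambda>s. x + s *\<^sub>R v \<in> \<Omega>) (at_right 0)"
    and "normal x \<bullet> v > 0 \<Longrightarrow> eventually (\<lambda>s. x + s *\<^sub>R v \<notin> \<Omega>) (at_right 0)"
proof -
  define \<rho> where "\<rho> = (\<lambda>s. (x + s *\<^sub>R v) \<bullet> e - \<gamma> (x + s *\<^sub>R v))"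
  have c: "normal x \<bullet> v = ((e - grad \<gamma> x) \<bullet> v) / sqrt (1 + (norm (grad \<gamma> x))\<^sup>2)"
    by (simp add: normal_def divide_inverse_commute)
  note pos = sqrt_pos[of x]
  have d: "DERIV \<rho> 0 :> (e - grad \<gamma> x) \<bullet> v"
    unfolding has_field_derivative_def \<rho>_def
    by (rule has_derivative_eq_rhs, rule has_derivative_compose[OF _ deriv_defining])
       (auto intro!: derivative_eq_intros)
  have \<rho>0: "\<rho> 0 = 0" using assms by (simp add: \<rho>_def)
  have "((\<lambda>s. x + s *\<^sub>R v) \<longlongrightarrow> x) (at_right 0)" by (auto intro!: tendsto_eq_intros)
  then have inV: "eventually (\<lambda>s. x + s *\<^sub>R v \<in> V) (at_right 0)"
    using assms open_V by (metis topological_tendstoD)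
  have mem: "x + s *\<^sub>R v \<in> V \<Longrightarrow> x + s *\<^sub>R v \<in> \<Omega> \<longleftrightarrow> \<rho> s < 0" for s
    using below by (auto simp: \<rho>_def)
  have gap: "0 < d \<Longrightarrow> eventually (\<lambda>s. 0 < s \<and> s < d) (at_right 0)" for d :: real
    by (auto simp: eventually_at_right intro!: exI[of _ d])
  {
    assume "normal x \<bullet> v < 0"
    then have "(e - grad \<gamma> x) \<bullet> v < 0" using pos c by (simp add: divide_less_0_iff)
    from DERIV_neg_dec_right[OF d this] obtain r where "r > 0" and h: "\<forall>h>0. h < r \<longrightarrow> \<rho> 0 > \<rho> (0 + h)" by blast
    show "eventually (\<lambda>s. x + s *\<^sub>R v \<in> \<Omega>) (at_right 0)"
      using inV gap[OF \<open>r > 0\<close>] by eventually_elim (use \<rho>0 mem h in auto)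
  }
  {
    assume "normal x \<bullet> v > 0"
    then have "(e - grad \<gamma> x) \<bullet> v > 0" using pos c by (simp add: zero_less_divide_iff)
    from DERIV_pos_inc_right[OF d this] obtain r where "r > 0" and h: "\<forall>h>0. h < r \<longrightarrow> \<rho> 0 < \<rho> (0 + h)" by blast
    show "eventually (\<lambda>s. x + s *\<^sub>R v \<notin> \<Omega>) (at_right 0)"
      using inV gap[OF \<open>r > 0\<close>] by eventually_elim (use \<rho>0 mem h in force)
  }
qed

end

text \<open>A unit vector is determined by its open negative half-space. Subtracting from
  \<open>m\<close> slightly more than its component along \<open>n\<close> gives a vector in the
  half-space of \<open>n\<close>; testing \<open>m\<close> on it forces \<open>m \<bullet> n\<close>
  to be at least \<open>1 - \<delta>\<close>.\<close>

lemma unit_vectors_eqI: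
  fixes n m :: "'a::real_inner"
  assumes "norm n = 1" "norm m = 1" "\<And>v. n \<bullet> v < 0 \<Longrightarrow> m \<bullet> v \<le> 0"
  shows "n = m"
proof -
  have nn: "n \<bullet> n = 1" "m \<bullet> m = 1" using assms by (auto simp: norm_eq_1)
  have *: "m \<bullet> n \<ge> 1 - \<delta>" if "\<delta> > 0" for \<delta>
  proof -
    have 1: "n \<bullet> (m - (m \<bullet> n + \<delta>) *\<^sub>R n) < 0"
      using nn that by (simp add: inner_diff_right algebra_simps inner_commute)
    have "m \<bullet> (m - (m \<bullet> n + \<delta>) *\<^sub>R n) \<le> 0" by (rule assms(3)[OF 1])
    then have **: "1 \<le> (m \<bullet> n + \<delta>) * (m \<bullet> n)" using nn by (simp add: inner_diff_right)
    have cs: "\<bar>m \<bullet> n\<bar> \<le> 1" using Cauchy_Schwarz_ineq2[of m n] assms by simp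
    \<comment> \<open>The vector \<open>n - n - n\<close> is \<open>- n\<close>; the resulting sign
      of \<open>m \<bullet> n\<close> allows the product below to be estimated by its first
      factor.\<close>
    have "m \<bullet> (n - n - n) \<le> 0" using assms(3)[of "n - n - n"] nn by (simp add: inner_diff_right)
    then have "m \<bullet> n \<ge> 0" by (simp add: inner_diff_right)
    then have "(m \<bullet> n + \<delta>) * (m \<bullet> n) \<le> m \<bullet> n + \<delta>" using cs that
      by (simp add: mult_left_le)
    then show ?thesis using ** by simp
  qed
  have "m \<bullet> n \<ge> 1" by (rule field_le_epsilon) (use * in force)
  moreover have "(norm (n - m))\<^sup>2 = 2 - 2 * (m \<bullet> n)"
    using nn by (simp add: power2_norm_eq_inner inner_diff_left inner_diff_right inner_commute)
  ultimately have "(norm (n - m))\<^sup>2 \<le> 0" by linarith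
  then show ?thesis by simp
qed

text \<open>Two charts at a common point see the same rays enter \<Omega>, so their normals have the
  same negative half-space and coincide. This makes the description by \<open>THE\<close>
  meaningful.\<close>

lemma exterior_normal_eq:
  assumes "boundary_chart \<Omega> V e \<gamma>" "open \<Omega>" "\<xi> \<in> V" "\<xi> \<in> frontier \<Omega>"
  shows "exterior_normal \<Omega> \<xi> = chart.normal e \<gamma> \<xi>"
proof -
  interpret c: chart \<Omega> V e \<gamma> using assms by unfold_locales
  show ?thesis
    unfolding exterior_normal_def
  proof (rule the_equality)
    show "\<exists>V e' \<gamma>'. \<xi> \<in> V \<and> boundary_chart \<Omega> V e' \<gamma>' \<and>
        c.normal \<xi> = (e' - grad \<gamma>' \<xi>) /\<^sub>R sqrt (1 + (norm (grad \<gamma>' \<xi>))\<^sup>2)"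
      by (intro exI[of _ V] exI[of _ e] exI[of _ \<gamma>] conjI assms(1,3) c.normal_def)
  next
    fix n assume "\<exists>V e \<gamma>. \<xi> \<in> V \<and> boundary_chart \<Omega> V e \<gamma> \<and>
        n = (e - grad \<gamma> \<xi>) /\<^sub>R sqrt (1 + (norm (grad \<gamma> \<xi>))\<^sup>2)"
    then obtain V' e' \<gamma>' where 1: "\<xi> \<in> V'" "boundary_chart \<Omega> V' e' \<gamma>'"
      "n = (e' - grad \<gamma>' \<xi>) /\<^sub>R sqrt (1 + (norm (grad \<gamma>' \<xi>))\<^sup>2)"
      by (elim exE conjE) (rule that)
    interpret d: chart \<Omega> V' e' \<gamma>' using 1 by unfold_locales
    have n: "n = d.normal \<xi>" unfolding d.normal_def by (rule 1(3))
    have g: "\<xi> \<bullet> e = \<gamma> \<xi>" "\<xi> \<bullet> e' = \<gamma>' \<xi>"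
      using c.frontier_V[OF assms(2)] d.frontier_V[OF assms(2)] assms(3,4) 1(1) by auto
    show "n = c.normal \<xi>"
      unfolding n
    proof (rule unit_vectors_eqI)
      fix v assume v: "d.normal \<xi> \<bullet> v < 0"
      show "c.normal \<xi> \<bullet> v \<le> 0"
      proof (rule ccontr)
        assume "\<not> ?thesis"
        then have "c.normal \<xi> \<bullet> v > 0" by simp
        have "eventually (\<lambda>s. False) (at_right (0::real))"
          using d.line_sign(1)[OF 1(1) g(2) v] c.line_sign(2)[OF assms(3) g(1) \<open>c.normal \<xi> \<bullet> v > 0\<close>]
          by eventually_elim simp
        then show False by simp
      qed
    qed (rule c.norm_normal d.norm_normal)+
  qed
qed

lemma continuous_on_exterior_normal:
  assumes "open \<Omega>" "smooth_boundary \<Omega>"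
  shows "continuous_on (frontier \<Omega>) (exterior_normal \<Omega>)"
    and "\<xi> \<in> frontier \<Omega> \<Longrightarrow> norm (exterior_normal \<Omega> \<xi>) = 1"
proof -
  show "continuous_on (frontier \<Omega>) (exterior_normal \<Omega>)"
    unfolding continuous_on_eq_continuous_within
  proof
    fix \<xi> assume \<xi>: "\<xi> \<in> frontier \<Omega>"
    then obtain V e \<gamma> where c: "\<xi> \<in> V" "boundary_chart \<Omega> V e \<gamma>"
      using assms by (auto simp: smooth_boundary_def)
    interpret c: chart \<Omega> V e \<gamma> using c by unfold_locales
    have "continuous (at \<xi> within frontier \<Omega>) c.normal"
      using c.cont_normal \<xi> by (metis continuous_on_eq_continuous_within)
    then have "(c.normal \<longlongrightarrow> c.normal \<xi>) (at \<xi> within frontier \<Omega>)" by (simp add: continuous_within)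
    then have "(exterior_normal \<Omega> \<longlongrightarrow> c.normal \<xi>) (at \<xi> within frontier \<Omega>)"
    proof (rule Lim_transform_eventually)
      show "\<forall>\<^sub>F x in at \<xi> within frontier \<Omega>. c.normal x = exterior_normal \<Omega> x"
        unfolding eventually_at_topological
        using exterior_normal_eq[OF c(2) assms(1)] c.open_V c(1) by metis
    qed
    then show "continuous (at \<xi> within frontier \<Omega>) (exterior_normal \<Omega>)"
      using exterior_normal_eq[OF c(2) assms(1) c(1) \<xi>] by (simp add: continuous_within)
  qed
  assume \<xi>: "\<xi> \<in> frontier \<Omega>"
  then obtain V e \<gamma> where c: "\<xi> \<in> V" "boundary_chart \<Omega> V e \<gamma>"
    using assms by (auto simp: smooth_boundary_def)
  then interpret c: chart \<Omega> V e \<gamma> by unfold_locales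
  show "norm (exterior_normal \<Omega> \<xi>) = 1"
    using exterior_normal_eq[OF c(2) assms(1) c(1) \<xi>] c.norm_normal by simp
qed

text \<open>The segment from \<open>x\<close> to \<open>y\<close> may leave the closure, so the path
  first descends from \<open>x\<close> along \<open>- e\<close> and then runs straight to
  \<open>y\<close>. The descent is proportional to \<open>norm (y - x)\<close> and steep enough to
  compensate for the slope of the graph.\<close>

lemma (in chart) local_path:
  assumes "x \<in> closure \<Omega>" "x \<in> V"
  shows "\<exists>C r. 0 < C \<and> 0 < r \<and> (\<forall>y \<in> closure \<Omega> \<inter> ball x r. \<exists>w.
    closed_segment x w \<subseteq> closure \<Omega> \<and> closed_segment w y \<subseteq> closure \<Omega> \<and> norm (w - x) \<le> C * norm (y - x))"
proof -
  obtain R where R: "R > 0" "cball x R \<subseteq> V" using open_V assms by (auto simp: open_contains_cball)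
  have "compact (grad \<gamma> ` cball x R)"
    by (intro compact_continuous_image continuous_on_subset[OF cont_grad]) auto
  then obtain L where L: "L > 0" "\<And>y. y \<in> cball x R \<Longrightarrow> norm (grad \<gamma> y) \<le> L"
    using compact_imp_bounded bounded_pos by (metis image_eqI)
  have lip: "\<bar>\<gamma> a - \<gamma> b\<bar> \<le> L * norm (a - b)" if "a \<in> cball x R" "b \<in> cball x R" for a b
  proof -
    have "norm (\<gamma> a - \<gamma> b) \<le> L * norm (a - b)"
    proof (rule differentiable_bound[OF convex_cball _ _ that])
      show "(\<gamma> has_derivative (\<lambda>v. grad \<gamma> y \<bullet> v)) (at y within cball x R)" for y
        by (rule has_derivative_at_withinI[OF deriv_\<gamma>])
      show "onorm (\<lambda>v. grad \<gamma> y \<bullet> v) \<le> L" if "y \<in> cball x R" for y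
      proof (rule onorm_bound)
        show "norm (grad \<gamma> y \<bullet> v) \<le> L * norm v" for v
          using Cauchy_Schwarz_ineq2[of "grad \<gamma> y" v] mult_right_mono[OF L(2)[OF that] norm_ge_zero[of v]] by simp
      qed (use L in simp)
    qed
    then show ?thesis by simp
  qed
  \<comment> \<open>\<open>L\<close> pays for the variation of \<gamma> along the second segment and
    \<open>1\<close> for that of the height. The radius below makes \<open>C * r + r\<close> equal
    to \<open>R\<close>, so that \<open>w\<close> and \<open>y\<close> stay in the ball where
    \<open>L\<close> is valid.\<close>
  define C where "C = L + 1"
  define r where "r = R / (C + 1)"
  have C: "C > 0" and r: "r > 0" "r * (C + 1) = R" using L R by (auto simp: C_def r_def)
  have "\<exists>w. closed_segment x w \<subseteq> closure \<Omega> \<and> closed_segment w y \<subseteq> closure \<Omega> \<and> norm (w - x) \<le> C * norm (y - x)"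
    if y: "y \<in> closure \<Omega>" "y \<in> ball x r" for y
  proof -
    define M where "M = C * norm (y - x)"
    define w where "w = x - M *\<^sub>R e"
    have nyx: "norm (y - x) < r" using y by (simp add: dist_norm norm_minus_commute)
    have M: "M \<ge> 0" "M \<le> C * r" using C nyx by (auto simp: M_def)
    have CrR: "C * r + r = R" using r by (simp add: algebra_simps)
    have "y \<in> cball x R" using y CrR C r by (auto simp: intro: order_trans[OF less_imp_le])
    have "norm (M *\<^sub>R e) \<le> R" using M CrR r(1) by simp
    then have wR: "w \<in> cball x R" by (simp add: w_def dist_norm)
    have xR: "x \<in> cball x R" using R by simp
    have yR: "y \<in> cball x R" by fact
    have yV: "y \<in> V" using yR R by auto
    have "x \<in> closure \<Omega> \<inter> V" "y \<in> closure \<Omega> \<inter> V" using assms y yV by auto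
    then have xg: "x \<bullet> e \<le> \<gamma> x" and yg: "y \<bullet> e \<le> \<gamma> y" unfolding closure_V by auto
    have 1: "closed_segment x w \<subseteq> closure \<Omega>"
    proof
      fix z assume "z \<in> closed_segment x w"
      then obtain u where u: "0 \<le> u" "u \<le> 1" "z = x + (- (u * M)) *\<^sub>R e"
        by (auto simp: closed_segment_def w_def algebra_simps)
      have "z \<in> cball x R"
        using \<open>z \<in> closed_segment x w\<close> closed_segment_subset[OF xR wR convex_cball] by blast
      moreover have "z \<bullet> e \<le> \<gamma> z" unfolding u(3) inv using xg mult_nonneg_nonneg[OF u(1) M(1)] by (simp add: inner_diff_left)
      ultimately have "z \<in> closure \<Omega> \<inter> V" unfolding closure_V using R(2) by auto
      then show "z \<in> closure \<Omega>" by simp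
    qed
    have 2: "closed_segment w y \<subseteq> closure \<Omega>"
    proof
      fix z assume zs: "z \<in> closed_segment w y"
      then obtain u where u: "0 \<le> u" "u \<le> 1" "z = (1 - u) *\<^sub>R w + u *\<^sub>R y"
        by (auto simp: closed_segment_def)
      \<comment> \<open>\<open>z\<close> is \<open>p\<close> lowered by \<open>(1 - u) * M\<close>,
        so \<gamma> agrees at both; \<open>p\<close> lies on the segment from \<open>x\<close> to
        \<open>y\<close> and is compared with \<open>y\<close>, at distance
        \<open>(1 - u) * norm (y - x)\<close>.\<close>
      define p where "p = (1 - u) *\<^sub>R x + u *\<^sub>R y"
      have z: "z = p + (- ((1 - u) * M)) *\<^sub>R e" using u(3) by (simp add: p_def w_def algebra_simps)
      have zR: "z \<in> cball x R" using zs closed_segment_subset[OF wR yR convex_cball] by blast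
      have "p \<in> cball x R" unfolding p_def using xR yR u
        by (intro convexD[OF convex_cball]) auto
      have yp: "y - p = (1 - u) *\<^sub>R (y - x)" by (simp add: p_def algebra_simps)
      have l: "\<bar>\<gamma> y - \<gamma> p\<bar> \<le> L * ((1 - u) * norm (y - x))"
        using lip[OF yR \<open>p \<in> cball x R\<close>] u by (simp add: yp)
      have cs: "\<bar>(y - p) \<bullet> e\<bar> \<le> (1 - u) * norm (y - x)"
        using Cauchy_Schwarz_ineq2[of "y - p" e] u by (simp add: yp)
      have m: "(1 - u) * M = L * ((1 - u) * norm (y - x)) + (1 - u) * norm (y - x)"
        by (simp add: M_def C_def algebra_simps)
      have "z \<bullet> e = p \<bullet> e - (1 - u) * M" by (simp add: z inner_diff_left)
      moreover have "\<gamma> z = \<gamma> p" unfolding z by (rule inv)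
      ultimately have "z \<bullet> e \<le> \<gamma> z"
        using yg l cs m by (simp add: inner_diff_left abs_le_iff)
      then have "z \<in> closure \<Omega> \<inter> V" unfolding closure_V using R(2) zR by auto
      then show "z \<in> closure \<Omega>" by simp
    qed
    have "norm (w - x) \<le> C * norm (y - x)" using M by (simp add: w_def M_def)
    then show ?thesis using 1 2 by blast
  qed
  then show ?thesis using C r by blast
qed

text \<open>This replaces convexity in mean value arguments on \<open>closure \<Omega>\<close>: in \<^const>\<open>C_k\<close> derivatives are taken pointwise
  within the set, so that bounds uniform up to the boundary need paths of controlled length.\<close>

lemma smooth_boundary_path:
  assumes "open \<Omega>" "smooth_boundary \<Omega>" "x \<in> closure \<Omega>"
  shows "\<exists>C r. 0 < C \<and> 0 < r \<and> (\<forall>y \<in> closure \<Omega> \<inter> ball x r. \<exists>w.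
    closed_segment x w \<subseteq> closure \<Omega> \<and> closed_segment w y \<subseteq> closure \<Omega> \<and> norm (w - x) \<le> C * norm (y - x))"
proof (cases "x \<in> \<Omega>")
  case True
  then obtain r where r: "r > 0" "ball x r \<subseteq> \<Omega>" using assms by (auto simp: open_contains_ball)
  have "closed_segment x y \<subseteq> closure \<Omega>" if "y \<in> ball x r" for y
    using closed_segment_subset[OF _ that convex_ball] r closure_subset by force
  then show ?thesis using r assms
    by (intro exI[of _ 1] exI[of _ r] conjI ballI exI[of _ x]) auto
next
  case False
  then have "x \<in> frontier \<Omega>" using assms by (simp add: frontier_def interior_open)
  then obtain V e \<gamma> where "x \<in> V" "boundary_chart \<Omega> V e \<gamma>"
    using assms by (auto simp: smooth_boundary_def)
  then show ?thesis using chart.local_path[of \<Omega> V e \<gamma> x] assms by (auto simp: chart_def)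
qed

section \<open>The divergence theorem below a graph\<close>

lemma nn_integral_lborel_shift:
  fixes c :: "'a::euclidean_space"
  assumes [measurable]: "g \<in> borel_measurable borel"
  shows "(\<integral>\<^sup>+x. g (x + c) \<partial>lborel) = (\<integral>\<^sup>+x. g x \<partial>lborel)"
proof -
  have "(\<integral>\<^sup>+x. g x \<partial>lborel) = (\<integral>\<^sup>+x. g x \<partial>distr lborel borel ((+) c))"
    by (simp add: lborel_distr_plus)
  also have "\<dots> = (\<integral>\<^sup>+x. g (c + x) \<partial>lborel)" by (subst nn_integral_distr) auto
  finally show ?thesis by (simp add: add.commute)
qed

text \<open>A slab of thickness one meets every line parallel to \<open>v\<close> in a segment of length one.\<close>

lemma nn_integral_slice:
  fixes v :: "'a::euclidean_space"
  assumes v: "norm v = 1" and [measurable]: "g \<in> borel_measurable borel"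
  shows "(\<integral>\<^sup>+x. g x \<partial>lborel) =
    (\<integral>\<^sup>+x. indicator {x. 0 \<le> x \<bullet> v \<and> x \<bullet> v \<le> 1} x * (\<integral>\<^sup>+s. g (x + s *\<^sub>R v) \<partial>lborel) \<partial>lborel)"
proof -
  let ?A = "{x. 0 \<le> x \<bullet> v \<and> x \<bullet> v \<le> 1}"
  have vv: "v \<bullet> v = 1" using v by (simp add: norm_eq_1)
  have A[measurable]: "?A \<in> sets borel" by measurable
  have "(\<integral>\<^sup>+x. indicator ?A x * (\<integral>\<^sup>+s. g (x + s *\<^sub>R v) \<partial>lborel) \<partial>lborel) =
      (\<integral>\<^sup>+x. \<integral>\<^sup>+s. indicator ?A x * g (x + s *\<^sub>R v) \<partial>lborel \<partial>lborel)"
    by (intro nn_integral_cong nn_integral_cmult[symmetric]) measurable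
  also have "\<dots> = (\<integral>\<^sup>+s. \<integral>\<^sup>+x. indicator ?A x * g (x + s *\<^sub>R v) \<partial>lborel \<partial>lborel)"
    by (rule lborel_pair.Fubini'[symmetric]) measurable
  \<comment> \<open>For fixed \<open>s\<close> a translation moves the shift from \<open>g\<close>
    to the slab. After a second exchange, the integral of the slab indicator over \<open>s\<close>
    is the length of a unit interval.\<close>
  also have "\<dots> = (\<integral>\<^sup>+s. \<integral>\<^sup>+x. indicator ?A (x + (- s) *\<^sub>R v) * g x \<partial>lborel \<partial>lborel)"
  proof (rule nn_integral_cong)
    fix s :: real
    have "(\<integral>\<^sup>+x. indicator ?A x * g (x + s *\<^sub>R v) \<partial>lborel) =
        (\<integral>\<^sup>+x. indicator ?A (x + (- s) *\<^sub>R v) * g (x + (- s) *\<^sub>R v + s *\<^sub>R v) \<partial>lborel)"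
      by (rule nn_integral_lborel_shift[symmetric]) measurable
    then show "(\<integral>\<^sup>+x. indicator ?A x * g (x + s *\<^sub>R v) \<partial>lborel) =
        (\<integral>\<^sup>+x. indicator ?A (x + (- s) *\<^sub>R v) * g x \<partial>lborel)" by simp
  qed
  also have "\<dots> = (\<integral>\<^sup>+x. \<integral>\<^sup>+s. indicator ?A (x + (- s) *\<^sub>R v) * g x \<partial>lborel \<partial>lborel)"
    by (rule lborel_pair.Fubini') measurable
  also have "\<dots> = (\<integral>\<^sup>+x. g x \<partial>lborel)"
  proof (rule nn_integral_cong)
    fix x :: 'a
    have "indicator ?A (x + (- s) *\<^sub>R v) = (indicator {x \<bullet> v - 1 .. x \<bullet> v} s :: ennreal)" for s
      by (auto simp: indicator_def inner_diff_left vv)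
    then have "(\<integral>\<^sup>+s. indicator ?A (x + (- s) *\<^sub>R v) * g x \<partial>lborel) =
        (\<integral>\<^sup>+s. g x * indicator {x \<bullet> v - 1 .. x \<bullet> v} s \<partial>lborel)"
      by (simp only: mult.commute)
    also have "\<dots> = g x" by (simp add: nn_integral_cmult_indicator)
    finally show "(\<integral>\<^sup>+s. indicator ?A (x + (- s) *\<^sub>R v) * g x \<partial>lborel) = g x" .
  qed
  finally show ?thesis by simp
qed

text \<open>Applied to indicators, \<open>nn_integral_slice\<close> says that Lebesgue measure is
  the image of slab times line under \<open>x + s *\<^sub>R v\<close>. As an identity of measures it
  carries over integrability and signed integrals.\<close>

lemma integral_slice:
  fixes v :: "'a::euclidean_space" and G :: "'a \<Rightarrow> real"
  assumes v: "norm v = 1" and G: "integrable lborel G"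
  shows "(\<integral>x. G x \<partial>lborel) =
    (\<integral>x. indicator {x. 0 \<le> x \<bullet> v \<and> x \<bullet> v \<le> 1} x * (\<integral>s. G (x + s *\<^sub>R v) \<partial>lborel) \<partial>lborel)"
proof -
  let ?A = "{x. 0 \<le> x \<bullet> v \<and> x \<bullet> v \<le> 1}"
  let ?P = "lborel \<Otimes>\<^sub>M lborel :: ('a \<times> real) measure"
  let ?h = "\<lambda>(x, s). x + s *\<^sub>R v"
  have [measurable]: "G \<in> borel_measurable borel" using G by auto
  have A[measurable]: "?A \<in> sets borel" by measurable
  define D where "D = density ?P (\<lambda>p. ennreal (indicator ?A (fst p)))"
  have eq: "distr D borel ?h = lborel"
  proof (rule measure_eqI)
    fix B assume "B \<in> sets (distr D borel ?h)"
    then have B[measurable]: "B \<in> sets borel" by simp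
    have "emeasure (distr D borel ?h) B = (\<integral>\<^sup>+p. indicator B p \<partial>distr D borel ?h)" by simp
    also have "\<dots> = (\<integral>\<^sup>+p. indicator B (?h p) \<partial>D)"
      by (rule nn_integral_distr) (auto simp: D_def)
    also have "\<dots> = (\<integral>\<^sup>+p. indicator ?A (fst p) * indicator B (?h p) \<partial>?P)"
      unfolding D_def by (subst nn_integral_density) (auto simp: ennreal_indicator)
    also have "\<dots> = (\<integral>\<^sup>+x. \<integral>\<^sup>+s. indicator ?A x * indicator B (x + s *\<^sub>R v) \<partial>lborel \<partial>lborel)"
      by (subst lborel.nn_integral_fst[symmetric]) auto
    also have "\<dots> = (\<integral>\<^sup>+x. indicator ?A x * (\<integral>\<^sup>+s. indicator B (x + s *\<^sub>R v) \<partial>lborel) \<partial>lborel)"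
      by (intro nn_integral_cong nn_integral_cmult) measurable
    also have "\<dots> = emeasure lborel B"
      by (subst nn_integral_slice[OF v, symmetric]) auto
    finally show "emeasure (distr D borel ?h) B = emeasure lborel B" .
  qed simp
  have "integrable (distr D borel ?h) G" using G by (simp add: eq)
  then have "integrable D (\<lambda>p. G (?h p))"
    by (subst (asm) integrable_distr_eq) (auto simp: D_def)
  then have int: "integrable ?P (\<lambda>(x, s). indicator ?A x * G (x + s *\<^sub>R v))"
    unfolding D_def by (subst (asm) integrable_real_density) (auto simp: case_prod_unfold)
  have "(\<integral>x. G x \<partial>lborel) = (\<integral>p. G p \<partial>distr D borel ?h)" by (simp add: eq)
  also have "\<dots> = (\<integral>p. G (?h p) \<partial>D)" by (rule integral_distr) (auto simp: D_def)
  also have "\<dots> = (\<integral>(x, s). indicator ?A x * G (x + s *\<^sub>R v) \<partial>?P)"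
    unfolding D_def by (subst integral_real_density) (auto simp: case_prod_unfold)
  also have "\<dots> = (\<integral>x. \<integral>s. indicator ?A x * G (x + s *\<^sub>R v) \<partial>lborel \<partial>lborel)"
    by (rule lborel_pair.integral_fst[OF int, symmetric])
  also have "\<dots> = (\<integral>x. indicator ?A x * (\<integral>s. G (x + s *\<^sub>R v) \<partial>lborel) \<partial>lborel)"
    by simp
  finally show ?thesis .
qed

lemma integrable_bounded_support:
  fixes G :: "'a::euclidean_space \<Rightarrow> real"
  assumes "G \<in> borel_measurable borel" "\<And>x. \<bar>G x\<bar> \<le> C" "\<And>x. norm x > M \<Longrightarrow> G x = 0"
  shows "integrable lborel G"
proof (rule integrableI_bounded_set[where A = "cball 0 M" and B = C])
  show "emeasure lborel (cball (0::'a) M) < \<infinity>" by (rule emeasure_lborel_cball_finite)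
qed (use assms in auto)

text \<open>Differentiability is asked in the open interval only, because functions on the closed
  region below a graph will be merely continuous at the graph point that ends the line.\<close>

lemma integral_FTC_lborel:
  fixes k k' :: "real \<Rightarrow> real"
  assumes ab: "a \<le> b" and "continuous_on {a..b} k"
    and "\<And>s. a < s \<Longrightarrow> s < b \<Longrightarrow> (k has_real_derivative k' s) (at s)"
    and out: "\<And>s. s \<le> a \<or> b \<le> s \<Longrightarrow> k' s = 0"
    and int: "integrable lborel k'"
  shows "(\<integral>s. k' s \<partial>lborel) = k b - k a"
proof -
  have "(k' has_integral (k b - k a)) {a..b}"
    using assms by (intro fundamental_theorem_of_calculus_interior)
      (auto simp: has_real_derivative_iff_has_vector_derivative)
  then have "((\<lambda>s. if s \<in> {a..b} then k' s else 0) has_integral (k b - k a)) UNIV"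
    by (simp only: has_integral_restrict_UNIV)
  moreover have "(\<lambda>s. if s \<in> {a..b} then k' s else 0) = k'"
    by (rule ext) (use out in auto)
  ultimately have "(k' has_integral (k b - k a)) UNIV" by simp
  moreover have "(k' has_integral (\<integral>s. k' s \<partial>lborel)) UNIV"
    using has_integral_integral_lborel[OF int] .
  ultimately show ?thesis by (rule has_integral_unique[symmetric])
qed

section \<open>The shear that flattens the boundary\<close>

context chart
begin

abbreviation (input) lower :: "'a set" where "lower \<equiv> {x. x \<bullet> e < \<gamma> x}"

abbreviation (input) slab :: "'a set" where "slab \<equiv> {x. 0 \<le> x \<bullet> e \<and> x \<bullet> e \<le> 1}"

lemma open_lower: "open lower"
  by (intro open_Collect_less continuous_intros cont_\<gamma>)

text \<open>On every line parallel to \<open>e\<close> the shear is a translation, by the constant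
  value of \<gamma> on that line; slicing in direction \<open>e\<close> reduces the claim to
  translation invariance on the real line.\<close>

lemma shear_measure_preserving: "distr lborel borel (\<lambda>y. y + \<gamma> y *\<^sub>R e) = lborel"
proof (rule measure_eqI)
  fix B assume "B \<in> sets (distr lborel borel (\<lambda>y. y + \<gamma> y *\<^sub>R e))"
  then have B[measurable]: "B \<in> sets borel" by simp
  have [measurable]: "\<gamma> \<in> borel_measurable borel"
    using cont_\<gamma> by (rule borel_measurable_continuous_onI)
  have "emeasure (distr lborel borel (\<lambda>y. y + \<gamma> y *\<^sub>R e)) B =
      (\<integral>\<^sup>+p. indicator B p \<partial>distr lborel borel (\<lambda>y. y + \<gamma> y *\<^sub>R e))" by simp
  also have "\<dots> = (\<integral>\<^sup>+y. indicator B (y + \<gamma> y *\<^sub>R e) \<partial>lborel)"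
    by (rule nn_integral_distr) auto
  also have "\<dots> = (\<integral>\<^sup>+x. indicator slab x *
      (\<integral>\<^sup>+s. indicator B (x + s *\<^sub>R e + \<gamma> (x + s *\<^sub>R e) *\<^sub>R e) \<partial>lborel) \<partial>lborel)"
    by (rule nn_integral_slice) auto
  also have "\<dots> = (\<integral>\<^sup>+x. indicator slab x *
      (\<integral>\<^sup>+s. indicator B (x + (s + \<gamma> x) *\<^sub>R e) \<partial>lborel) \<partial>lborel)"
    by (simp add: inv scaleR_add_left add.assoc)
  also have "\<dots> = (\<integral>\<^sup>+x. indicator slab x * (\<integral>\<^sup>+s. indicator B (x + s *\<^sub>R e) \<partial>lborel) \<partial>lborel)"
    by (subst nn_integral_lborel_shift[where g = "\<lambda>s. indicator B (x + s *\<^sub>R e)" for x]) auto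
  also have "\<dots> = (\<integral>\<^sup>+x. indicator B x \<partial>lborel)"
    by (rule nn_integral_slice[symmetric]) auto
  finally show "emeasure (distr lborel borel (\<lambda>y. y + \<gamma> y *\<^sub>R e)) B = emeasure lborel B" by simp
qed simp

end

text \<open>The local ingredient of the divergence theorem: a localised function, extended by zero
  from the part of \<Omega> in the chart to the whole region below the graph.\<close>

locale chart_function = chart +
  fixes g :: "'a \<Rightarrow> real" and Dg :: "'a \<Rightarrow> 'a \<Rightarrow> real" and B M :: real
  assumes cont_g: "continuous_on {x. x \<bullet> e \<le> \<gamma> x} g"
    and der_g: "\<And>x. x \<bullet> e < \<gamma> x \<Longrightarrow> (g has_derivative Dg x) (at x)"
    and cont_Dg: "\<And>b. b \<in> Basis \<Longrightarrow> continuous_on {x. x \<bullet> e < \<gamma> x} (\<lambda>x. Dg x b)"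
    and bd_Dg: "\<And>x b. x \<bullet> e < \<gamma> x \<Longrightarrow> b \<in> Basis \<Longrightarrow> \<bar>Dg x b\<bar> \<le> B"
    and supp_g: "\<And>x. M < norm x \<Longrightarrow> x \<bullet> e \<le> \<gamma> x \<Longrightarrow> g x = 0"
begin

lemma lin_Dg: "x \<bullet> e < \<gamma> x \<Longrightarrow> linear (Dg x)"
  using der_g has_derivative_linear by blast

lemma Dg_e_bd: "x \<bullet> e < \<gamma> x \<Longrightarrow> \<bar>Dg x e\<bar> \<le> B"
  using e_Basis bd_Dg[of x e] bd_Dg[of x "- e"] linear_neg[OF lin_Dg, of x e] by auto

lemma Dg_e_cont: "continuous_on {x. x \<bullet> e < \<gamma> x} (\<lambda>x. Dg x e)"
  by (rule continuous_on_linear_Basis[OF _ cont_Dg continuous_on_const]) (use lin_Dg in auto)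

lemma Dg_zero:
  assumes "M < norm x" "x \<bullet> e < \<gamma> x"
  shows "Dg x v = 0"
proof -
  let ?U = "- cball 0 M \<inter> {x. x \<bullet> e < \<gamma> x}"
  have "open ?U" by (intro open_Int open_lower) (simp add: open_Compl)
  then have "(g has_derivative (\<lambda>v. 0)) (at x)"
    by (rule has_derivative_transform_within_open[OF has_derivative_const[of 0]])
      (use assms supp_g in auto)
  then have "Dg x = (\<lambda>v. 0)" using der_g[OF assms(2)] by (blast intro: has_derivative_unique)
  then show ?thesis by simp
qed

lemma lower_indicator_measurable:
  assumes "continuous_on {x. x \<bullet> e < \<gamma> x} h"
  shows "(\<lambda>x. indicator {x. x \<bullet> e < \<gamma> x} x * h x :: real) \<in> borel_measurable borel"
  using borel_measurable_continuous_on_indicator[OF borel_open[OF open_lower] assms] by simp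

text \<open>On each line parallel to \<open>e\<close> the weight \<omega> is constant, so the
  fundamental theorem applies and only the end point on the graph contributes. The weights needed
  later are constants and a component of the negative gradient of \<gamma>.\<close>

lemma integral_normal_derivative:
  fixes \<omega> :: "'a \<Rightarrow> real"
  assumes cont\<omega>: "continuous_on UNIV \<omega>" and inv\<omega>: "\<And>x s. \<omega> (x + s *\<^sub>R e) = \<omega> x"
  shows "integrable lborel (\<lambda>x. indicator {x. x \<bullet> e < \<gamma> x} x * (\<omega> x * Dg x e))" (is ?int)
    and "(\<integral>x. indicator {x. x \<bullet> e < \<gamma> x} x * (\<omega> x * Dg x e) \<partial>lborel) =
      (\<integral>x. indicator {x. 0 \<le> x \<bullet> e \<and> x \<bullet> e \<le> 1} x * (\<omega> x * g (graph x)) \<partial>lborel)"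
proof -
  define G where "G x = indicator {x. x \<bullet> e < \<gamma> x} x * (\<omega> x * Dg x e)" for x
  have meas[measurable]: "G \<in> borel_measurable borel"
    unfolding G_def[abs_def]
    by (intro lower_indicator_measurable continuous_intros Dg_e_cont continuous_on_subset[OF cont\<omega>]) auto
  have "compact (\<omega> ` cball 0 M)"
    by (intro compact_continuous_image continuous_on_subset[OF cont\<omega>]) auto
  then obtain W where W: "\<And>x. x \<in> cball 0 M \<Longrightarrow> norm (\<omega> x) \<le> W"
    using compact_imp_bounded bounded_iff by (metis image_eqI)
  have zero: "G x = 0" if "M < norm x" for x
    using Dg_zero[OF that] by (auto simp: G_def indicator_def)
  have bd: "\<bar>G x\<bar> \<le> \<bar>W\<bar> * \<bar>B\<bar>" for x
  proof (cases "x \<bullet> e < \<gamma> x \<and> norm x \<le> M")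
    case True
    have "\<bar>\<omega> x\<bar> * \<bar>Dg x e\<bar> \<le> \<bar>W\<bar> * \<bar>B\<bar>"
      using W[of x] Dg_e_bd[of x] True by (intro mult_mono) auto
    then show ?thesis using True by (simp add: G_def abs_mult)
  next
    case False
    then have "G x = 0" using zero[of x] by (auto simp: G_def)
    then show ?thesis by simp
  qed
  have int: "integrable lborel G"
    by (rule integrable_bounded_support[OF meas bd zero])
  then show ?int unfolding G_def[abs_def] .
  have inner: "(\<integral>s. G (x + s *\<^sub>R e) \<partial>lborel) = \<omega> x * g (graph x)" for x
  proof -
    define s0 where "s0 = \<gamma> x - x \<bullet> e"
    \<comment> \<open>The first entry puts the lower end point beyond the support of
      \<open>g\<close>, the second puts it below the graph point at \<open>s0\<close>.\<close>
    define a where "a = min (- (\<bar>M\<bar> + norm x + 1)) (s0 - 1)"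
    have low: "(x + s *\<^sub>R e) \<bullet> e < \<gamma> (x + s *\<^sub>R e) \<longleftrightarrow> s < s0" "(x + s *\<^sub>R e) \<bullet> e \<le> \<gamma> (x + s *\<^sub>R e) \<longleftrightarrow> s \<le> s0" for s
      by (auto simp: inv s0_def inner_add_left)
    have far: "M < norm (x + s *\<^sub>R e)" if "\<bar>s\<bar> > \<bar>M\<bar> + norm x" for s
      using norm_triangle_ineq4[of "x + s *\<^sub>R e" x] that by simp
    have fara: "M < norm (x + s *\<^sub>R e)" if "s \<le> a" for s
    proof (rule far)
      have "s \<le> - (\<bar>M\<bar> + norm x + 1)" using that by (simp add: a_def)
      moreover have "- s \<le> \<bar>s\<bar>" by simp
      ultimately show "\<bar>M\<bar> + norm x < \<bar>s\<bar>" by linarith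
    qed
    have m: "(\<lambda>s. G (x + s *\<^sub>R e)) \<in> borel_measurable borel" by measurable
    have i: "integrable lborel (\<lambda>s. G (x + s *\<^sub>R e))"
      by (rule integrable_bounded_support[OF m bd, of "\<bar>M\<bar> + norm x"]) (use far zero in auto)
    have "(\<integral>s. G (x + s *\<^sub>R e) \<partial>lborel) = \<omega> x * g (x + s0 *\<^sub>R e) - \<omega> x * g (x + a *\<^sub>R e)"
    proof (rule integral_FTC_lborel[where k = "\<lambda>s. \<omega> x * g (x + s *\<^sub>R e)", OF _ _ _ _ i])
      show "a \<le> s0" by (simp add: a_def)
      show "continuous_on {a..s0} (\<lambda>s. \<omega> x * g (x + s *\<^sub>R e))"
        by (intro continuous_intros continuous_on_compose2[OF cont_g]) (auto simp: low)
      show "((\<lambda>s. \<omega> x * g (x + s *\<^sub>R e)) has_real_derivative G (x + s *\<^sub>R e)) (at s)"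
        if "a < s" "s < s0" for s
      proof -
        have lt: "(x + s *\<^sub>R e) \<bullet> e < \<gamma> (x + s *\<^sub>R e)" using low that by simp
        have "((\<lambda>s. g (x + s *\<^sub>R e)) has_derivative (\<lambda>h. Dg (x + s *\<^sub>R e) (h *\<^sub>R e))) (at s)"
          by (rule has_derivative_compose[where f = "\<lambda>s. x + s *\<^sub>R e", OF _ der_g[OF lt]]) (auto intro!: derivative_eq_intros)
        then have "((\<lambda>s. g (x + s *\<^sub>R e)) has_real_derivative Dg (x + s *\<^sub>R e) e) (at s)"
          unfolding has_field_derivative_def
          by (rule has_derivative_eq_rhs) (auto simp: linear_cmul[OF lin_Dg[OF lt]])
        from DERIV_cmult[OF this, of "\<omega> x"] show ?thesis
          using lt by (simp add: G_def inv\<omega>)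
      qed
      show "G (x + s *\<^sub>R e) = 0" if "s \<le> a \<or> s0 \<le> s" for s
        using that fara[of s] zero low(1)[of s] by (auto simp: G_def)
    qed
    moreover have "g (x + a *\<^sub>R e) = 0"
      by (rule supp_g) (use fara[of a] low(2)[of a] in \<open>auto simp: a_def\<close>)
    ultimately show ?thesis by (simp add: graph_def s0_def)
  qed
  have "(\<integral>x. G x \<partial>lborel) = (\<integral>x. indicator {x. 0 \<le> x \<bullet> e \<and> x \<bullet> e \<le> 1} x * (\<integral>s. G (x + s *\<^sub>R e) \<partial>lborel) \<partial>lborel)"
    by (rule integral_slice[OF norm_e int])
  then show "(\<integral>x. indicator {x. x \<bullet> e < \<gamma> x} x * (\<omega> x * Dg x e) \<partial>lborel) =
      (\<integral>x. indicator {x. 0 \<le> x \<bullet> e \<and> x \<bullet> e \<le> 1} x * (\<omega> x * g (graph x)) \<partial>lborel)"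
    by (simp only: inner) (simp only: G_def)
qed

text \<open>The integrand, moved by the shear, is the derivative of \<open>g \<circ> \<Phi>\<close>
  in direction \<open>b\<close>. The sheared region is a half-space containing with each point the
  full line in direction \<open>b\<close>, so compact support makes every line integral
  zero.\<close>

lemma integral_tangential_derivative:
  assumes b: "b \<in> Basis" "b \<bullet> e = 0"
  shows "(\<integral>x. indicator {x. x \<bullet> e < \<gamma> x} x * (Dg x b + (grad \<gamma> x \<bullet> b) * Dg x e) \<partial>lborel) = 0"
    and "integrable lborel (\<lambda>x. indicator {x. x \<bullet> e < \<gamma> x} x * Dg x b)"
proof -
  define G1 where "G1 x = indicator {x. x \<bullet> e < \<gamma> x} x * Dg x b" for x
  define G where "G x = G1 x + indicator {x. x \<bullet> e < \<gamma> x} x * ((grad \<gamma> x \<bullet> b) * Dg x e)" for x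
  define \<Phi> where "\<Phi> y = y + \<gamma> y *\<^sub>R e" for y
  have [measurable]: "G1 \<in> borel_measurable borel"
    unfolding G1_def[abs_def] by (intro lower_indicator_measurable cont_Dg b)
  have i1: "integrable lborel G1"
  proof (rule integrable_bounded_support)
    show "\<bar>G1 x\<bar> \<le> \<bar>B\<bar>" for x using bd_Dg[of x b] b by (auto simp: G1_def indicator_def)
    show "norm x > M \<Longrightarrow> G1 x = 0" for x using Dg_zero[of x] by (auto simp: G1_def indicator_def)
  qed measurable
  then show "integrable lborel (\<lambda>x. indicator {x. x \<bullet> e < \<gamma> x} x * Dg x b)" by (simp add: G1_def[abs_def])
  have i: "integrable lborel G"
    unfolding G_def[abs_def]
    by (intro Bochner_Integration.integrable_add i1 integral_normal_derivative)
      (auto intro!: continuous_intros cont_grad simp: grad_inv)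
  then have [measurable]: "G \<in> borel_measurable borel" by auto
  have zero: "G x = 0" if "M < norm x" for x
    using Dg_zero[OF that] by (auto simp: G_def G1_def indicator_def)
  have cont\<Phi>: "continuous_on S \<Phi>" for S
    unfolding \<Phi>_def[abs_def] by (intro continuous_intros cont_\<gamma>)
  then have [measurable]: "\<Phi> \<in> borel_measurable borel" by (rule borel_measurable_continuous_onI)
  have dist: "distr lborel borel \<Phi> = lborel"
    using shear_measure_preserving by (simp add: \<Phi>_def[abs_def])
  have iG\<Phi>: "integrable lborel (\<lambda>y. G (\<Phi> y))"
    using i by (subst integrable_distr_eq[symmetric, where N = borel]) (auto simp: dist)
  have gr: "grad \<gamma> (\<Phi> y) = grad \<gamma> y" and low: "\<Phi> y \<bullet> e < \<gamma> (\<Phi> y) \<longleftrightarrow> y \<bullet> e < 0" for y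
    by (auto simp: \<Phi>_def grad_inv inv inner_add_left)
  have bb: "b \<bullet> b = 1" "norm b = 1" using b by (auto simp: inner_Basis)
  have eb: "e \<bullet> b = 0" using b by (simp add: inner_commute)
  have inner: "(\<integral>s. G (\<Phi> (y + s *\<^sub>R b)) \<partial>lborel) = 0" for y
  proof (cases "y \<bullet> e < 0")
    case False
    then have "G (\<Phi> (y + s *\<^sub>R b)) = 0" for s
      using low[of "y + s *\<^sub>R b"] b(2) by (simp add: G_def G1_def inner_add_left)
    then show ?thesis by simp
  next
    case True
    have lt: "\<Phi> (y + s *\<^sub>R b) \<bullet> e < \<gamma> (\<Phi> (y + s *\<^sub>R b))" for s
      using low[of "y + s *\<^sub>R b"] b(2) True by (simp add: inner_add_left)
    \<comment> \<open>The shear moves points along \<open>e\<close> only and keeps the coordinate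
      along \<open>b\<close>; that coordinate alone drives the point out of the support.\<close>
    define a where "a = \<bar>M\<bar> + norm y + 1"
    have far: "M < norm (\<Phi> (y + s *\<^sub>R b))" if "a \<le> \<bar>s\<bar>" for s
    proof -
      have "\<Phi> (y + s *\<^sub>R b) \<bullet> b = y \<bullet> b + s" by (simp add: \<Phi>_def inner_add_left bb eb)
      moreover have "\<bar>\<Phi> (y + s *\<^sub>R b) \<bullet> b\<bar> \<le> norm (\<Phi> (y + s *\<^sub>R b))"
        using Cauchy_Schwarz_ineq2[of "\<Phi> (y + s *\<^sub>R b)" b] bb by simp
      moreover have "\<bar>y \<bullet> b\<bar> \<le> norm y" using Cauchy_Schwarz_ineq2[of y b] bb by simp
      ultimately show ?thesis using that by (simp add: a_def)
    qed
    have der: "((\<lambda>s. g (\<Phi> (y + s *\<^sub>R b))) has_real_derivative G (\<Phi> (y + s *\<^sub>R b))) (at s)" for s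
    proof -
      define p where "p = \<Phi> (y + s *\<^sub>R b)"
      have "((\<lambda>s. \<gamma> (y + s *\<^sub>R b)) has_derivative (\<lambda>h. grad \<gamma> (y + s *\<^sub>R b) \<bullet> (h *\<^sub>R b))) (at s)"
        by (rule has_derivative_compose[OF _ deriv_\<gamma>]) (auto intro!: derivative_eq_intros)
      then have "((\<lambda>s. \<Phi> (y + s *\<^sub>R b)) has_derivative
          (\<lambda>h. h *\<^sub>R b + (grad \<gamma> (y + s *\<^sub>R b) \<bullet> (h *\<^sub>R b)) *\<^sub>R e)) (at s)"
        unfolding \<Phi>_def by (auto intro!: derivative_eq_intros)
      from has_derivative_compose[OF this der_g[OF lt]]
      have "((\<lambda>s. g (\<Phi> (y + s *\<^sub>R b))) has_derivative
          (\<lambda>h. Dg p (h *\<^sub>R b + (grad \<gamma> (y + s *\<^sub>R b) \<bullet> (h *\<^sub>R b)) *\<^sub>R e))) (at s)"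
        unfolding p_def .
      moreover have "Dg p (h *\<^sub>R b + (grad \<gamma> (y + s *\<^sub>R b) \<bullet> (h *\<^sub>R b)) *\<^sub>R e) =
          G p * h" for h
      proof -
        have l: "linear (Dg p)" using lin_Dg[OF lt[of s]] by (simp add: p_def)
        have "G p = Dg p b + (grad \<gamma> (y + s *\<^sub>R b) \<bullet> b) * Dg p e"
          using lt[of s] by (simp add: G_def G1_def p_def gr)
        then show ?thesis
          by (simp add: linear_add[OF l] linear_cmul[OF l] algebra_simps)
      qed
      ultimately show ?thesis unfolding has_field_derivative_def p_def by simp
    qed
    have i2: "integrable lborel (\<lambda>s. G (\<Phi> (y + s *\<^sub>R b)))"
    proof -
      have "continuous_on UNIV (\<lambda>s. G (\<Phi> (y + s *\<^sub>R b)))"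
      proof -
        have "continuous_on UNIV (\<lambda>s. Dg (\<Phi> (y + s *\<^sub>R b)) b + (grad \<gamma> (y + s *\<^sub>R b) \<bullet> b) * Dg (\<Phi> (y + s *\<^sub>R b)) e)"
          by (intro continuous_intros continuous_on_compose2[OF cont_Dg[OF b(1)]] continuous_on_compose2[OF cont\<Phi>]
              continuous_on_compose2[OF cont_grad] continuous_on_compose2[OF Dg_e_cont]) (auto simp: lt)
        then show ?thesis using lt by (simp add: G_def G1_def gr)
      qed
      then have c: "continuous_on {-a..a} (\<lambda>s. G (\<Phi> (y + s *\<^sub>R b)))" by (rule continuous_on_subset) auto
      have "set_integrable lborel {-a..a} (\<lambda>s. G (\<Phi> (y + s *\<^sub>R b)))"
        by (rule borel_integrable_compact[OF compact_Icc c, folded set_integrable_def])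
      moreover have "indicator {-a..a} s *\<^sub>R G (\<Phi> (y + s *\<^sub>R b)) = G (\<Phi> (y + s *\<^sub>R b))" for s
        using far[of s] zero by (cases "s \<in> {-a..a}") auto
      ultimately show ?thesis unfolding set_integrable_def by (simp only:)
    qed
    have "(\<integral>s. G (\<Phi> (y + s *\<^sub>R b)) \<partial>lborel) = g (\<Phi> (y + a *\<^sub>R b)) - g (\<Phi> (y + (-a) *\<^sub>R b))"
    proof (rule integral_FTC_lborel[where k = "\<lambda>s. g (\<Phi> (y + s *\<^sub>R b))", OF _ _ _ _ i2])
      show "- a \<le> a" by (simp add: a_def)
      show "continuous_on {- a..a} (\<lambda>s. g (\<Phi> (y + s *\<^sub>R b)))"
        by (intro DERIV_continuous_on[where D = "\<lambda>s. G (\<Phi> (y + s *\<^sub>R b))"] has_field_derivative_at_within[OF der])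
      show "G (\<Phi> (y + s *\<^sub>R b)) = 0" if "s \<le> - a \<or> a \<le> s" for s
        by (rule zero, rule far) (use that in auto)
    qed (rule der)
    also have "\<dots> = 0"
      using supp_g[OF far less_imp_le[OF lt]] by (simp add: a_def)
    finally show ?thesis .
  qed
  have "(\<integral>x. G x \<partial>lborel) = (\<integral>x. G x \<partial>distr lborel borel \<Phi>)" by (simp add: dist)
  also have "\<dots> = (\<integral>y. G (\<Phi> y) \<partial>lborel)" by (rule integral_distr) auto
  also have "\<dots> = 0"
    by (subst integral_slice[OF bb(2) iG\<Phi>]) (simp add: inner)
  finally show "(\<integral>x. indicator {x. x \<bullet> e < \<gamma> x} x * (Dg x b + (grad \<gamma> x \<bullet> b) * Dg x e) \<partial>lborel) = 0"
    by (simp add: G_def G1_def distrib_left)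
qed

text \<open>For \<open>b\<close> equal to \<open>e\<close> or \<open>- e\<close> this is the normal
  case with a constant weight. Otherwise the derivative along the graph is completed by adding and
  subtracting \<open>(grad \<gamma> x \<bullet> b) * Dg x e\<close>: the completed part integrates
  to zero, the correction is a normal derivative.\<close>

lemma divergence_below_graph:
  assumes b: "b \<in> Basis"
  shows "(\<integral>x. indicator {x. x \<bullet> e < \<gamma> x} x * Dg x b \<partial>lborel) =
    (\<integral>x. indicator {x. 0 \<le> x \<bullet> e \<and> x \<bullet> e \<le> 1} x * (g (graph x) * ((e - grad \<gamma> x) \<bullet> b)) \<partial>lborel)"
proof -
  consider "b = e" | "b = - e" | "b \<bullet> e = 0"
    using e_Basis b by (metis inner_minus_right inner_not_same_Basis minus_equation_iff neg_equal_0_iff_equal)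
  then show ?thesis
  proof cases
    case 1
    then show ?thesis using integral_normal_derivative(2)[of "\<lambda>_. 1"] grad_e
      by (simp add: inner_diff_left)
  next
    case 2
    have "(\<integral>x. indicator {x. x \<bullet> e < \<gamma> x} x * Dg x b \<partial>lborel) =
        (\<integral>x. indicator {x. x \<bullet> e < \<gamma> x} x * ((-1) * Dg x e) \<partial>lborel)"
      by (rule Bochner_Integration.integral_cong) (auto simp: 2 indicator_def linear_neg[OF lin_Dg])
    then show ?thesis using 2 integral_normal_derivative(2)[of "\<lambda>_. -1"] grad_e
      by (simp add: inner_diff_left)
  next
    case 3
    let ?L = "{x. x \<bullet> e < \<gamma> x}"
    have c: "continuous_on UNIV (\<lambda>x. - (grad \<gamma> x \<bullet> b))" by (intro continuous_intros cont_grad)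
    have i: "- (grad \<gamma> (x + s *\<^sub>R e) \<bullet> b) = - (grad \<gamma> x \<bullet> b)" for x s by (simp add: grad_inv)
    have "(\<integral>x. indicator ?L x * (Dg x b + (grad \<gamma> x \<bullet> b) * Dg x e) \<partial>lborel) +
          (\<integral>x. indicator ?L x * ((- (grad \<gamma> x \<bullet> b)) * Dg x e) \<partial>lborel) =
        (\<integral>x. indicator ?L x * (Dg x b + (grad \<gamma> x \<bullet> b) * Dg x e) +
          indicator ?L x * ((- (grad \<gamma> x \<bullet> b)) * Dg x e) \<partial>lborel)"
    proof (rule Bochner_Integration.integral_add[symmetric])
      have "integrable lborel (\<lambda>x. indicator ?L x * Dg x b - indicator ?L x * ((- (grad \<gamma> x \<bullet> b)) * Dg x e))"
        by (intro Bochner_Integration.integrable_diff integral_tangential_derivative(2)[OF b 3] integral_normal_derivative(1)[OF c i])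
      then show "integrable lborel (\<lambda>x. indicator ?L x * (Dg x b + (grad \<gamma> x \<bullet> b) * Dg x e))"
        by (simp add: distrib_left)
    qed (rule integral_normal_derivative(1)[OF c i])
    also have "\<dots> = (\<integral>x. indicator ?L x * Dg x b \<partial>lborel)"
      by (rule Bochner_Integration.integral_cong) (auto simp: algebra_simps)
    finally show ?thesis
      using integral_tangential_derivative(1)[OF b 3] integral_normal_derivative(2)[OF c i] 3
      by (simp add: inner_diff_left inner_commute[of e b] mult.commute)
  qed
qed

end

section \<open>Surface integrals and the divergence theorem\<close>

lemma continuous_on_compact_bound:
  fixes f :: "'a::topological_space \<Rightarrow> 'b::real_normed_vector"
  assumes "compact S" "continuous_on S f"
  obtains C where "0 \<le> C" "\<And>x. x \<in> S \<Longrightarrow> norm (f x) \<le> C"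
proof -
  have "bounded (f ` S)" using compact_imp_bounded[OF compact_continuous_image[OF assms(2,1)]] .
  then obtain C where "\<forall>x\<in>f ` S. norm x \<le> C" unfolding bounded_iff by blast
  then show ?thesis by (intro that[of "\<bar>C\<bar>"]) force+
qed

lemma C_k_sum: "(\<And>i. i \<in> I \<Longrightarrow> C_k k S (f i)) \<Longrightarrow> C_k k S (\<lambda>x. \<Sum>i\<in>I. f i x)"
  by (induction I rule: infinite_finite_induct) (auto intro: C_k_const C_k_add)

lemma C_k_1I:
  assumes "\<And>x. x \<in> S \<Longrightarrow> (f has_derivative D x) (at x within S)"
    "\<And>b. b \<in> Basis \<Longrightarrow> continuous_on S (\<lambda>x. D x b)"
  shows "C_k 1 S f"
  unfolding One_nat_def by (rule C_k_SucI[where D = D]) (use assms in auto)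

lemma C_k_1_inverse:
  fixes f :: "'a::euclidean_space \<Rightarrow> real"
  assumes f: "C_k 1 S f" and nz: "\<And>x. x \<in> S \<Longrightarrow> f x \<noteq> 0"
  shows "C_k 1 S (\<lambda>x. inverse (f x))"
proof -
  from f obtain D where D: "\<And>x. x \<in> S \<Longrightarrow> (f has_derivative D x) (at x within S)"
    "\<And>b. b \<in> Basis \<Longrightarrow> continuous_on S (\<lambda>x. D x b)" by (rule C_k_1E) (rule that, assumption+)
  show ?thesis
  proof (rule C_k_1I)
    show "((\<lambda>x. inverse (f x)) has_derivative (\<lambda>h. - (inverse (f x) * D x h * inverse (f x)))) (at x within S)"
      if "x \<in> S" for x by (rule Deriv.has_derivative_inverse[OF nz[OF that] D(1)[OF that]])
    show "continuous_on S (\<lambda>x. - (inverse (f x) * D x b * inverse (f x)))" if "b \<in> Basis" for b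
      by (intro continuous_intros D(2)[OF that] C_k_imp_continuous[OF f]) (use nz in auto)
  qed
qed

text \<open>Squaring the positive part makes it continuously differentiable across the sphere. A
  partition of unity of class \<open>C_k 1\<close> suffices for the divergence theorem.\<close>

definition bump :: "'a::real_inner \<Rightarrow> real \<Rightarrow> 'a \<Rightarrow> real" where
  "bump c r x = (max 0 (r\<^sup>2 - (x - c) \<bullet> (x - c)))\<^sup>2"

lemma bump_nonneg: "0 \<le> bump c r x" by (simp add: bump_def)

lemma bump_pos: "x \<in> ball c r \<Longrightarrow> 0 < bump c r x"
  using power_strict_mono[of "norm (x - c)" r 2]
  by (simp add: bump_def dist_norm norm_minus_commute[of c] power2_norm_eq_inner[symmetric])

lemma bump_zero: "x \<notin> cball c r \<Longrightarrow> 0 < r \<Longrightarrow> bump c r x = 0"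
  using power_strict_mono[of r "norm (x - c)" 2]
  by (simp add: bump_def dist_norm norm_minus_commute[of c] power2_norm_eq_inner[symmetric])

lemma DERIV_max_0_square: "((\<lambda>s. (max 0 s)\<^sup>2) has_real_derivative 2 * max 0 s) (at (s::real))"
proof (cases s "0::real" rule: linorder_cases)
  case greater
  have "((\<lambda>s. s\<^sup>2) has_real_derivative 2 * s) (at s)" by (auto intro!: derivative_eq_intros)
  then have "((\<lambda>s. (max 0 s)\<^sup>2) has_real_derivative 2 * s) (at s)"
    by (rule has_field_derivative_transform_within_open[of _ _ _ "{0<..}"]) (use greater in auto)
  then show ?thesis using greater by simp
next
  case less
  have "((\<lambda>s. 0) has_real_derivative 0) (at s)" by simp
  then have "((\<lambda>s. (max 0 s)\<^sup>2) has_real_derivative 0) (at s)"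
    by (rule has_field_derivative_transform_within_open[of _ _ _ "{..<0}"]) (use less in auto)
  then show ?thesis using less by simp
next
  case equal
  have "((\<lambda>h. ((max 0 h)\<^sup>2) / h) \<longlongrightarrow> 0) (at (0::real))"
  proof (rule Lim_null_comparison)
    show "\<forall>\<^sub>F h in at 0. norm ((max 0 h)\<^sup>2 / h) \<le> \<bar>h\<bar>"
      by (intro always_eventually) (auto simp: max_def power2_eq_square)
    show "((\<lambda>h. \<bar>h\<bar>) \<longlongrightarrow> 0) (at (0::real))" by (rule tendsto_rabs_zero) (rule tendsto_ident_at)
  qed
  then show ?thesis using equal by (simp add: DERIV_def)
qed

lemma surface_measure_space:
  assumes "surface_measure \<Omega> \<sigma>"
  shows "sets \<sigma> = sets (restrict_space borel (frontier \<Omega>))" "space \<sigma> = frontier \<Omega>"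
proof -
  show s: "sets \<sigma> = sets (restrict_space borel (frontier \<Omega>))" using assms by (simp add: surface_measure_def)
  show "space \<sigma> = frontier \<Omega>" using sets_eq_imp_space_eq[OF s] by (simp add: space_restrict_space)
qed

lemma surface_measure_sets:
  assumes "surface_measure \<Omega> \<sigma>" "B \<in> sets borel"
  shows "frontier \<Omega> \<inter> B \<in> sets \<sigma>"
  unfolding surface_measure_space(1)[OF assms(1)] sets_restrict_space using assms(2) by (rule imageI)

lemma surface_measure_chart:
  assumes "surface_measure \<Omega> \<sigma>" "boundary_chart \<Omega> V e \<gamma>" "A \<in> sets \<sigma>" "A \<subseteq> V"
  shows "emeasure \<sigma> A = (\<integral>\<^sup>+x. ennreal (sqrt (1 + (norm (grad \<gamma> x))\<^sup>2)) *
    indicator {x. 0 \<le> x \<bullet> e \<and> x \<bullet> e \<le> 1 \<and> x + (\<gamma> x - x \<bullet> e) *\<^sub>R e \<in> A} x \<partial>lborel)"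
proof -
  have "\<forall>V e \<gamma> A. boundary_chart \<Omega> V e \<gamma> \<and> A \<in> sets \<sigma> \<and> A \<subseteq> V \<longrightarrow>
    emeasure \<sigma> A = (\<integral>\<^sup>+x. ennreal (sqrt (1 + (norm (grad \<gamma> x))\<^sup>2)) *
    indicator {x. 0 \<le> x \<bullet> e \<and> x \<bullet> e \<le> 1 \<and> x + (\<gamma> x - x \<bullet> e) *\<^sub>R e \<in> A} x \<partial>lborel)"
    using assms(1) unfolding surface_measure_def by (rule conjunct2)
  from this[rule_format, OF conjI[OF assms(2) conjI[OF assms(3,4)]]] show ?thesis .
qed

lemma C_k_1_bump:
  fixes c :: "'a::euclidean_space"
  shows "C_k 1 S (bump c r)"
proof (rule C_k_1I)
  fix x
  have "((\<lambda>x. r\<^sup>2 - (x - c) \<bullet> (x - c)) has_derivative (\<lambda>h. - 2 * ((x - c) \<bullet> h))) (at x within S)"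
    by (auto intro!: derivative_eq_intros simp: inner_commute)
  from has_derivative_compose[OF this DERIV_max_0_square[unfolded has_field_derivative_def]]
  show "(bump c r has_derivative
      (\<lambda>h. 2 * max 0 (r\<^sup>2 - (x - c) \<bullet> (x - c)) * (- 2 * ((x - c) \<bullet> h)))) (at x within S)"
    by (simp add: bump_def[abs_def])
qed (intro continuous_intros)

section \<open>Surface integrals and the divergence theorem in one chart\<close>

context chart
begin

lemma graph_frontier: "open \<Omega> \<Longrightarrow> graph x \<in> V \<Longrightarrow> graph x \<in> frontier \<Omega>"
proof -
  assume "open \<Omega>" "graph x \<in> V"
  then have "graph x \<in> frontier \<Omega> \<inter> V" unfolding frontier_V[OF \<open>open \<Omega>\<close>] by (simp add: graph_e)
  then show ?thesis by simp
qed

lemma mem_closure: "x \<in> V \<Longrightarrow> x \<in> closure \<Omega> \<longleftrightarrow> x \<bullet> e \<le> \<gamma> x"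
  and mem_\<Omega>: "x \<in> V \<Longrightarrow> x \<in> \<Omega> \<longleftrightarrow> x \<bullet> e < \<gamma> x"
proof -
  assume x: "x \<in> V"
  have "x \<in> closure \<Omega> \<longleftrightarrow> x \<in> closure \<Omega> \<inter> V" "x \<in> \<Omega> \<longleftrightarrow> x \<in> \<Omega> \<inter> V" using x by simp_all
  then show "x \<in> closure \<Omega> \<longleftrightarrow> x \<bullet> e \<le> \<gamma> x" "x \<in> \<Omega> \<longleftrightarrow> x \<bullet> e < \<gamma> x"
    unfolding closure_V below using x by simp_all
qed

abbreviation (input) area :: "'a \<Rightarrow> real" where "area x \<equiv> sqrt (1 + (norm (grad \<gamma> x))\<^sup>2)"

lemma graph_measurable [measurable]: "graph \<in> borel_measurable borel"
  using cont_graph by (rule borel_measurable_continuous_onI)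

lemma area_continuous: "continuous_on S area"
  by (intro continuous_intros continuous_on_subset[OF cont_grad]) auto

lemma area_measurable [measurable]: "area \<in> borel_measurable borel"
  using area_continuous by (rule borel_measurable_continuous_onI)

text \<open>\<open>surface_measure\<close> prescribes the measure of sets only. Identifying \<sigma>
  on \<open>V\<close> with the image of the weighted slab under \<open>graph\<close> turns this into
  a formula for integrals of signed functions.\<close>

lemma surface_integral:
  fixes h :: "'a \<Rightarrow> real"
  assumes \<Omega>: "open \<Omega>" and \<sigma>: "surface_measure \<Omega> \<sigma>"
    and h[measurable]: "h \<in> borel_measurable borel" and supp: "\<And>x. x \<in> frontier \<Omega> \<Longrightarrow> x \<notin> V \<Longrightarrow> h x = 0"
  shows "(\<integral>\<xi>. h \<xi> \<partial>\<sigma>) =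
    (\<integral>x. indicator {x. 0 \<le> x \<bullet> e \<and> x \<bullet> e \<le> 1} x * (indicator V (graph x) * (area x * h (graph x))) \<partial>lborel)"
proof -
  let ?slab = "{x. 0 \<le> x \<bullet> e \<and> x \<bullet> e \<le> 1}"
  have V[measurable]: "V \<in> sets borel" using open_V by simp
  have A[measurable]: "?slab \<in> sets borel" by measurable
  note [measurable_cong] = surface_measure_space(1)[OF \<sigma>]
  note sp = surface_measure_space(2)[OF \<sigma>]
  have id[measurable]: "(\<lambda>x. x) \<in> measurable \<sigma> borel"
    unfolding measurable_cong_sets[OF surface_measure_space(1)[OF \<sigma>] refl] by (intro measurable_restrict_space1) simp
  define D where "D = density \<sigma> (\<lambda>x. ennreal (indicator V x))"
  define E where "E = density lborel (\<lambda>x. ennreal (indicator ?slab x * (indicator V (graph x) * area x)))"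
  have D_meas[measurable]: "(\<lambda>x. x) \<in> measurable D borel" by (simp add: D_def)
  have E_meas[measurable]: "graph \<in> measurable E borel" by (simp add: E_def)
  have eq: "distr D borel (\<lambda>x. x) = distr E borel graph"
  proof (rule measure_eqI)
    fix B assume "B \<in> sets (distr D borel (\<lambda>x. x))"
    then have B[measurable]: "B \<in> sets borel" by simp
    let ?B = "frontier \<Omega> \<inter> (B \<inter> V)"
    have Bs: "?B \<in> sets \<sigma>" by (rule surface_measure_sets[OF \<sigma>]) simp
    have "emeasure (distr D borel (\<lambda>x. x)) B = emeasure D (frontier \<Omega> \<inter> B)"
      by (subst emeasure_distr) (auto simp: D_def sp Int_commute)
    also have "\<dots> = (\<integral>\<^sup>+x. indicator V x * indicator (frontier \<Omega> \<inter> B) x \<partial>\<sigma>)"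
      unfolding D_def
    proof (subst emeasure_density)
      show "frontier \<Omega> \<inter> B \<in> sets \<sigma>" by (rule surface_measure_sets[OF \<sigma> B])
    qed (auto simp: ennreal_indicator)
    also have "\<dots> = (\<integral>\<^sup>+x. indicator ?B x \<partial>\<sigma>)"
      by (intro nn_integral_cong) (auto simp: indicator_def)
    also have "\<dots> = emeasure \<sigma> ?B" using Bs by simp
    also have "\<dots> = (\<integral>\<^sup>+x. ennreal (area x) *
        indicator {x. 0 \<le> x \<bullet> e \<and> x \<bullet> e \<le> 1 \<and> x + (\<gamma> x - x \<bullet> e) *\<^sub>R e \<in> ?B} x \<partial>lborel)"
    proof -
      have "?B \<subseteq> V" by auto
      then show ?thesis by (rule surface_measure_chart[OF \<sigma> chart Bs])
    qed
    also have "\<dots> = (\<integral>\<^sup>+x. ennreal (indicator ?slab x * (indicator V (graph x) * area x)) * indicator B (graph x) \<partial>lborel)"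
    proof (rule nn_integral_cong)
      fix x
      show "ennreal (area x) * indicator {x. 0 \<le> x \<bullet> e \<and> x \<bullet> e \<le> 1 \<and> x + (\<gamma> x - x \<bullet> e) *\<^sub>R e \<in> ?B} x =
          ennreal (indicator ?slab x * (indicator V (graph x) * area x)) * indicator B (graph x)"
        using graph_frontier[OF \<Omega>, of x] by (cases "graph x \<in> V") (simp_all add: indicator_def graph_def[symmetric])
    qed
    also have "\<dots> = (\<integral>\<^sup>+x. indicator B (graph x) \<partial>E)"
      unfolding E_def by (subst nn_integral_density) auto
    also have "\<dots> = emeasure (distr E borel graph) B"
      by (subst nn_integral_distr[symmetric, where M' = borel and f = "indicator B"]) auto
    finally show "emeasure (distr D borel (\<lambda>x. x)) B = emeasure (distr E borel graph) B" .
  qed simp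
  have "(\<integral>\<xi>. h \<xi> \<partial>\<sigma>) = (\<integral>\<xi>. indicator V \<xi> * h \<xi> \<partial>\<sigma>)"
    by (rule Bochner_Integration.integral_cong) (use supp in \<open>auto simp: sp indicator_def\<close>)
  also have "\<dots> = (\<integral>\<xi>. h \<xi> \<partial>D)"
    unfolding D_def by (subst integral_real_density) auto
  also have "\<dots> = (\<integral>\<xi>. h \<xi> \<partial>distr D borel (\<lambda>x. x))" by (subst integral_distr) auto
  also have "\<dots> = (\<integral>x. h (graph x) \<partial>E)" unfolding eq by (subst integral_distr) auto
  also have "\<dots> = (\<integral>x. indicator ?slab x * (indicator V (graph x) * area x) * h (graph x) \<partial>lborel)"
    unfolding E_def by (subst integral_real_density) auto
  finally show ?thesis by (simp only: mult.assoc)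
qed

text \<open>The part of the slab projected into a bounded set is itself bounded, since the
  projection changes only the component along \<open>e\<close>; on it the area element is
  bounded.\<close>

lemma surface_measure_cball_finite:
  assumes \<Omega>: "open \<Omega>" and \<sigma>: "surface_measure \<Omega> \<sigma>" and V: "cball c r \<subseteq> V"
  shows "emeasure \<sigma> (frontier \<Omega> \<inter> cball c r) < \<infinity>"
proof -
  let ?B = "frontier \<Omega> \<inter> cball c r"
  \<comment> \<open>Removing from the graph point its component along \<open>e\<close> and adding
    one of length at most 1 recovers \<open>x\<close>; hence \<open>norm x\<close> is at most
    \<open>2 * norm (graph x) + 1\<close>.\<close>
  define R where "R = 2 * (norm c + r) + 1"
  have Bs: "?B \<in> sets \<sigma>" by (rule surface_measure_sets[OF \<sigma>]) simp
  obtain W where W: "\<And>x. x \<in> cball 0 R \<Longrightarrow> norm (area x) \<le> W"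
    by (rule continuous_on_compact_bound[OF compact_cball[of 0 R] area_continuous]) (rule that, assumption)
  have mem: "x \<in> cball 0 R" if "0 \<le> x \<bullet> e" "x \<bullet> e \<le> 1" "x + (\<gamma> x - x \<bullet> e) *\<^sub>R e \<in> ?B" for x
  proof -
    have p: "norm (graph x) \<le> norm c + r"
      using that norm_triangle_ineq2[of "graph x" c] by (auto simp: graph_def dist_norm norm_minus_commute)
    have "x = graph x - (graph x \<bullet> e) *\<^sub>R e + (x \<bullet> e) *\<^sub>R e"
      using graph_e[of x] by (simp add: graph_def algebra_simps)
    then have "norm x \<le> norm (graph x - (graph x \<bullet> e) *\<^sub>R e) + norm ((x \<bullet> e) *\<^sub>R e)"
      by (metis norm_triangle_ineq)
    also have "\<dots> \<le> norm (graph x) + norm ((graph x \<bullet> e) *\<^sub>R e) + norm ((x \<bullet> e) *\<^sub>R e)"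
      using norm_triangle_ineq4[of "graph x" "(graph x \<bullet> e) *\<^sub>R e"] by (intro add_right_mono)
    also have "\<dots> \<le> norm (graph x) + norm (graph x) + 1"
      using that Cauchy_Schwarz_ineq2[of "graph x" e] by simp
    finally show ?thesis using p by (simp add: R_def)
  qed
  have "emeasure \<sigma> ?B = (\<integral>\<^sup>+x. ennreal (area x) *
      indicator {x. 0 \<le> x \<bullet> e \<and> x \<bullet> e \<le> 1 \<and> x + (\<gamma> x - x \<bullet> e) *\<^sub>R e \<in> ?B} x \<partial>lborel)"
  proof -
    have "?B \<subseteq> V" using V by auto
    then show ?thesis by (rule surface_measure_chart[OF \<sigma> chart Bs])
  qed
  also have "\<dots> \<le> (\<integral>\<^sup>+x. ennreal W * indicator (cball (0::'a) R) x \<partial>lborel)"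
  proof (rule nn_integral_mono)
    fix x :: 'a
    show "ennreal (area x) * indicator {x. 0 \<le> x \<bullet> e \<and> x \<bullet> e \<le> 1 \<and> x + (\<gamma> x - x \<bullet> e) *\<^sub>R e \<in> ?B} x
        \<le> ennreal W * indicator (cball 0 R) x"
    proof (cases "x \<in> {x. 0 \<le> x \<bullet> e \<and> x \<bullet> e \<le> 1 \<and> x + (\<gamma> x - x \<bullet> e) *\<^sub>R e \<in> ?B}")
      case True
      then have "x \<in> cball 0 R" using mem by blast
      with W[OF this] True show ?thesis by (auto intro: ennreal_leI)
    qed simp
  qed
  also have "\<dots> = ennreal W * emeasure lborel (cball (0::'a) R)"
    by (rule nn_integral_cmult_indicator) auto
  also have "\<dots> < \<infinity>"
    using emeasure_lborel_cball_finite[of "0::'a" R] by (simp add: ennreal_mult_less_top)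
  finally show ?thesis .
qed

text \<open>A function supported in a ball inside \<open>V\<close> can be extended by zero to the
  whole region below the graph, where \<open>divergence_below_graph\<close> applies. The resulting
  vector \<open>e - grad \<gamma> x\<close> is the area element times the unit normal.\<close>

lemma divergence_chart:
  assumes \<Omega>: "open \<Omega>" "bounded \<Omega>" "smooth_boundary \<Omega>" and \<sigma>: "surface_measure \<Omega> \<sigma>" and V: "cball c r \<subseteq> V"
    and D: "\<And>x. x \<in> closure \<Omega> \<Longrightarrow> (g has_derivative D x) (at x within closure \<Omega>)"
    and Dc: "\<And>b. b \<in> Basis \<Longrightarrow> continuous_on (closure \<Omega>) (\<lambda>x. D x b)"
    and supp: "\<And>x. x \<in> closure \<Omega> \<Longrightarrow> x \<notin> cball c r \<Longrightarrow> g x = (0::real)"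
    and b: "b \<in> Basis"
  shows "(\<integral>x. indicator \<Omega> x * D x b \<partial>lborel) = (\<integral>\<xi>. g \<xi> * (exterior_normal \<Omega> \<xi> \<bullet> b) \<partial>\<sigma>)"
proof -
  define g' where "g' x = (if x \<in> V then g x else 0)" for x
  define D' where "D' x = (if x \<in> V then D x else (\<lambda>_. 0))" for x
  let ?L = "{x. x \<bullet> e < \<gamma> x}"
  have cl: "compact (closure \<Omega>)" using \<Omega> by (simp add: compact_closure)
  have D_at: "(g has_derivative D x) (at x)" if "x \<in> \<Omega>" for x
  proof -
    have "(g has_derivative D x) (at x within \<Omega>)"
      using D closure_subset that by (blast intro: has_derivative_subset)
    then show ?thesis using at_within_open[OF that \<Omega>(1)] by simp
  qed
  have LV: "x \<in> \<Omega> \<longleftrightarrow> x \<in> ?L" if "x \<in> V" for x using mem_\<Omega>[OF that] by simp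
  have zero: "g' x = 0" if "x \<notin> cball c r" "x \<bullet> e \<le> \<gamma> x" for x
    using supp[of x] mem_closure[of x] that by (auto simp: g'_def)
  have oc: "open (- cball c r)" by (simp add: open_Compl)
  have D_zero: "D x = (\<lambda>_. 0)" if "x \<in> \<Omega>" "x \<notin> cball c r" for x
  proof -
    have "(g has_derivative (\<lambda>_. 0)) (at x)"
      by (rule has_derivative_transform_within_open[OF has_derivative_const[of 0], of "\<Omega> \<inter> - cball c r"])
        (use that supp closure_subset \<Omega>(1) oc in auto)
    then show ?thesis using D_at[OF that(1)] by (blast intro: has_derivative_unique)
  qed
  have D'_zero: "D' x b = 0" if "x \<in> ?L" "x \<notin> cball c r" for x b
    using LV[of x] D_zero[of x] that by (auto simp: D'_def)
  have "\<forall>b\<in>Basis. \<exists>C. \<forall>x\<in>closure \<Omega>. \<bar>D x b\<bar> \<le> C"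
  proof
    fix b :: 'a assume "b \<in> Basis"
    then have "compact ((\<lambda>x. D x b) ` closure \<Omega>)" by (intro compact_continuous_image Dc cl)
    then show "\<exists>C. \<forall>x\<in>closure \<Omega>. \<bar>D x b\<bar> \<le> C" by (auto dest!: compact_imp_bounded simp: bounded_iff)
  qed
  then obtain C where C: "\<And>b x. b \<in> Basis \<Longrightarrow> x \<in> closure \<Omega> \<Longrightarrow> \<bar>D x b\<bar> \<le> C b" by metis
  interpret chart_function \<Omega> V e \<gamma> g' D' "\<Sum>b\<in>Basis. \<bar>C b\<bar>" "norm c + r"
  proof
    show "continuous_on {x. x \<bullet> e \<le> \<gamma> x} g'"
      unfolding continuous_on_eq_continuous_within
    proof
      fix x assume x: "x \<in> {x. x \<bullet> e \<le> \<gamma> x}"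
      let ?C = "{x. x \<bullet> e \<le> \<gamma> x}"
      show "continuous (at x within ?C) g'"
      proof (cases "x \<in> V")
        case True
        then have "x \<in> closure \<Omega>" using mem_closure x by simp
        then have "continuous (at x within closure \<Omega>) g" using D has_derivative_continuous by blast
        then have "continuous (at x within ?C \<inter> V) g"
          by (rule continuous_within_subset) (auto simp: mem_closure)
        then have "continuous (at x within ?C) g"
          using at_within_nhd[OF True open_V, of "?C \<inter> V" ?C] by (simp add: continuous_within Int_assoc)
        moreover have "\<forall>\<^sub>F y in at x within ?C. g y = g' y"
          unfolding eventually_at_topological using open_V True by (auto simp: g'_def)
        ultimately show ?thesis
          unfolding continuous_within using True by (auto simp: g'_def intro: Lim_transform_eventually)
      next
        case False
        then have "x \<notin> cball c r" using V by blast
        then have "\<forall>\<^sub>F y in at x within ?C. 0 = g' y"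
          unfolding eventually_at_topological using oc zero by (intro exI[of _ "- cball c r"]) auto
        then show ?thesis
          unfolding continuous_within using zero[OF \<open>x \<notin> cball c r\<close>] x
          by (auto intro: Lim_transform_eventually)
      qed
    qed
    show "(g' has_derivative D' x) (at x)" if x: "x \<bullet> e < \<gamma> x" for x
    proof (cases "x \<in> V")
      case True
      then have "(g has_derivative D' x) (at x)" using D_at LV x by (auto simp: D'_def)
      then show ?thesis
        by (rule has_derivative_transform_within_open[OF _ open_V True]) (simp add: g'_def)
    next
      case False
      then have "x \<notin> cball c r" using V by blast
      have "(g' has_derivative (\<lambda>_. 0)) (at x)"
        by (rule has_derivative_transform_within_open[OF has_derivative_const[of 0], of "?L \<inter> - cball c r"])
          (use \<open>x \<notin> cball c r\<close> zero x oc open_lower in auto)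
      then show ?thesis using False by (simp add: D'_def)
    qed
    show "continuous_on ?L (\<lambda>x. D' x b)" if b: "b \<in> Basis" for b
    proof -
      \<comment> \<open>Two open sets cover the region below the graph: on one \<open>D'\<close> is
        \<open>D\<close>, on the other it vanishes because the support has been left.\<close>
      have "continuous_on (\<Omega> \<inter> V) (\<lambda>x. D' x b)"
        by (rule continuous_on_eq[OF continuous_on_subset[OF Dc[OF b]]]) (use closure_subset in \<open>auto simp: D'_def\<close>)
      moreover have "continuous_on (?L \<inter> - cball c r) (\<lambda>x. D' x b)"
        by (rule continuous_on_eq[OF continuous_on_const[of _ 0]]) (use D'_zero in auto)
      ultimately have "continuous_on ((\<Omega> \<inter> V) \<union> (?L \<inter> - cball c r)) (\<lambda>x. D' x b)"
        by (intro continuous_on_open_Un open_Int \<Omega> open_V open_lower oc)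
      then show ?thesis by (rule continuous_on_subset) (use V LV in auto)
    qed
    show "\<bar>D' x b\<bar> \<le> (\<Sum>b\<in>Basis. \<bar>C b\<bar>)" if "x \<bullet> e < \<gamma> x" "b \<in> Basis" for x b
    proof -
      have "\<bar>C b\<bar> \<le> (\<Sum>b\<in>Basis. \<bar>C b\<bar>)" by (rule member_le_sum) (use that in auto)
      moreover have "0 \<le> (\<Sum>b\<in>Basis. \<bar>C b\<bar>)" by (rule sum_nonneg) auto
      moreover have "\<bar>D' x b\<bar> \<le> \<bar>C b\<bar> \<or> D' x b = 0"
        using C[OF that(2), of x] LV[of x] that closure_subset by (force simp: D'_def)
      ultimately show ?thesis by auto
    qed
    show "g' x = 0" if "norm c + r < norm x" "x \<bullet> e \<le> \<gamma> x" for x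
    proof (rule zero[OF _ that(2)])
      show "x \<notin> cball c r" using that norm_triangle_ineq2[of x c] by (auto simp: dist_norm norm_minus_commute)
    qed
  qed
  \<comment> \<open>The indicator turns a function continuous on the frontier into a Borel function
    on the whole space, as \<open>surface_integral\<close> requires.\<close>
  define h where "h \<xi> = indicator (frontier \<Omega>) \<xi> * (g \<xi> * (exterior_normal \<Omega> \<xi> \<bullet> b))" for \<xi>
  have cg: "continuous_on (closure \<Omega>) g"
    unfolding continuous_on_eq_continuous_within using D has_derivative_continuous by blast
  have "continuous_on (frontier \<Omega>) (\<lambda>\<xi>. g \<xi> * (exterior_normal \<Omega> \<xi> \<bullet> b))"
    by (intro continuous_intros continuous_on_exterior_normal \<Omega> continuous_on_subset[OF cg]) (auto simp: frontier_def)
  then have hm: "h \<in> borel_measurable borel"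
    unfolding h_def[abs_def]
    using borel_measurable_continuous_on_indicator[of "frontier \<Omega>" "\<lambda>\<xi>. g \<xi> * (exterior_normal \<Omega> \<xi> \<bullet> b)"]
    by simp
  note sp = surface_measure_space(2)[OF \<sigma>]
  have fr: "frontier \<Omega> \<subseteq> closure \<Omega>" by (auto simp: frontier_def)
  have "(\<integral>x. indicator \<Omega> x * D x b \<partial>lborel) = (\<integral>x. indicator ?L x * D' x b \<partial>lborel)"
  proof (rule Bochner_Integration.integral_cong)
    fix x
    show "indicator \<Omega> x * D x b = indicator ?L x * D' x b"
    proof (cases "x \<in> V")
      case True
      then show ?thesis using LV[OF True] by (simp add: indicator_def D'_def)
    next
      case False
      then have "x \<notin> cball c r" using V by (rule contra_subsetD[rotated])
      then show ?thesis using False D_zero[of x] by (auto simp: indicator_def D'_def)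
    qed
  qed simp
  also have "\<dots> = (\<integral>x. indicator {x. 0 \<le> x \<bullet> e \<and> x \<bullet> e \<le> 1} x * (g' (graph x) * ((e - grad \<gamma> x) \<bullet> b)) \<partial>lborel)"
    by (rule divergence_below_graph[OF b])
  also have "\<dots> = (\<integral>x. indicator {x. 0 \<le> x \<bullet> e \<and> x \<bullet> e \<le> 1} x * (indicator V (graph x) * (area x * h (graph x))) \<partial>lborel)"
  proof (rule Bochner_Integration.integral_cong)
    fix x
    show "indicator {x. 0 \<le> x \<bullet> e \<and> x \<bullet> e \<le> 1} x * (g' (graph x) * ((e - grad \<gamma> x) \<bullet> b)) =
        indicator {x. 0 \<le> x \<bullet> e \<and> x \<bullet> e \<le> 1} x * (indicator V (graph x) * (area x * h (graph x)))"
    proof (cases "graph x \<in> V")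
      case True
      then have f: "graph x \<in> frontier \<Omega>" by (rule graph_frontier[OF \<Omega>(1)])
      have "area x * (exterior_normal \<Omega> (graph x) \<bullet> b) = (e - grad \<gamma> x) \<bullet> b"
        using sqrt_pos[of x] unfolding exterior_normal_eq[OF chart \<Omega>(1) True f] normal_def grad_graph
        by (simp del: real_sqrt_gt_0_iff real_sqrt_eq_zero_cancel_iff add: right_inverse[OF less_imp_neq[OF sqrt_pos, symmetric]])
      then show ?thesis using f True by (simp add: h_def g'_def mult.left_commute)
    qed (simp add: g'_def)
  qed simp
  also have "\<dots> = (\<integral>\<xi>. h \<xi> \<partial>\<sigma>)"
  proof (rule surface_integral[OF \<Omega>(1) \<sigma> hm, symmetric])
    fix x assume "x \<in> frontier \<Omega>" "x \<notin> V"
    then have "x \<in> closure \<Omega>" "x \<notin> cball c r" using fr V by auto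
    then show "h x = 0" by (simp add: h_def supp)
  qed
  also have "\<dots> = (\<integral>\<xi>. g \<xi> * (exterior_normal \<Omega> \<xi> \<bullet> b) \<partial>\<sigma>)"
    by (rule Bochner_Integration.integral_cong) (auto simp: h_def sp)
  finally show ?thesis .
qed

end

section \<open>Covering by charts and globalisation\<close>

lemma smooth_const: "smooth (\<lambda>_. c)"
  by (simp add: smooth_def C_k_const)

text \<open>Interior points are covered by a degenerate chart, a constant graph lying above \<open>\<Omega>\<close>.\<close>

lemma closure_chart:
  fixes \<Omega> :: "'a::euclidean_space set"
  assumes "open \<Omega>" "bounded \<Omega>" "smooth_boundary \<Omega>" "x \<in> closure \<Omega>"
  shows "\<exists>V e \<gamma>. x \<in> V \<and> boundary_chart \<Omega> V e \<gamma>"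
proof (cases "x \<in> \<Omega>")
  case True
  obtain C where C: "\<And>y. y \<in> \<Omega> \<Longrightarrow> norm y \<le> C" using assms(2) by (auto simp: bounded_iff)
  define e :: 'a where "e = (SOME i. i \<in> Basis)"
  have e: "e \<in> Basis" unfolding e_def by (rule SOME_Basis)
  have "y \<bullet> e < C + 1" if "y \<in> \<Omega>" for y
    using C[OF that] Basis_le_norm[OF e, of y] by simp
  then have "boundary_chart \<Omega> \<Omega> e (\<lambda>_. C + 1)"
    using assms(1) e by (auto simp: boundary_chart_def smooth_const)
  then show ?thesis using True by blast
next
  case False
  then have "x \<in> frontier \<Omega>" using assms by (simp add: frontier_def interior_open)
  then show ?thesis using assms(3) by (auto simp: smooth_boundary_def)
qed

text \<open>The open balls cover while the closed balls stay inside charts: bumps are positive on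
  the former and vanish outside the latter.\<close>

lemma finite_chart_cover:
  fixes \<Omega> :: "'a::euclidean_space set"
  assumes "open \<Omega>" "bounded \<Omega>" "smooth_boundary \<Omega>"
  obtains I r where "finite I" "closure \<Omega> \<subseteq> (\<Union>c\<in>I. ball c (r c))" "\<And>c. c \<in> I \<Longrightarrow> 0 < r c"
    "\<And>c. c \<in> I \<Longrightarrow> \<exists>V e \<gamma>. boundary_chart \<Omega> V e \<gamma> \<and> cball c (r c) \<subseteq> V"
proof -
  have "\<forall>x\<in>closure \<Omega>. \<exists>r>0. \<exists>V e \<gamma>. boundary_chart \<Omega> V e \<gamma> \<and> cball x r \<subseteq> V"
  proof
    fix x assume "x \<in> closure \<Omega>"
    then obtain V e \<gamma> where V: "x \<in> V" "boundary_chart \<Omega> V e \<gamma>" using closure_chart[OF assms] by blast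
    then have "open V" by (simp add: boundary_chart_def)
    then obtain r where "r > 0" "cball x r \<subseteq> V" using V(1) by (auto simp: open_contains_cball)
    then show "\<exists>r>0. \<exists>V e \<gamma>. boundary_chart \<Omega> V e \<gamma> \<and> cball x r \<subseteq> V" using V by blast
  qed
  then obtain r where r: "\<And>x. x \<in> closure \<Omega> \<Longrightarrow> 0 < r x"
    "\<And>x. x \<in> closure \<Omega> \<Longrightarrow> \<exists>V e \<gamma>. boundary_chart \<Omega> V e \<gamma> \<and> cball x (r x) \<subseteq> V" by metis
  have cover: "closure \<Omega> \<subseteq> (\<Union>c\<in>closure \<Omega>. ball c (r c))"
  proof
    fix x assume "x \<in> closure \<Omega>"
    then show "x \<in> (\<Union>c\<in>closure \<Omega>. ball c (r c))" using r(1)[of x] by (intro UN_I[of x]) auto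
  qed
  have "compact (closure \<Omega>)" using assms(2) by (simp add: compact_closure)
  then obtain I where I: "I \<subseteq> closure \<Omega>" "finite I" "closure \<Omega> \<subseteq> (\<Union>c\<in>I. ball c (r c))"
    by (rule compactE_image[OF _ _ cover]) auto
  show ?thesis by (rule that[OF I(2,3)]) (use r I(1) in auto)
qed

lemma surface_measure_finite:
  fixes \<Omega> :: "'a::euclidean_space set"
  assumes \<Omega>: "open \<Omega>" "bounded \<Omega>" "smooth_boundary \<Omega>" and \<sigma>: "surface_measure \<Omega> \<sigma>"
  shows "finite_measure \<sigma>"
proof
  obtain I r where I: "finite I" "closure \<Omega> \<subseteq> (\<Union>c\<in>I. ball c (r c))" "\<And>c. c \<in> I \<Longrightarrow> 0 < r c"
    "\<And>c. c \<in> I \<Longrightarrow> \<exists>V e \<gamma>. boundary_chart \<Omega> V e \<gamma> \<and> cball c (r c) \<subseteq> V"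
    by (rule finite_chart_cover[OF \<Omega>]) (rule that, assumption+)
  have sets: "frontier \<Omega> \<inter> cball c s \<in> sets \<sigma>" for c s
    by (rule surface_measure_sets[OF \<sigma>]) simp
  have "frontier \<Omega> \<subseteq> closure \<Omega>" by (auto simp: frontier_def)
  then have fr: "frontier \<Omega> \<subseteq> (\<Union>c\<in>I. ball c (r c))" using I(2) by (rule order_trans)
  have "frontier \<Omega> \<subseteq> (\<Union>c\<in>I. frontier \<Omega> \<inter> cball c (r c))"
  proof
    fix x assume x: "x \<in> frontier \<Omega>"
    with fr have "x \<in> (\<Union>c\<in>I. ball c (r c))" by (rule subsetD)
    then obtain c where "c \<in> I" "x \<in> ball c (r c)" by (rule UN_E) (rule that)
    then show "x \<in> (\<Union>c\<in>I. frontier \<Omega> \<inter> cball c (r c))" using x by (intro UN_I[of c]) auto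
  qed
  then have "emeasure \<sigma> (space \<sigma>) \<le> emeasure \<sigma> (\<Union>c\<in>I. frontier \<Omega> \<inter> cball c (r c))"
    unfolding surface_measure_space(2)[OF \<sigma>] by (intro emeasure_mono sets.finite_UN I(1) sets)
  also have "\<dots> \<le> (\<Sum>c\<in>I. emeasure \<sigma> (frontier \<Omega> \<inter> cball c (r c)))"
    by (rule emeasure_subadditive_finite) (use sets I(1) in auto)
  also have "\<dots> < \<infinity>"
    unfolding infinity_ennreal_def ennreal_sum_less_top[OF I(1)]
  proof (rule ballI)
    fix c assume "c \<in> I"
    then obtain V e \<gamma> where V: "boundary_chart \<Omega> V e \<gamma>" "cball c (r c) \<subseteq> V" using I(4) by blast
    interpret chart \<Omega> V e \<gamma> by unfold_locales (rule V)
    show "emeasure \<sigma> (frontier \<Omega> \<inter> cball c (r c)) < top"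
      using surface_measure_cball_finite[OF \<Omega>(1) \<sigma> V(2)] by simp
  qed
  finally show "emeasure \<sigma> (space \<sigma>) \<noteq> \<infinity>" by simp
qed

lemma C_k_1_closure:
  fixes g :: "'a::euclidean_space \<Rightarrow> real"
  assumes \<Omega>: "open \<Omega>" "bounded \<Omega>" and g: "C_k 1 (closure \<Omega>) g"
  obtains D where "\<And>x. x \<in> closure \<Omega> \<Longrightarrow> (g has_derivative D x) (at x within closure \<Omega>)"
    "\<And>b. b \<in> Basis \<Longrightarrow> continuous_on (closure \<Omega>) (\<lambda>x. D x b)"
    "\<And>x. x \<in> \<Omega> \<Longrightarrow> (g has_derivative D x) (at x)"
    "\<And>b. b \<in> Basis \<Longrightarrow> integrable lborel (\<lambda>x. indicator \<Omega> x * D x b)"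
proof -
  from g obtain D where D: "\<And>x. x \<in> closure \<Omega> \<Longrightarrow> (g has_derivative D x) (at x within closure \<Omega>)"
    "\<And>b. b \<in> Basis \<Longrightarrow> continuous_on (closure \<Omega>) (\<lambda>x. D x b)" by (rule C_k_1E) (rule that, assumption+)
  show ?thesis
  proof (rule that[OF D])
    fix x assume x: "x \<in> \<Omega>"
    have "(g has_derivative D x) (at x within \<Omega>)"
      using D(1) closure_subset x by (blast intro: has_derivative_subset)
    then show "(g has_derivative D x) (at x)" using at_within_open[OF x \<Omega>(1)] by simp
  next
    fix b :: 'a assume b: "b \<in> Basis"
    have "compact (closure \<Omega>)" using \<Omega> by (simp add: compact_closure)
    then have "set_integrable lborel (closure \<Omega>) (\<lambda>x. D x b)"
      unfolding set_integrable_def by (rule borel_integrable_compact[OF _ D(2)[OF b]])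
    then have "set_integrable lborel \<Omega> (\<lambda>x. D x b)"
      by (rule set_integrable_subset) (use \<Omega> closure_subset in auto)
    then show "integrable lborel (\<lambda>x. indicator \<Omega> x * D x b)" by (simp add: set_integrable_def)
  qed
qed

text \<open>The sum of the bumps is positive on the compact closure, so dividing by it splits
  \<open>g\<close> into finitely many pieces, each supported in a closed ball inside a
  chart.\<close>

lemma divergence_theorem:
  fixes \<Omega> :: "'a::euclidean_space set"
  assumes \<Omega>: "open \<Omega>" "bounded \<Omega>" "smooth_boundary \<Omega>" and \<sigma>: "surface_measure \<Omega> \<sigma>"
    and g: "C_k 1 (closure \<Omega>) g" and b: "b \<in> Basis"
  shows "(\<integral>x. indicator \<Omega> x * frechet_derivative g (at x) b \<partial>lborel) =
    (\<integral>\<xi>. g \<xi> * (exterior_normal \<Omega> \<xi> \<bullet> b) \<partial>\<sigma>)"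
proof -
  obtain I r where I: "finite I" "closure \<Omega> \<subseteq> (\<Union>c\<in>I. ball c (r c))" "\<And>c. c \<in> I \<Longrightarrow> 0 < r c"
    "\<And>c. c \<in> I \<Longrightarrow> \<exists>V e \<gamma>. boundary_chart \<Omega> V e \<gamma> \<and> cball c (r c) \<subseteq> V"
    by (rule finite_chart_cover[OF \<Omega>]) (rule that, assumption+)
  interpret finite_measure \<sigma> by (rule surface_measure_finite[OF \<Omega> \<sigma>])
  define S where "S x = (\<Sum>c\<in>I. bump c (r c) x)" for x
  have S: "S x > 0" if "x \<in> closure \<Omega>" for x
  proof -
    have "x \<in> (\<Union>c\<in>I. ball c (r c))" using I(2) that by (rule subsetD)
    then obtain c where c: "c \<in> I" "x \<in> ball c (r c)" by (rule UN_E) (rule that)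
    show ?thesis
      unfolding S_def by (rule sum_pos2[where f = "\<lambda>c. bump c (r c) x", OF I(1) c(1) bump_pos[OF c(2)]]) (rule bump_nonneg)
  qed
  define G where "G c x = bump c (r c) x * (g x * inverse (S x))" for c x
  have CG: "C_k 1 (closure \<Omega>) (G c)" for c
    unfolding G_def[abs_def] S_def[abs_def]
    by (intro C_k_mult C_k_1_bump g C_k_1_inverse C_k_sum less_imp_neq[OF S, unfolded S_def, symmetric])
  have sumG: "g x = (\<Sum>c\<in>I. G c x)" if "x \<in> closure \<Omega>" for x
    using S[OF that] by (simp add: G_def sum_distrib_right[symmetric] S_def[symmetric])
  have "\<forall>c. \<exists>D. (\<forall>x\<in>closure \<Omega>. (G c has_derivative D x) (at x within closure \<Omega>)) \<and>
    (\<forall>b\<in>Basis. continuous_on (closure \<Omega>) (\<lambda>x. D x b)) \<and>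
    (\<forall>x\<in>\<Omega>. (G c has_derivative D x) (at x)) \<and>
    (\<forall>b\<in>Basis. integrable lborel (\<lambda>x. indicator \<Omega> x * D x b))"
  proof
    fix c
    show "\<exists>D. (\<forall>x\<in>closure \<Omega>. (G c has_derivative D x) (at x within closure \<Omega>)) \<and>
      (\<forall>b\<in>Basis. continuous_on (closure \<Omega>) (\<lambda>x. D x b)) \<and>
      (\<forall>x\<in>\<Omega>. (G c has_derivative D x) (at x)) \<and>
      (\<forall>b\<in>Basis. integrable lborel (\<lambda>x. indicator \<Omega> x * D x b))"
      by (rule C_k_1_closure[OF \<Omega>(1,2) CG[of c]]) (intro exI conjI ballI; assumption)
  qed
  from choice[OF this] obtain D where D0: "\<forall>c. (\<forall>x\<in>closure \<Omega>. (G c has_derivative D c x) (at x within closure \<Omega>)) \<and>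
      (\<forall>b\<in>Basis. continuous_on (closure \<Omega>) (\<lambda>x. D c x b)) \<and>
      (\<forall>x\<in>\<Omega>. (G c has_derivative D c x) (at x)) \<and>
      (\<forall>b\<in>Basis. integrable lborel (\<lambda>x. indicator \<Omega> x * D c x b))" by (rule exE)
  have D: "\<And>c x. x \<in> closure \<Omega> \<Longrightarrow> (G c has_derivative D c x) (at x within closure \<Omega>)"
    "\<And>c b. b \<in> Basis \<Longrightarrow> continuous_on (closure \<Omega>) (\<lambda>x. D c x b)"
    "\<And>c x. x \<in> \<Omega> \<Longrightarrow> (G c has_derivative D c x) (at x)"
    "\<And>c b. b \<in> Basis \<Longrightarrow> integrable lborel (\<lambda>x. indicator \<Omega> x * D c x b)"
    using D0 by simp_all
  have fd: "frechet_derivative g (at x) = (\<lambda>v. \<Sum>c\<in>I. D c x v)" if x: "x \<in> \<Omega>" for x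
  proof -
    have "((\<lambda>x. \<Sum>c\<in>I. G c x) has_derivative (\<lambda>v. \<Sum>c\<in>I. D c x v)) (at x)"
      by (rule has_derivative_sum) (rule D(3)[OF x])
    then have "(g has_derivative (\<lambda>v. \<Sum>c\<in>I. D c x v)) (at x)"
      by (rule has_derivative_transform_within_open[OF _ \<Omega>(1) x])
        (rule sumG[OF subsetD[OF closure_subset], symmetric])
    then show ?thesis by (rule frechet_derivative_at[symmetric])
  qed
  have fr: "frontier \<Omega> \<subseteq> closure \<Omega>" by (auto simp: frontier_def)
  have int: "integrable \<sigma> (\<lambda>\<xi>. G c \<xi> * (exterior_normal \<Omega> \<xi> \<bullet> b))" for c
  proof -
    have c: "continuous_on (frontier \<Omega>) (\<lambda>\<xi>. G c \<xi> * (exterior_normal \<Omega> \<xi> \<bullet> b))"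
      by (intro continuous_intros continuous_on_exterior_normal \<Omega> continuous_on_subset[OF C_k_imp_continuous[OF CG] fr])
    have "compact (frontier \<Omega>)" using \<Omega>(2) by (rule compact_frontier_bounded)
    then obtain C where C: "\<And>\<xi>. \<xi> \<in> frontier \<Omega> \<Longrightarrow> norm (G c \<xi> * (exterior_normal \<Omega> \<xi> \<bullet> b)) \<le> C"
      by (rule continuous_on_compact_bound[OF _ c]) (rule that, assumption)
    show ?thesis
    proof (rule integrable_const_bound[of _ C])
      show "(\<lambda>\<xi>. G c \<xi> * (exterior_normal \<Omega> \<xi> \<bullet> b)) \<in> borel_measurable \<sigma>"
        unfolding measurable_cong_sets[OF surface_measure_space(1)[OF \<sigma>] refl]
        by (rule borel_measurable_continuous_on_restrict[OF c])
      show "AE \<xi> in \<sigma>. norm (G c \<xi> * (exterior_normal \<Omega> \<xi> \<bullet> b)) \<le> C"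
        by (rule AE_I2) (use C surface_measure_space(2)[OF \<sigma>] in auto)
    qed
  qed
  have "(\<integral>x. indicator \<Omega> x * frechet_derivative g (at x) b \<partial>lborel) =
      (\<integral>x. (\<Sum>c\<in>I. indicator \<Omega> x * D c x b) \<partial>lborel)"
    by (rule Bochner_Integration.integral_cong) (auto simp: indicator_def fd)
  also have "\<dots> = (\<Sum>c\<in>I. \<integral>x. indicator \<Omega> x * D c x b \<partial>lborel)"
    by (rule Bochner_Integration.integral_sum) (rule D(4)[OF b])
  also have "\<dots> = (\<Sum>c\<in>I. \<integral>\<xi>. G c \<xi> * (exterior_normal \<Omega> \<xi> \<bullet> b) \<partial>\<sigma>)"
  proof (rule sum.cong[OF refl])
    fix c assume c: "c \<in> I"
    then obtain V e \<gamma> where V: "boundary_chart \<Omega> V e \<gamma>" "cball c (r c) \<subseteq> V" using I(4) by blast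
    interpret chart \<Omega> V e \<gamma> by unfold_locales (rule V)
    show "(\<integral>x. indicator \<Omega> x * D c x b \<partial>lborel) = (\<integral>\<xi>. G c \<xi> * (exterior_normal \<Omega> \<xi> \<bullet> b) \<partial>\<sigma>)"
      by (rule divergence_chart[OF \<Omega> \<sigma> V(2) D(1,2) _ b]) (use bump_zero I(3)[OF c] in \<open>auto simp: G_def\<close>)
  qed
  also have "\<dots> = (\<integral>\<xi>. (\<Sum>c\<in>I. G c \<xi> * (exterior_normal \<Omega> \<xi> \<bullet> b)) \<partial>\<sigma>)"
    by (rule Bochner_Integration.integral_sum[symmetric]) (rule int)
  also have "\<dots> = (\<integral>\<xi>. g \<xi> * (exterior_normal \<Omega> \<xi> \<bullet> b) \<partial>\<sigma>)"
  proof (rule Bochner_Integration.integral_cong[OF refl])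
    fix \<xi> assume "\<xi> \<in> space \<sigma>"
    then have "\<xi> \<in> closure \<Omega>" using surface_measure_space(2)[OF \<sigma>] fr by blast
    then show "(\<Sum>c\<in>I. G c \<xi> * (exterior_normal \<Omega> \<xi> \<bullet> b)) = g \<xi> * (exterior_normal \<Omega> \<xi> \<bullet> b)"
      by (simp add: sumG sum_distrib_right)
  qed
  finally show ?thesis .
qed

section \<open>Parametric integrals on \<open>[0,T] \<times> closure \<Omega> \<times> \<real>\<close>\<close>

lemma linear_norm_Basis_bound:
  fixes L :: "'a::euclidean_space \<Rightarrow> 'b::real_normed_vector"
  assumes "linear L" "\<And>b. b \<in> Basis \<Longrightarrow> norm (L b) \<le> \<epsilon>"
  shows "norm (L v) \<le> real DIM('a) * \<epsilon> * norm v"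
proof -
  have "L v = L (\<Sum>b\<in>Basis. (v \<bullet> b) *\<^sub>R b)" by (simp add: euclidean_representation)
  also have "\<dots> = (\<Sum>b\<in>Basis. (v \<bullet> b) *\<^sub>R L b)"
    using assms(1) by (simp add: linear_sum linear_cmul)
  also have "norm \<dots> \<le> (\<Sum>b\<in>(Basis::'a set). norm v * \<epsilon>)"
  proof (rule sum_norm_le)
    fix b :: 'a assume "b \<in> Basis"
    then show "norm ((v \<bullet> b) *\<^sub>R L b) \<le> norm v * \<epsilon>"
      using assms(2)[of b] Basis_le_norm[of b v] by (auto intro!: mult_mono)
  qed
  finally show ?thesis by (simp add: mult.commute mult.left_commute)
qed

text \<open>Each of the finitely many basis directions gives uniform continuity on \<open>K\<close>;
  together they give uniform continuity of the derivative in operator norm.\<close>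

lemma uniform_derivative_bound:
  fixes D :: "'c::metric_space \<Rightarrow> 'a::euclidean_space \<Rightarrow> 'b::real_normed_vector"
  assumes K: "compact K" and lin: "\<And>p. p \<in> K \<Longrightarrow> linear (D p)"
    and cont: "\<And>b. b \<in> Basis \<Longrightarrow> continuous_on K (\<lambda>p. D p b)" and "\<epsilon> > 0"
  shows "\<exists>\<delta>>0. \<forall>p\<in>K. \<forall>q\<in>K. dist p q < \<delta> \<longrightarrow> (\<forall>v. norm (D p v - D q v) \<le> \<epsilon> * norm v)"
proof -
  define \<epsilon>' where "\<epsilon>' = \<epsilon> / real DIM('a)"
  have \<epsilon>': "\<epsilon>' > 0" "real DIM('a) * \<epsilon>' = \<epsilon>" using \<open>\<epsilon> > 0\<close> by (auto simp: \<epsilon>'_def)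
  define P where "P b \<delta> \<longleftrightarrow> (\<forall>p\<in>K. \<forall>q\<in>K. dist p q < \<delta> \<longrightarrow> norm (D p b - D q b) \<le> \<epsilon>')" for b \<delta>
  have "\<forall>b\<in>Basis. eventually (P b) (at_right 0)"
  proof
    fix b :: 'a assume "b \<in> Basis"
    then have "uniformly_continuous_on K (\<lambda>p. D p b)" by (intro compact_uniformly_continuous cont K)
    then obtain \<delta> where \<delta>: "\<delta> > 0" "\<forall>p\<in>K. \<forall>q\<in>K. dist q p < \<delta> \<longrightarrow> dist (D q b) (D p b) < \<epsilon>'"
      unfolding uniformly_continuous_on_def using \<epsilon>'(1) by blast
    have "P b y" if "0 < y" "y < \<delta>" for y
      unfolding P_def
    proof (intro ballI impI)
      fix p q assume "p \<in> K" "q \<in> K" "dist p q < y"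
      then have "dist (D p b) (D q b) < \<epsilon>'" using \<delta>(2) that by auto
      then show "norm (D p b - D q b) \<le> \<epsilon>'" by (simp add: dist_norm)
    qed
    then show "eventually (P b) (at_right 0)" using \<delta>(1) unfolding eventually_at_right_field by blast
  qed
  then have "eventually (\<lambda>\<delta>. \<forall>b\<in>Basis. P b \<delta>) (at_right 0)"
    by (intro eventually_ball_finite finite_Basis)
  then have "eventually (\<lambda>\<delta>. 0 < \<delta> \<and> (\<forall>b\<in>Basis. P b \<delta>)) (at_right 0)"
    by (intro eventually_conj eventually_at_right_less)
  then obtain \<delta> where \<delta>: "0 < \<delta>" "\<forall>b\<in>Basis. P b \<delta>"
    using eventually_happens[of _ "at_right (0::real)"] by auto
  have "norm (D p v - D q v) \<le> \<epsilon> * norm v" if "p \<in> K" "q \<in> K" "dist p q < \<delta>" for p q v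
  proof -
    have "linear (\<lambda>v. D p v - D q v)" by (intro linear_compose_sub lin that)
    from linear_norm_Basis_bound[OF this, of \<epsilon>' v] show ?thesis
      using \<delta>(2) that \<epsilon>'(2) by (simp add: P_def)
  qed
  then show ?thesis using \<delta>(1) by blast
qed

locale domain =
  fixes \<Omega> :: "'a::euclidean_space set" and T :: real
  assumes \<Omega>: "open \<Omega>" "bounded \<Omega>" "smooth_boundary \<Omega>"
begin

abbreviation cyl :: "(real \<times> 'a \<times> real) set" where "cyl \<equiv> {0..T} \<times> closure \<Omega> \<times> UNIV"

lemma compact_closure_\<Omega>: "compact (closure \<Omega>)"
  using \<Omega>(2) by (simp add: compact_closure)

text \<open>A mean value estimate for \<open>h\<close> minus its linear part at
  \<open>(t, x, s)\<close>, along the two segments of \<open>smooth_boundary_path\<close>. The value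
  \<open>s\<close> is fixed on both, so any compact \<open>J\<close> will do, and the modulus of
  continuity of the derivative is uniform in it.\<close>

lemma uniform_differentiability:
  fixes h :: "real \<times> 'a \<times> real \<Rightarrow> 'b::real_normed_vector"
  assumes h: "\<And>p. p \<in> cyl \<Longrightarrow> (h has_derivative D p) (at p within cyl)"
    and D: "\<And>b. b \<in> Basis \<Longrightarrow> continuous_on cyl (\<lambda>p. D p b)"
    and t: "t \<in> {0..T}" and x: "x \<in> closure \<Omega>" and J: "compact J" and "\<epsilon> > 0"
  shows "\<exists>\<delta>>0. \<forall>t'\<in>{0..T}. \<forall>x'\<in>closure \<Omega>. norm ((t', x') - (t, x)) < \<delta> \<longrightarrow>
    (\<forall>s\<in>J. norm (h (t', x', s) - h (t, x, s) - D (t, x, s) (t' - t, x' - x, 0)) \<le> \<epsilon> * norm ((t', x') - (t, x)))"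
proof -
  obtain C r where C: "0 < C" "0 < r" and path: "\<forall>y \<in> closure \<Omega> \<inter> ball x r. \<exists>w.
    closed_segment x w \<subseteq> closure \<Omega> \<and> closed_segment w y \<subseteq> closure \<Omega> \<and> norm (w - x) \<le> C * norm (y - x)"
    using smooth_boundary_path[OF \<Omega>(1,3) x] by (elim exE conjE) (rule that)
  \<comment> \<open>The path has length at most \<open>C * n\<close> on the first segment and
    \<open>n + C * n\<close> on the second, with \<open>n\<close> the distance of the two space-time
    points.\<close>
  define \<epsilon>' where "\<epsilon>' = \<epsilon> / (2 * C + 1)"
  have \<epsilon>': "\<epsilon>' > 0" "\<epsilon>' * (2 * C + 1) = \<epsilon>" using \<open>\<epsilon> > 0\<close> C by (auto simp: \<epsilon>'_def)
  let ?K = "{0..T} \<times> closure \<Omega> \<times> J"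
  have "compact ?K" by (intro compact_Times compact_closure_\<Omega> J compact_Icc)
  moreover have lin: "linear (D p)" if "p \<in> cyl" for p by (rule has_derivative_linear[OF h[OF that]])
  ultimately have "\<exists>\<delta>>0. \<forall>p\<in>?K. \<forall>q\<in>?K. dist p q < \<delta> \<longrightarrow> (\<forall>v. norm (D p v - D q v) \<le> \<epsilon>' * norm v)"
    by (intro uniform_derivative_bound \<epsilon>'(1) continuous_on_subset[OF D]) auto
  then obtain \<delta>1 where \<delta>1: "\<delta>1 > 0" and unif: "\<forall>p\<in>?K. \<forall>q\<in>?K. dist p q < \<delta>1 \<longrightarrow> (\<forall>v. norm (D p v - D q v) \<le> \<epsilon>' * norm v)"
    by (elim exE conjE) (rule that)
  \<comment> \<open>The path stays within \<open>(C + 1) * n\<close> of its start, so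
    \<open>n < \<delta>\<close> keeps it in the range of uniform continuity; the bound by
    \<open>r\<close> makes the path available.\<close>
  define \<delta> where "\<delta> = min r (\<delta>1 / (C + 1))"
  have \<delta>: "\<delta> > 0" "\<delta> \<le> r" using C \<delta>1 by (auto simp: \<delta>_def)
  have "\<delta> \<le> \<delta>1 / (C + 1)" by (simp add: \<delta>_def)
  then have \<delta>': "\<delta> * (C + 1) \<le> \<delta>1" using C by (simp add: pos_le_divide_eq)
  have "norm (h (t', x', s) - h (t, x, s) - D (t, x, s) (t' - t, x' - x, 0)) \<le> \<epsilon> * norm ((t', x') - (t, x))"
    if t': "t' \<in> {0..T}" and x': "x' \<in> closure \<Omega>" and n: "norm ((t', x') - (t, x)) < \<delta>" and s: "s \<in> J" for t' x' s
  proof -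
    define n where "n = norm ((t', x') - (t, x))"
    define p where "p = (t, x, s)"
    have pK: "p \<in> ?K" and pS: "p \<in> cyl" using t x s by (auto simp: p_def)
    have nx: "norm (x' - x) \<le> n" unfolding n_def using norm_snd_le[of "x' - x" "t' - t"] by simp
    have nt: "\<bar>t' - t\<bar> \<le> n" unfolding n_def using norm_fst_le[of "t' - t" "x' - x"] by simp
    have n0: "0 \<le> n" "n < \<delta>" using that by (auto simp: n_def)
    have "x' \<in> closure \<Omega> \<inter> ball x r" using x' nx n0 \<delta> by (auto simp: dist_norm norm_minus_commute)
    then obtain w where w: "closed_segment x w \<subseteq> closure \<Omega>" "closed_segment w x' \<subseteq> closure \<Omega>"
      "norm (w - x) \<le> C * norm (x' - x)" using path by blast
    have wn: "norm (w - x) \<le> C * n" using w(3) mult_left_mono[OF nx, of C] C by linarith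
    have wcl: "w \<in> closure \<Omega>" using w(1) by auto
    have far: "norm (q - p) < \<delta>1" if "norm (q - p) \<le> (C + 1) * n" for q :: "real \<times> 'a \<times> real"
    proof -
      have "(C + 1) * n < (C + 1) * \<delta>" using n0 C by simp
      then show ?thesis using that \<delta>' by (simp add: mult.commute)
    qed
    \<comment> \<open>Subtracting the linear map at \<open>p\<close> leaves the derivative
      \<open>D q - D p\<close>, which is small along the whole path.\<close>
    define \<Phi> where "\<Phi> q = h q - D p q" for q
    have Lp: "linear (D p)" by (rule lin[OF pS])
    have step: "norm (\<Phi> a - \<Phi> b) \<le> \<epsilon>' * norm (a - b)"
      if ab: "closed_segment a b \<subseteq> ?K" and an: "norm (a - p) \<le> (C + 1) * n" "norm (b - p) \<le> (C + 1) * n" for a b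
    proof (rule differentiable_bound[of "closed_segment a b" \<Phi> "\<lambda>q v. D q v - D p v"])
      fix q assume q: "q \<in> closed_segment a b"
      then have qK: "q \<in> ?K" and qS: "q \<in> cyl" using ab by auto
      have sub: "closed_segment a b \<subseteq> cyl" using ab by auto
      show "(\<Phi> has_derivative (\<lambda>v. D q v - D p v)) (at q within closed_segment a b)"
        unfolding \<Phi>_def
        by (intro has_derivative_diff has_derivative_subset[OF h[OF qS] sub]
            bounded_linear_imp_has_derivative has_derivative_bounded_linear[OF h[OF pS]])
      have "q \<in> cball p ((C + 1) * n)"
        using q an closed_segment_subset[of a "cball p ((C + 1) * n)" b]
        by (auto simp: dist_norm norm_minus_commute)
      then have "norm (q - p) < \<delta>1" by (intro far) (simp add: dist_norm norm_minus_commute)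
      then have "dist q p < \<delta>1" by (simp only: dist_norm)
      then have "norm (D q v - D p v) \<le> \<epsilon>' * norm v" for v
        by (rule unif[rule_format, OF qK pK])
      then show "onorm (\<lambda>v. D q v - D p v) \<le> \<epsilon>'"
        using \<epsilon>'(1) by (intro onorm_bound) auto
    qed auto
    define m where "m = (t, w, s)"
    define p' where "p' = (t', x', s)"
    have nm: "norm (m - p) = norm (w - x)" by (simp add: m_def p_def norm_Pair)
    have np': "norm (p' - p) = n" by (simp add: p'_def p_def n_def norm_Pair)
    have 1: "norm (\<Phi> m - \<Phi> p) \<le> \<epsilon>' * norm (m - p)"
    proof (rule step)
      show "closed_segment m p \<subseteq> ?K"
      proof
        fix q assume "q \<in> closed_segment m p"
        then obtain u where u: "0 \<le> u" "u \<le> 1" "q = (1 - u) *\<^sub>R m + u *\<^sub>R p" by (auto simp: closed_segment_def)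
        have "(1 - u) *\<^sub>R w + u *\<^sub>R x \<in> closed_segment w x" using u by (auto simp: closed_segment_def)
        then have "(1 - u) *\<^sub>R w + u *\<^sub>R x \<in> closure \<Omega>" using w(1) by (simp add: closed_segment_commute subset_iff)
        moreover have "q = (t, (1 - u) *\<^sub>R w + u *\<^sub>R x, s)"
          by (simp add: u m_def p_def algebra_simps)
        ultimately show "q \<in> ?K" using t s by simp
      qed
      show "norm (m - p) \<le> (C + 1) * n" using wn n0 by (simp add: nm algebra_simps)
      show "norm (p - p) \<le> (C + 1) * n" using n0 C by simp
    qed
    have 2: "norm (\<Phi> p' - \<Phi> m) \<le> \<epsilon>' * norm (p' - m)"
    proof (rule step)
      show "closed_segment p' m \<subseteq> ?K"
      proof
        fix q assume "q \<in> closed_segment p' m"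
        then obtain u where u: "0 \<le> u" "u \<le> 1" "q = (1 - u) *\<^sub>R p' + u *\<^sub>R m" by (auto simp: closed_segment_def)
        have "(1 - u) *\<^sub>R x' + u *\<^sub>R w \<in> closed_segment x' w" using u by (auto simp: closed_segment_def)
        then have "(1 - u) *\<^sub>R x' + u *\<^sub>R w \<in> closure \<Omega>" using w(2) by (simp add: closed_segment_commute subset_iff)
        moreover have "q = ((1 - u) *\<^sub>R t' + u *\<^sub>R t, (1 - u) *\<^sub>R x' + u *\<^sub>R w, s)"
          by (simp add: u m_def p'_def algebra_simps)
        moreover have "(1 - u) *\<^sub>R t' + u *\<^sub>R t \<in> {0..T}"
          using convexD[OF convex_real_interval(5) t' t, of "1 - u" u] u by simp
        ultimately show "q \<in> ?K" using s by simp
      qed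
      show "norm (m - p) \<le> (C + 1) * n" using wn n0 by (simp add: nm algebra_simps)
      show "norm (p' - p) \<le> (C + 1) * n" using n0 C by (simp add: np' algebra_simps)
    qed
    have "norm (p' - m) \<le> n + C * n"
      using norm_triangle_ineq4[of "p' - p" "m - p"] np' nm wn by simp
    then have 3: "norm (\<Phi> p' - \<Phi> m) \<le> \<epsilon>' * (n + C * n)"
      using 2 mult_left_mono[of "norm (p' - m)" "n + C * n" \<epsilon>'] \<epsilon>'(1) by linarith
    have 4: "norm (\<Phi> m - \<Phi> p) \<le> \<epsilon>' * (C * n)"
      using 1 mult_left_mono[OF wn less_imp_le[OF \<epsilon>'(1)]] by (simp add: nm)
    have "norm (\<Phi> p' - \<Phi> p) \<le> norm (\<Phi> p' - \<Phi> m) + norm (\<Phi> m - \<Phi> p)"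
      using norm_triangle_ineq[of "\<Phi> p' - \<Phi> m" "\<Phi> m - \<Phi> p"] by simp
    also have "\<dots> \<le> \<epsilon>' * (2 * C + 1) * n" using 3 4 by (simp add: algebra_simps)
    finally have "norm (\<Phi> p' - \<Phi> p) \<le> \<epsilon> * n" unfolding \<epsilon>'(2) .
    moreover have "\<Phi> p' - \<Phi> p = h p' - h p - D p (p' - p)"
      by (simp add: \<Phi>_def linear_diff[OF Lp])
    moreover have "p' - p = (t' - t, x' - x, 0)" by (simp add: p'_def p_def)
    ultimately show ?thesis by (simp add: p_def p'_def n_def)
  qed
  then show ?thesis using \<delta>(1) by blast
qed

lemma continuous_on_slice:
  assumes "continuous_on cyl h" "t \<in> {0..T}" "x \<in> closure \<Omega>" "continuous_on S g"
  shows "continuous_on S (\<lambda>s. h (t, x, g s))"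
  by (rule continuous_on_compose2[OF assms(1)]) (use assms in \<open>auto intro!: continuous_intros\<close>)

text \<open>The remainder is uniformly small over the compact range of \<open>g\<close>, hence small
  after integration. The substitution \<open>g\<close> allows both a fixed interval of integration
  and the parametrisation in \<open>oint\<close>.\<close>

lemma leibniz:
  fixes h :: "real \<times> 'a \<times> real \<Rightarrow> 'b::euclidean_space" and a g :: "real \<Rightarrow> real"
  assumes h: "\<And>p. p \<in> cyl \<Longrightarrow> (h has_derivative D p) (at p within cyl)"
    and D: "\<And>b. b \<in> Basis \<Longrightarrow> continuous_on cyl (\<lambda>p. D p b)"
    and t: "t \<in> {0..T}" and x: "x \<in> closure \<Omega>"
    and a: "continuous_on {c..d} a" and g: "continuous_on {c..d} g"
  shows "((\<lambda>(t, x). integral {c..d} (\<lambda>s. a s *\<^sub>R h (t, x, g s))) has_derivative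
    (\<lambda>(u, v). integral {c..d} (\<lambda>s. a s *\<^sub>R D (t, x, g s) (u, v, 0)))) (at (t, x) within {0..T} \<times> closure \<Omega>)"
proof -
  have ch: "continuous_on cyl h"
    unfolding continuous_on_eq_continuous_within using h has_derivative_continuous by blast
  have lin: "linear (D p)" if "p \<in> cyl" for p by (rule has_derivative_linear[OF h[OF that]])
  have cD: "continuous_on cyl (\<lambda>p. D p v)" for v
    by (rule continuous_on_linear_Basis[OF lin D continuous_on_const])
  have ih: "(\<lambda>s. a s *\<^sub>R h (t', x', g s)) integrable_on {c..d}" if "t' \<in> {0..T}" "x' \<in> closure \<Omega>" for t' x'
    by (intro integrable_continuous_interval continuous_intros a continuous_on_slice[OF ch that g])
  have iD: "(\<lambda>s. a s *\<^sub>R D (t, x, g s) v) integrable_on {c..d}" for v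
    by (intro integrable_continuous_interval continuous_intros a continuous_on_slice[OF cD t x g])
  let ?F = "\<lambda>(u, v). integral {c..d} (\<lambda>s. a s *\<^sub>R D (t, x, g s) (u, v, 0))"
  have tx: "(t, x, s) \<in> cyl" for s using t x by simp
  have "linear ?F"
  proof (rule linearI)
    fix p q :: "real \<times> 'a"
    obtain u v u' v' where pq: "p = (u, v)" "q = (u', v')" by (cases p, cases q) auto
    have "D (t, x, g s) (u + u', v + v', 0) = D (t, x, g s) (u, v, 0) + D (t, x, g s) (u', v', 0)" for s
      using linear_add[OF lin[OF tx], of "g s" "(u, v, 0)" "(u', v', 0)"] by simp
    then show "?F (p + q) = ?F p + ?F q"
      by (simp add: pq scaleR_add_right integral_add iD)
  next
    fix r and p :: "real \<times> 'a"
    obtain u v where p: "p = (u, v)" by (cases p)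
    have "D (t, x, g s) (r * u, r *\<^sub>R v, 0) = r *\<^sub>R D (t, x, g s) (u, v, 0)" for s
      using linear_cmul[OF lin[OF tx], of "g s" r "(u, v, 0)"] by simp
    then have "?F (r *\<^sub>R p) = integral {c..d} (\<lambda>s. r *\<^sub>R (a s *\<^sub>R D (t, x, g s) (u, v, 0)))"
      by (simp add: p mult.commute)
    also have "\<dots> = r *\<^sub>R integral {c..d} (\<lambda>s. a s *\<^sub>R D (t, x, g s) (u, v, 0))"
      by (rule integral_cmul)
    finally show "?F (r *\<^sub>R p) = r *\<^sub>R ?F p" by (simp add: p)
  qed
  then have bl: "bounded_linear ?F" by (simp add: linear_conv_bounded_linear)
  obtain A where A: "0 \<le> A" "\<And>s. s \<in> {c..d} \<Longrightarrow> norm (a s) \<le> A"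
    by (rule continuous_on_compact_bound[OF compact_Icc a]) (rule that, assumption)
  show ?thesis
    unfolding has_derivative_within_alt
  proof (intro conjI bl allI impI)
    fix e :: real assume "e > 0"
    \<comment> \<open>\<open>A * \<bar>d - c\<bar>\<close> is the factor gained by integrating the
      remainder; adding 1 keeps the denominator positive.\<close>
    define \<epsilon> where "\<epsilon> = e / (A * \<bar>d - c\<bar> + 1)"
    have pos: "A * \<bar>d - c\<bar> + 1 > 0" using A(1) by (intro add_nonneg_pos mult_nonneg_nonneg) auto
    then have \<epsilon>: "\<epsilon> > 0" "\<epsilon> * (A * \<bar>d - c\<bar> + 1) = e" using \<open>e > 0\<close> by (auto simp: \<epsilon>_def)
    have cJ: "compact (g ` {c..d})" by (rule compact_continuous_image[OF g compact_Icc])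
    have "\<exists>\<delta>>0. \<forall>t'\<in>{0..T}. \<forall>x'\<in>closure \<Omega>. norm ((t', x') - (t, x)) < \<delta> \<longrightarrow>
      (\<forall>s\<in>g ` {c..d}. norm (h (t', x', s) - h (t, x, s) - D (t, x, s) (t' - t, x' - x, 0)) \<le> \<epsilon> * norm ((t', x') - (t, x)))"
      by (rule uniform_differentiability[OF h D t x cJ \<epsilon>(1)])
    then obtain \<delta> where \<delta>: "\<delta> > 0" "\<forall>t'\<in>{0..T}. \<forall>x'\<in>closure \<Omega>. norm ((t', x') - (t, x)) < \<delta> \<longrightarrow>
      (\<forall>s\<in>g ` {c..d}. norm (h (t', x', s) - h (t, x, s) - D (t, x, s) (t' - t, x' - x, 0)) \<le> \<epsilon> * norm ((t', x') - (t, x)))"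
      by (elim exE conjE) (rule that)
    have "norm (integral {c..d} (\<lambda>s. a s *\<^sub>R h (t', x', g s)) - integral {c..d} (\<lambda>s. a s *\<^sub>R h (t, x, g s)) -
        integral {c..d} (\<lambda>s. a s *\<^sub>R D (t, x, g s) (t' - t, x' - x, 0))) \<le> e * norm ((t', x') - (t, x))"
      if t': "t' \<in> {0..T}" and x': "x' \<in> closure \<Omega>" and n: "norm ((t', x') - (t, x)) < \<delta>" for t' x'
    proof (cases "c \<le> d")
      case True
      let ?n = "norm ((t', x') - (t, x))"
      let ?I = "\<lambda>s. a s *\<^sub>R h (t', x', g s) - a s *\<^sub>R h (t, x, g s) - a s *\<^sub>R D (t, x, g s) (t' - t, x' - x, 0)"
      have eq: "integral {c..d} (\<lambda>s. a s *\<^sub>R h (t', x', g s)) - integral {c..d} (\<lambda>s. a s *\<^sub>R h (t, x, g s)) -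
        integral {c..d} (\<lambda>s. a s *\<^sub>R D (t, x, g s) (t' - t, x' - x, 0)) = integral {c..d} ?I"
        by (simp add: integral_diff integrable_diff ih[OF t' x'] ih[OF t x] iD)
      have "norm (integral {c..d} ?I) \<le> integral {c..d} (\<lambda>s. A * (\<epsilon> * ?n))"
      proof (rule integral_norm_bound_integral)
        show "?I integrable_on {c..d}" by (intro integrable_diff ih iD t' x' t x)
        fix s assume s: "s \<in> {c..d}"
        have "norm (?I s) = \<bar>a s\<bar> * norm (h (t', x', g s) - h (t, x, g s) - D (t, x, g s) (t' - t, x' - x, 0))"
          by (simp only: scaleR_diff_right[symmetric] norm_scaleR)
        also have "\<dots> \<le> A * (\<epsilon> * ?n)"
        proof (rule mult_mono)
          show "\<bar>a s\<bar> \<le> A" using A(2)[OF s] by simp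
          show "norm (h (t', x', g s) - h (t, x, g s) - D (t, x, g s) (t' - t, x' - x, 0)) \<le> \<epsilon> * ?n"
            using \<delta>(2) t' x' n s by blast
        qed (use A in auto)
        finally show "norm (?I s) \<le> A * (\<epsilon> * ?n)" .
      qed auto
      also have "integral {c..d} (\<lambda>s. A * (\<epsilon> * ?n)) = (A * \<bar>d - c\<bar>) * \<epsilon> * ?n"
        using True by (simp add: mult.commute mult.left_commute)
      also have "\<dots> \<le> e * ?n"
      proof (rule mult_right_mono)
        have "(A * \<bar>d - c\<bar>) * \<epsilon> = e - \<epsilon>" unfolding \<epsilon>(2)[symmetric] by (simp add: algebra_simps)
        then show "(A * \<bar>d - c\<bar>) * \<epsilon> \<le> e" using \<epsilon>(1) by simp
      qed simp
      finally show ?thesis unfolding eq .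
    next
      case False
      then show ?thesis using \<open>e > 0\<close> by simp
    qed
    then have "\<forall>y\<in>{0..T} \<times> closure \<Omega>. norm (y - (t, x)) < \<delta> \<longrightarrow>
      norm ((\<lambda>(t, x). integral {c..d} (\<lambda>s. a s *\<^sub>R h (t, x, g s))) y - (\<lambda>(t, x). integral {c..d} (\<lambda>s. a s *\<^sub>R h (t, x, g s))) (t, x) - ?F (y - (t, x))) \<le> e * norm (y - (t, x))"
      by auto
    then show "\<exists>d'>0. \<forall>y\<in>{0..T} \<times> closure \<Omega>. norm (y - (t, x)) < d' \<longrightarrow>
      norm ((\<lambda>(t, x). integral {c..d} (\<lambda>s. a s *\<^sub>R h (t, x, g s))) y - (\<lambda>(t, x). integral {c..d} (\<lambda>s. a s *\<^sub>R h (t, x, g s))) (t, x) - ?F (y - (t, x))) \<le> e * norm (y - (t, x))"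
      using \<delta>(1) by (intro exI[of _ \<delta>] conjI)
  qed
qed

end

text \<open>The integral from \<open>k\<close> to \<open>z\<close>, parametrised over \<open>[0,1]\<close> so that no orientation has to be distinguished.\<close>

definition oint :: "real \<Rightarrow> real \<Rightarrow> (real \<Rightarrow> 'b::euclidean_space) \<Rightarrow> 'b" where
  "oint k z w = (z - k) *\<^sub>R integral {0..1} (\<lambda>\<theta>. w (k + \<theta> * (z - k)))"

lemma oint_FTC:
  assumes "\<And>s. s \<in> closed_segment k z \<Longrightarrow> (W has_vector_derivative w s) (at s within closed_segment k z)"
  shows "oint k z w = W z - W k"
proof -
  have "((\<lambda>\<theta>. (z - k) *\<^sub>R w (k + \<theta> * (z - k))) has_integral (W (k + 1 * (z - k)) - W (k + 0 * (z - k)))) {0..1}"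
  proof (rule fundamental_theorem_of_calculus)
    fix \<theta> :: real assume \<theta>: "\<theta> \<in> {0..1}"
    have im: "(\<lambda>\<theta>. k + \<theta> * (z - k)) ` {0..1} \<subseteq> closed_segment k z"
    proof (rule image_subsetI)
      fix \<theta> :: real assume "\<theta> \<in> {0..1}"
      then show "k + \<theta> * (z - k) \<in> closed_segment k z"
        unfolding closed_segment_def by (intro CollectI exI[of _ \<theta>]) (auto simp: algebra_simps)
    qed
    have "((\<lambda>\<theta>. k + \<theta> * (z - k)) has_vector_derivative (z - k)) (at \<theta> within {0..1})"
      by (auto intro!: derivative_eq_intros simp: has_real_derivative_iff_has_vector_derivative[symmetric])
    moreover have "(W has_vector_derivative w (k + \<theta> * (z - k))) (at (k + \<theta> * (z - k)) within (\<lambda>\<theta>. k + \<theta> * (z - k)) ` {0..1})"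
      by (rule has_vector_derivative_within_subset[OF assms[OF subsetD[OF im imageI[OF \<theta>]]] im])
    ultimately have "(W \<circ> (\<lambda>\<theta>. k + \<theta> * (z - k)) has_vector_derivative (z - k) *\<^sub>R w (k + \<theta> * (z - k))) (at \<theta> within {0..1})"
      by (rule vector_diff_chain_within)
    then show "((\<lambda>\<theta>. W (k + \<theta> * (z - k))) has_vector_derivative (z - k) *\<^sub>R w (k + \<theta> * (z - k))) (at \<theta> within {0..1})"
      by (simp add: o_def)
  qed simp
  then have "integral {0..1} (\<lambda>\<theta>. (z - k) *\<^sub>R w (k + \<theta> * (z - k))) = W z - W k"
    by (rule integral_unique[THEN trans]) simp
  then show ?thesis unfolding oint_def integral_cmul .
qed

lemma oint_has_derivative:
  assumes "continuous_on UNIV w"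
  shows "((\<lambda>z. oint k z w) has_vector_derivative w z) (at z)"
proof -
  \<comment> \<open>The margin of 1 makes both \<open>k\<close> and \<open>z\<close> interior to the
    interval on which an antiderivative is taken.\<close>
  define a where "a = min k z - 1"
  define b where "b = max k z + 1"
  have kz: "k \<in> {a<..<b}" "z \<in> {a<..<b}" by (auto simp: a_def b_def)
  obtain W where W: "\<And>s. s \<in> {a..b} \<Longrightarrow> (W has_vector_derivative w s) (at s within {a..b})"
    by (rule antiderivative_continuous[OF continuous_on_subset[OF assms subset_UNIV, of "{a..b}"]]) (rule that, assumption)
  have eq: "oint k y w = W y - W k" if "y \<in> {a<..<b}" for y
  proof (rule oint_FTC)
    have sub: "closed_segment k y \<subseteq> {a..b}"
      using kz that by (intro closed_segment_subset) auto
    fix s assume "s \<in> closed_segment k y"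
    then show "(W has_vector_derivative w s) (at s within closed_segment k y)"
      using sub by (intro has_vector_derivative_within_subset[OF W sub]) auto
  qed
  have "(W has_vector_derivative w z) (at z within {a<..<b})"
    by (rule has_vector_derivative_within_subset[OF W]) (use kz in auto)
  then have "(W has_vector_derivative w z) (at z)"
    using at_within_open[OF kz(2)] by simp
  then have "((\<lambda>y. W y - W k) has_vector_derivative w z) (at z)"
    by (auto intro!: derivative_eq_intros)
  then show ?thesis
    by (rule has_vector_derivative_transform_within_open[OF _ _ kz(2)]) (use eq in auto)
qed

section \<open>Regularity of integrals with a variable end point\<close>

context domain
begin

lemma C_k_continuous_z: "C_k n UNIV a \<Longrightarrow> C_k n cyl (\<lambda>(t, x, z). a z)" for a :: "real \<Rightarrow> 'c::euclidean_space"
proof (induction n arbitrary: a)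
  case 0
  then show ?case unfolding case_prod_unfold C_k.simps
    by (rule continuous_on_compose2) (auto intro!: continuous_intros)
next
  case (Suc n)
  from Suc.prems obtain D where D: "\<And>z. z \<in> UNIV \<Longrightarrow> (a has_derivative D z) (at z)"
    "\<And>b. b \<in> Basis \<Longrightarrow> C_k n UNIV (\<lambda>z. D z b)" by (rule C_k_SucE) (rule that, assumption+)
  show ?case
  proof (rule C_k_SucI)
    fix p :: "real \<times> 'a \<times> real" assume "p \<in> cyl"
    show "((\<lambda>(t, x, z). a z) has_derivative (\<lambda>v. D (snd (snd p)) (snd (snd v)))) (at p within cyl)"
      unfolding case_prod_unfold
      by (rule has_derivative_compose[where f = "\<lambda>p. snd (snd p)", OF _ D(1)[OF UNIV_I]])
        (intro derivative_intros)
  next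
    fix b :: "real \<times> 'a \<times> real" assume "b \<in> Basis"
    have "snd (snd b) = 1 \<or> snd (snd b) = 0" using \<open>b \<in> Basis\<close> by (auto simp: Basis_prod_def)
    then show "C_k n cyl (\<lambda>p. D (snd (snd p)) (snd (snd b)))"
    proof
      assume "snd (snd b) = 1"
      moreover have "C_k n cyl (\<lambda>(t, x, z). D z 1)" by (rule Suc.IH[OF D(2)]) simp
      ultimately show ?thesis by (simp add: case_prod_unfold)
    next
      assume "snd (snd b) = 0"
      then show ?thesis using linear_0[OF has_derivative_linear[OF D(1)]] by (simp add: C_k_const)
    qed
  qed
qed

text \<open>The derivative in time and space is again an \<open>oint\<close>, of the derivative of
  \<open>h\<close>; the derivative in the end point is the integrand itself. Neither costs more than
  one order, so the integral inherits the full regularity of \<open>a\<close> and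
  \<open>h\<close>.\<close>

lemma C_k_oint:
  fixes h :: "real \<times> 'a \<times> real \<Rightarrow> 'b::euclidean_space"
  assumes a: "C_k n UNIV a"
  shows "C_k n cyl h \<Longrightarrow> C_k n cyl (\<lambda>(t, x, z). oint k z (\<lambda>s. a s *\<^sub>R h (t, x, s)))"
  using a
proof (induction n arbitrary: h)
  case 0
  have "continuous_on cyl (\<lambda>p. (snd (snd p) - k) *\<^sub>R integral (cbox 0 1)
    (\<lambda>\<theta>. a (k + \<theta> * (snd (snd p) - k)) *\<^sub>R h (fst p, fst (snd p), k + \<theta> * (snd (snd p) - k))))"
  proof (intro continuous_intros integral_continuous_on_param)
    have "continuous_on (cyl \<times> cbox 0 1) (\<lambda>q. a (k + snd q * (snd (snd (fst q)) - k)) *\<^sub>R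
      h (fst (fst q), fst (snd (fst q)), k + snd q * (snd (snd (fst q)) - k)))"
    proof -
      have ca: "continuous_on UNIV a" and ch: "continuous_on cyl h" using 0 by simp_all
      have m: "continuous_on (cyl \<times> cbox 0 1) (\<lambda>q. k + snd q * (snd (snd (fst q)) - k))"
        by (intro continuous_intros)
      have p: "continuous_on (cyl \<times> cbox 0 1) (\<lambda>q. (fst (fst q), fst (snd (fst q)), k + snd q * (snd (snd (fst q)) - k)))"
        by (intro continuous_intros)
      have "(\<lambda>q. (fst (fst q), fst (snd (fst q)), k + snd q * (snd (snd (fst q)) - k))) ` (cyl \<times> cbox 0 1) \<subseteq> cyl"
        by (rule image_subsetI) (simp add: mem_Times_iff)
      from continuous_on_scaleR[OF continuous_on_compose2[OF ca m subset_UNIV] continuous_on_compose2[OF ch p this]]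
      show ?thesis .
    qed
    then show "continuous_on (cyl \<times> cbox 0 1) (\<lambda>(p, \<theta>). a (k + \<theta> * (snd (snd p) - k)) *\<^sub>R
      h (fst p, fst (snd p), k + \<theta> * (snd (snd p) - k)))" by (simp add: case_prod_unfold)
  qed
  then show ?case by (simp add: oint_def case_prod_unfold)
next
  case (Suc n)
  from Suc.prems(1) obtain D where D: "\<And>p. p \<in> cyl \<Longrightarrow> (h has_derivative D p) (at p within cyl)"
    "\<And>b. b \<in> Basis \<Longrightarrow> C_k n cyl (\<lambda>p. D p b)" by (rule C_k_SucE) (rule that, assumption+)
  have Dc: "\<And>b. b \<in> Basis \<Longrightarrow> continuous_on cyl (\<lambda>p. D p b)" using C_k_imp_continuous[OF D(2)] .
  have lin: "linear (D p)" if "p \<in> cyl" for p by (rule has_derivative_linear[OF D(1)[OF that]])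
  have ca: "continuous_on UNIV a" by (rule C_k_imp_continuous[OF Suc.prems(2)])
  have ch: "continuous_on cyl h" by (rule C_k_imp_continuous[OF Suc.prems(1)])
  let ?P = "{0..T} \<times> closure \<Omega>"
  \<comment> \<open>Time and space are grouped as one variable:
    \<open>has_derivative_partialsI\<close> combines a derivative in it with a continuous partial
    derivative in \<open>z\<close>.\<close>
  define G where "G tx z = oint k z (\<lambda>s. a s *\<^sub>R h (fst tx, snd tx, s))" for tx :: "real \<times> 'a" and z
  define A where "A t x z = (\<lambda>(u, v). oint k z (\<lambda>s. a s *\<^sub>R D (t, x, s) (u, v, 0)))" for t and x :: 'a and z
  have fx: "((\<lambda>tx. G tx z) has_derivative A t x z) (at (t, x) within ?P)"
    if tx: "t \<in> {0..T}" "x \<in> closure \<Omega>" for t x z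
  proof -
    let ?a = "\<lambda>\<theta>. a (k + \<theta> * (z - k))"
    have "((\<lambda>(t, x). integral {0..1} (\<lambda>\<theta>. ?a \<theta> *\<^sub>R h (t, x, k + \<theta> * (z - k)))) has_derivative
      (\<lambda>(u, v). integral {0..1} (\<lambda>\<theta>. ?a \<theta> *\<^sub>R D (t, x, k + \<theta> * (z - k)) (u, v, 0)))) (at (t, x) within ?P)"
      by (intro leibniz[OF D(1) Dc tx] continuous_on_compose2[OF ca _ subset_UNIV] continuous_intros)
    from has_derivative_scaleR_right[OF this, of "z - k"] show ?thesis
      by (simp add: G_def A_def oint_def case_prod_unfold)
  qed
  have slice: "continuous_on UNIV (\<lambda>s. a s *\<^sub>R h (t, x, s))" if "t \<in> {0..T}" "x \<in> closure \<Omega>" for t x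
    by (intro continuous_intros ca continuous_on_slice[OF ch that])
  define fy where "fy = (\<lambda>tx z. blinfun_scaleR_left (a z *\<^sub>R h (fst tx, snd tx, z)))"
  have fy: "((\<lambda>z. G tx z) has_derivative blinfun_apply (fy tx z)) (at z within UNIV)" if "tx \<in> ?P" for tx z
    using oint_has_derivative[OF slice, of "fst tx" "snd tx" k z] that
    by (auto simp: G_def fy_def has_vector_derivative_def)
  have fyc: "continuous_on (?P \<times> UNIV) (\<lambda>(tx, z). fy tx z)"
    unfolding fy_def case_prod_unfold
  proof (intro bounded_linear.continuous_on[OF bounded_linear_blinfun_scaleR_left] continuous_on_scaleR)
    show "continuous_on (?P \<times> UNIV) (\<lambda>p. a (snd p))"
      by (rule continuous_on_compose2[OF ca _ subset_UNIV]) (intro continuous_intros)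
    show "continuous_on (?P \<times> UNIV) (\<lambda>p. h (fst (fst p), snd (fst p), snd p))"
    proof (rule continuous_on_compose2[OF ch])
      show "continuous_on (?P \<times> UNIV) (\<lambda>p. (fst (fst p), snd (fst p), snd p))" by (intro continuous_intros)
      show "(\<lambda>p. (fst (fst p), snd (fst p), snd p)) ` (?P \<times> UNIV) \<subseteq> cyl"
        by (rule image_subsetI) (simp add: mem_Times_iff)
    qed
  qed
  have der: "((\<lambda>(t, x, z). oint k z (\<lambda>s. a s *\<^sub>R h (t, x, s))) has_derivative
      (\<lambda>(u, v, y). A t x z (u, v) + y *\<^sub>R (a z *\<^sub>R h (t, x, z)))) (at (t, x, z) within cyl)"
    if tx: "t \<in> {0..T}" "x \<in> closure \<Omega>" for t x z
  proof -
    have txP: "(t, x) \<in> ?P" using tx by simp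
    have "((\<lambda>(tx, z). G tx z) has_derivative (\<lambda>(tu, y). A t x z tu + blinfun_apply (fy (t, x) z) y)) (at ((t, x), z) within ?P \<times> UNIV)"
    proof (rule has_derivative_partialsI[OF fx[OF tx] fy])
      show "continuous (at ((t, x), z) within ?P \<times> UNIV) (\<lambda>(x, y). fy x y)"
        using fyc txP by (simp add: continuous_on_eq_continuous_within)
    qed auto
    then have 1: "((\<lambda>(tx, z). G tx z) has_derivative (\<lambda>(tu, y). A t x z tu + blinfun_apply (fy (t, x) z) y))
        (at ((\<lambda>(t, x, z). ((t, x), z)) (t, x, z)) within (\<lambda>(t, x, z). ((t, x), z)) ` cyl)"
      unfolding prod.case by (rule has_derivative_subset) auto
    have 2: "((\<lambda>(t, x, z). ((t, x), z)) has_derivative (\<lambda>(t, x, z). ((t, x), z))) (at (t, x, z) within cyl)"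
      unfolding case_prod_unfold by (intro has_derivative_Pair derivative_intros)
    from has_derivative_in_compose[OF 2 1] show ?thesis
      by (simp add: G_def fy_def case_prod_unfold)
  qed
  show ?case
  proof (rule C_k_SucI[where D = "\<lambda>(t, x, z) (u, v, y). A t x z (u, v) + y *\<^sub>R (a z *\<^sub>R h (t, x, z))"])
    fix p :: "real \<times> 'a \<times> real" assume "p \<in> cyl"
    then show "((\<lambda>(t, x, z). oint k z (\<lambda>s. a s *\<^sub>R h (t, x, s))) has_derivative
      (case p of (t, x, z) \<Rightarrow> \<lambda>(u, v, y). A t x z (u, v) + y *\<^sub>R (a z *\<^sub>R h (t, x, z)))) (at p within cyl)"
      using der by (cases p) auto
  next
    fix b :: "real \<times> 'a \<times> real" assume b: "b \<in> Basis"
    obtain u v y where uv: "b = (u, v, y)" by (cases b)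
    have an: "C_k n UNIV a" by (rule C_k_Suc_imp[OF Suc.prems(2)])
    have 1: "C_k n cyl (\<lambda>(t, x, z). A t x z (u, v))"
    \<comment> \<open>A basis vector points either in time or space or along the last axis. In the
      latter case the integral term vanishes by linearity; in the former the induction hypothesis
      applies to the derivative in that direction.\<close>
    proof (cases "y = 0")
      case True
      have "C_k n cyl (\<lambda>(t, x, z). oint k z (\<lambda>s. a s *\<^sub>R D (t, x, s) b))"
        by (rule Suc.IH[OF D(2)[OF b] an])
      then show ?thesis by (simp add: A_def uv True)
    next
      case False
      then have "u = 0" "v = 0" using b by (auto simp: uv Basis_prod_def zero_prod_def image_iff)
      then have "A t x z (u, v) = 0" if "t \<in> {0..T}" "x \<in> closure \<Omega>" for t x z
        using linear_0[OF lin] that by (simp add: A_def oint_def case_prod_unfold flip: zero_prod_def)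
      then show ?thesis by (intro C_k_cong[OF C_k_const[of _ _ 0]]) auto
    qed
    have 2: "C_k n cyl (\<lambda>p. y *\<^sub>R ((\<lambda>(t, x, z). a z) p *\<^sub>R h p))"
      by (intro C_k_scaleR C_k_const C_k_continuous_z an C_k_Suc_imp[OF Suc.prems(1)])
    show "C_k n cyl (\<lambda>p. (case p of (t, x, z) \<Rightarrow> \<lambda>(u, v, y). A t x z (u, v) + y *\<^sub>R (a z *\<^sub>R h (t, x, z))) b)"
      by (rule C_k_cong[OF C_k_add[OF 1 2]]) (auto simp: uv)
  qed
qed

end

section \<open>Both notions of solution as one functional\<close>

lemma L_infinityI:
  "f \<in> borel_measurable M \<Longrightarrow> AE x in M. norm (f x) \<le> C \<Longrightarrow> f \<in> L_infinity M"
  by (auto simp: L_infinity_def)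

lemma L_infinity_measurable: "f \<in> L_infinity M \<Longrightarrow> f \<in> borel_measurable M"
  by (simp add: L_infinity_def)

lemma L_infinityE:
  assumes "f \<in> L_infinity M"
  obtains C where "0 \<le> C" "AE x in M. norm (f x) \<le> C"
proof -
  obtain C where "AE x in M. norm (f x) \<le> C" using assms by (auto simp: L_infinity_def)
  then have "AE x in M. norm (f x) \<le> \<bar>C\<bar>" by eventually_elim simp
  then show ?thesis by (rule that[rotated]) simp
qed

lemma L_infinity_const: "(\<lambda>_. c) \<in> L_infinity M"
  by (rule L_infinityI[where C = "norm c"]) auto

lemma L_infinity_add:
  fixes f g :: "'c \<Rightarrow> 'b::{second_countable_topology, real_normed_vector}"
  assumes f: "f \<in> L_infinity M" and g: "g \<in> L_infinity M"
  shows "(\<lambda>x. f x + g x) \<in> L_infinity M"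
proof -
  obtain A where A: "AE x in M. norm (f x) \<le> A" by (rule L_infinityE[OF f])
  obtain B where B: "AE x in M. norm (g x) \<le> B" by (rule L_infinityE[OF g])
  have [measurable]: "f \<in> borel_measurable M" "g \<in> borel_measurable M"
    using f g by (auto intro: L_infinity_measurable)
  show ?thesis
  proof (rule L_infinityI[where C = "A + B"])
    show "AE x in M. norm (f x + g x) \<le> A + B"
      using A B by eventually_elim (rule norm_triangle_mono)
  qed measurable
qed

lemma L_infinity_bilinear:
  fixes f :: "'c \<Rightarrow> 'b::{second_countable_topology, real_normed_vector}"
    and g :: "'c \<Rightarrow> 'd::{second_countable_topology, real_normed_vector}"
    and B :: "'b \<Rightarrow> 'd \<Rightarrow> 'e::real_normed_vector"
  assumes B: "bounded_bilinear B" and f: "f \<in> L_infinity M" and g: "g \<in> L_infinity M"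
  shows "(\<lambda>x. B (f x) (g x)) \<in> L_infinity M"
proof -
  obtain C where C: "0 \<le> C" "AE x in M. norm (f x) \<le> C" by (rule L_infinityE[OF f])
  obtain D where D: "AE x in M. norm (g x) \<le> D" by (rule L_infinityE[OF g])
  obtain K where K: "0 \<le> K" "\<And>a b. norm (B a b) \<le> norm a * norm b * K"
    using bounded_bilinear.nonneg_bounded[OF B] by blast
  have fm: "f \<in> borel_measurable M" and gm: "g \<in> borel_measurable M"
    using f g by (auto intro: L_infinity_measurable)
  show ?thesis
  proof (rule L_infinityI[where C = "C * D * K"])
    have "continuous_on UNIV (\<lambda>p. B (fst p) (snd p))"
      by (intro bounded_bilinear.continuous_on[OF B] continuous_intros)
    then show "(\<lambda>x. B (f x) (g x)) \<in> borel_measurable M"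
      by (rule borel_measurable_continuous_Pair[OF fm gm])
    show "AE x in M. norm (B (f x) (g x)) \<le> C * D * K"
      using C(2) D
    proof eventually_elim
      case (elim x)
      have "norm (f x) * norm (g x) * K \<le> C * D * K"
        using elim C(1) K(1) by (intro mult_right_mono mult_mono) auto
      then show ?case using K(2)[of "f x" "g x"] by linarith
    qed
  qed
qed

lemmas L_infinity_mult = L_infinity_bilinear[OF bounded_bilinear_mult]
lemmas L_infinity_scaleR = L_infinity_bilinear[OF bounded_bilinear_scaleR]
lemmas L_infinity_inner = L_infinity_bilinear[OF bounded_bilinear_inner]

lemma L_infinity_diff:
  fixes f g :: "'c \<Rightarrow> 'b::{second_countable_topology, real_normed_vector}"
  assumes f: "f \<in> L_infinity M" and g: "g \<in> L_infinity M"
  shows "(\<lambda>x. f x - g x) \<in> L_infinity M"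
  using L_infinity_add[OF f L_infinity_scaleR[OF L_infinity_const g, of "-1"]] by simp

lemma L_infinity_sgn:
  fixes f :: "'c \<Rightarrow> real"
  assumes "f \<in> L_infinity M" shows "(\<lambda>x. sgn (f x)) \<in> L_infinity M"
proof (rule L_infinityI[where C = 1])
  have [measurable]: "f \<in> borel_measurable M" using assms by (rule L_infinity_measurable)
  show "(\<lambda>x. sgn (f x)) \<in> borel_measurable M" by measurable
qed (auto simp: sgn_if)

lemma L_infinity_abs:
  fixes f :: "'c \<Rightarrow> real"
  assumes "f \<in> L_infinity M" shows "(\<lambda>x. \<bar>f x\<bar>) \<in> L_infinity M"
  using L_infinity_mult[OF L_infinity_sgn[OF assms] assms] by (simp add: abs_sgn mult.commute)

text \<open>Two sets are involved: values in \<open>S\<close> everywhere give measurability of the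
  composition, values in the compact set \<open>K\<close> almost everywhere give the bound.\<close>

lemma L_infinity_continuous:
  fixes g :: "'c \<Rightarrow> 'b::euclidean_space" and Q :: "'b \<Rightarrow> 'd::real_normed_vector"
  assumes g: "g \<in> borel_measurable N" and S: "\<And>p. p \<in> space N \<Longrightarrow> g p \<in> S"
    and Q: "continuous_on S Q" and K: "compact K" "K \<subseteq> S" "AE p in N. g p \<in> K"
  shows "(\<lambda>p. Q (g p)) \<in> L_infinity N"
proof -
  obtain C where C: "\<And>x. x \<in> K \<Longrightarrow> norm (Q x) \<le> C"
    by (rule continuous_on_compact_bound[OF K(1) continuous_on_subset[OF Q K(2)]]) (rule that, assumption)
  have "g \<in> measurable N (restrict_space borel S)"
    by (rule measurable_restrict_space2[OF _ g]) (use S in auto)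
  from measurable_compose[OF this borel_measurable_continuous_on_restrict[OF Q]]
  show ?thesis
  proof (rule L_infinityI)
    show "AE p in N. norm (Q (g p)) \<le> C" using K(3) by eventually_elim (rule C)
  qed
qed

lemma L_infinity_integrable:
  fixes f :: "'c \<Rightarrow> real"
  assumes "finite_measure M" "f \<in> L_infinity M" shows "integrable M f"
proof -
  interpret finite_measure M by fact
  obtain C where C: "AE x in M. norm (f x) \<le> C" by (rule L_infinityE[OF assms(2)])
  show ?thesis by (rule integrable_const_bound[OF C L_infinity_measurable[OF assms(2)]])
qed

lemma L_infinity_integral_add3:
  fixes f g h :: "'c \<Rightarrow> real"
  assumes M: "finite_measure M" and f: "f \<in> L_infinity M" and g: "g \<in> L_infinity M" and h: "h \<in> L_infinity M"
  shows "(\<integral>x. f x + g x + h x \<partial>M) = (\<integral>x. f x \<partial>M) + (\<integral>x. g x \<partial>M) + (\<integral>x. h x \<partial>M)"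
  using L_infinity_integrable[OF M f] L_infinity_integrable[OF M g] L_infinity_integrable[OF M h] by simp

text \<open>The half-space of times before \<open>T\<close> and the complement of the compact
  support are open and cover everything. On the second the function vanishes, so its extension by
  zero is continuously differentiable across time \<open>T\<close>.\<close>

lemma test_functionE:
  fixes \<phi> :: "real \<times> 'a::euclidean_space \<Rightarrow> real"
  assumes "test_function T \<phi>"
  obtains D where "\<And>p. (\<phi> has_derivative D p) (at p)" "\<And>b. b \<in> Basis \<Longrightarrow> continuous_on UNIV (\<lambda>p. D p b)"
    "\<And>t x. T \<le> t \<Longrightarrow> \<phi> (t, x) = 0"
proof -
  let ?U = "{..<T} \<times> (UNIV::'a set)"
  obtain K where C: "C_k 1 ?U \<phi>" and K: "compact K" "K \<subseteq> ?U" "\<And>p. p \<notin> K \<Longrightarrow> \<phi> p = 0"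
    using assms unfolding test_function_def by blast
  from C obtain E where E: "\<And>p. p \<in> ?U \<Longrightarrow> (\<phi> has_derivative E p) (at p within ?U)"
    "\<And>b. b \<in> Basis \<Longrightarrow> continuous_on ?U (\<lambda>p. E p b)" by (rule C_k_1E) (rule that, assumption+)
  have oU: "open ?U" by (intro open_Times) auto
  have oK: "open (- K)" using K(1) by (simp add: compact_imp_closed open_Compl)
  define D where "D p = (if p \<in> ?U then E p else (\<lambda>_. 0))" for p
  have D0: "(\<phi> has_derivative (\<lambda>_. 0)) (at p)" if "p \<in> - K" for p
    by (rule has_derivative_transform_within_open[OF has_derivative_const[of 0] oK that]) (simp add: K(3))
  have D: "(\<phi> has_derivative D p) (at p)" for p
  proof (cases "p \<in> ?U")
    case True
    then show ?thesis using E(1)[OF True] at_within_open[OF True oU] by (simp add: D_def)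
  next
    case False
    then have "p \<in> - K" using K(2) by auto
    then show ?thesis using D0 False by (simp add: D_def)
  qed
  have "continuous_on UNIV (\<lambda>p. D p b)" if b: "b \<in> Basis" for b
  proof -
    have "continuous_on ?U (\<lambda>p. D p b)"
      by (rule continuous_on_eq[OF E(2)[OF b]]) (simp add: D_def)
    moreover have "continuous_on (- K) (\<lambda>p. D p b)"
    proof (rule continuous_on_eq[OF continuous_on_const[of _ 0]])
      fix p assume "p \<in> - K"
      then have "D p = (\<lambda>_. 0)" by (rule has_derivative_unique[OF D D0])
      then show "0 = D p b" by simp
    qed
    ultimately have "continuous_on (?U \<union> - K) (\<lambda>p. D p b)"
      by (intro continuous_on_open_Un oU oK)
    moreover have "?U \<union> - K = UNIV" using K(2) by auto
    ultimately show ?thesis by simp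
  qed
  moreover have "\<phi> (t, x) = 0" if "T \<le> t" for t x
    using K(2) K(3)[of "(t, x)"] that by (cases "(t, x) \<in> K") auto
  ultimately show ?thesis using D by (intro that[of D])
qed

text \<open>The divergence in space read off from a derivative within the cylinder. Unlike the full
  derivative in \<open>div_x\<close>, this is meaningful and continuous up to the boundary.\<close>

definition dv :: "('c \<Rightarrow> real \<times> 'a::euclidean_space \<times> real \<Rightarrow> 'a) \<Rightarrow> 'c \<Rightarrow> real" where
  "dv D p = (\<Sum>b\<in>Basis. D p (0, b, 0) \<bullet> b)"

section \<open>Partial derivatives and compositions on the cylinder\<close>

context domain
begin

lemma partial_x_derivative:
  assumes h: "(h has_derivative D) (at (t, x, z) within cyl)" and t: "t \<in> {0..T}" and x: "x \<in> \<Omega>"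
  shows "((\<lambda>y. h (t, y, z)) has_derivative (\<lambda>v. D (0, v, 0))) (at x)"
proof -
  have sub: "(\<lambda>y. (t, y, z)) ` \<Omega> \<subseteq> cyl" using t closure_subset by auto
  have "((\<lambda>y. (t, y, z)) has_derivative (\<lambda>v. (0, v, 0))) (at x within \<Omega>)"
    by (intro has_derivative_Pair has_derivative_const has_derivative_ident)
  from has_derivative_in_compose[OF this has_derivative_subset[OF h sub]]
  show ?thesis using at_within_open[OF x \<Omega>(1)] by simp
qed

lemma div_x_eq:
  assumes h: "(h has_derivative D (t, x, z)) (at (t, x, z) within cyl)" and t: "t \<in> {0..T}" and x: "x \<in> \<Omega>"
  shows "div_x h t x z = dv D (t, x, z)"
  unfolding div_x_def dv_def frechet_derivative_at[OF partial_x_derivative[OF h t x], symmetric] by (rule refl)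

text \<open>The last axis of the cylinder is unrestricted, so this partial derivative is two-sided
  even at boundary points of \<Omega>.\<close>

lemma partial_u_derivative:
  assumes h: "(h has_derivative D) (at (t, x, z) within cyl)" and t: "t \<in> {0..T}" and x: "x \<in> closure \<Omega>"
  shows "((\<lambda>s. h (t, x, s)) has_vector_derivative D (0, 0, 1)) (at z)"
proof -
  have sub: "(\<lambda>s. (t, x, s)) ` UNIV \<subseteq> cyl" by (rule image_subsetI) (simp add: t[simplified] x)
  have "((\<lambda>s. (t, x, s)) has_derivative (\<lambda>v. (0, 0, v))) (at z)"
    by (intro has_derivative_Pair has_derivative_const has_derivative_ident)
  from has_derivative_in_compose[OF this has_derivative_subset[OF h sub]]
  have "((\<lambda>s. h (t, x, s)) has_derivative (\<lambda>v. D (0, 0, v))) (at z)" .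
  moreover have "(\<lambda>v. D (0, 0, v)) = (\<lambda>v. v *\<^sub>R D (0, 0, 1))"
  proof
    fix v :: real
    have "v *\<^sub>R (0, 0, 1) = (0::real, 0::'a, v)" by simp
    with linear_cmul[OF has_derivative_linear[OF h], of v "(0, 0, 1)"]
    show "D (0, 0, v) = v *\<^sub>R D (0, 0, 1)" by (simp only:)
  qed
  ultimately show ?thesis unfolding has_vector_derivative_def by simp
qed

lemma continuous_on_dv:
  fixes D :: "real \<times> 'a \<times> real \<Rightarrow> real \<times> 'a \<times> real \<Rightarrow> 'a"
  assumes "\<And>b. b \<in> Basis \<Longrightarrow> continuous_on cyl (\<lambda>p. D p b)"
  shows "continuous_on cyl (dv D)"
  unfolding dv_def[abs_def] by (intro continuous_intros assms) (auto simp: Basis_prod_def)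

lemma L_infinity_cyl:
  fixes Q :: "real \<times> 'a \<times> real \<Rightarrow> 'd::real_normed_vector"
  assumes Q: "continuous_on cyl Q" and \<tau>: "\<tau> \<in> borel_measurable N" and \<rho>: "\<rho> \<in> borel_measurable N"
    and sp: "\<And>p. p \<in> space N \<Longrightarrow> \<tau> p \<in> {0..T} \<and> \<rho> p \<in> closure \<Omega>" and \<zeta>: "\<zeta> \<in> L_infinity N"
  shows "(\<lambda>p. Q (\<tau> p, \<rho> p, \<zeta> p)) \<in> L_infinity N"
proof -
  obtain R where R: "AE p in N. norm (\<zeta> p) \<le> R" by (rule L_infinityE[OF \<zeta>])
  have [measurable]: "\<zeta> \<in> borel_measurable N" using \<zeta> by (rule L_infinity_measurable)
  note [measurable] = \<tau> \<rho>
  show ?thesis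
  proof (rule L_infinity_continuous[where S = cyl and K = "{0..T} \<times> closure \<Omega> \<times> {-R..R}", OF _ _ Q])
    show "(\<lambda>p. (\<tau> p, \<rho> p, \<zeta> p)) \<in> borel_measurable N" by measurable
    show "(\<tau> p, \<rho> p, \<zeta> p) \<in> cyl" if "p \<in> space N" for p using sp[OF that] by simp
    show "compact ({0..T} \<times> closure \<Omega> \<times> {-R..R})" by (intro compact_Times compact_closure_\<Omega> compact_Icc)
    show "{0..T} \<times> closure \<Omega> \<times> {-R..R} \<subseteq> cyl" by auto
    have "AE p in N. \<tau> p \<in> {0..T} \<and> \<rho> p \<in> closure \<Omega>" by (rule AE_I2) (rule sp)
    with R show "AE p in N. (\<tau> p, \<rho> p, \<zeta> p) \<in> {0..T} \<times> closure \<Omega> \<times> {-R..R}"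
      by eventually_elim auto
  qed
qed

end

text \<open>One test function is fixed together with its derivative on the whole space.
  \<open>w\<close> stands for the trace; both inequalities contain it through \<open>f\<close> only,
  and the comparison is made for an arbitrary bounded \<open>w\<close>.\<close>

locale ibvp = domain \<Omega> T for \<Omega> :: "'a::euclidean_space set" and T +
  fixes \<sigma> :: "'a measure"
    and f :: "real \<times> 'a \<times> real \<Rightarrow> 'a" and Df :: "real \<times> 'a \<times> real \<Rightarrow> real \<times> 'a \<times> real \<Rightarrow> 'a"
    and F :: "real \<times> 'a \<times> real \<Rightarrow> real" and u\<^sub>o :: "'a \<Rightarrow> real" and u\<^sub>b u w \<phi> :: "real \<times> 'a \<Rightarrow> real"
    and D\<phi> :: "real \<times> 'a \<Rightarrow> real \<times> 'a \<Rightarrow> real"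
  assumes T: "T > 0" and \<sigma>: "surface_measure \<Omega> \<sigma>"
    and f: "\<And>p. p \<in> cyl \<Longrightarrow> (f has_derivative Df p) (at p within cyl)"
    and Df: "\<And>b. b \<in> Basis \<Longrightarrow> C_k 1 cyl (\<lambda>p. Df p b)"
    and F: "continuous_on cyl F"
    and u\<^sub>o: "u\<^sub>o \<in> L_infinity (restrict_space lborel \<Omega>)"
    and u\<^sub>b: "u\<^sub>b \<in> L_infinity (lateral_measure T \<sigma>)"
    and u: "u \<in> L_infinity (interior_measure T \<Omega>)"
    and w: "w \<in> L_infinity (lateral_measure T \<sigma>)"
    and \<phi>: "\<And>p. (\<phi> has_derivative D\<phi> p) (at p)"
    and D\<phi>: "\<And>b. b \<in> Basis \<Longrightarrow> continuous_on UNIV (\<lambda>p. D\<phi> p b)"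
    and \<phi>_zero: "\<And>t x. T \<le> t \<Longrightarrow> \<phi> (t, x) = 0"
begin

section \<open>Measures, test function and bounded integrands\<close>

abbreviation "MI \<equiv> interior_measure T \<Omega>"
abbreviation "MB \<equiv> lateral_measure T \<sigma>"
abbreviation "M0 \<equiv> (restrict_space lborel \<Omega> :: 'a measure)"
abbreviation "\<nu> \<equiv> exterior_normal \<Omega>"

definition \<phi>\<^sub>t :: "real \<times> 'a \<Rightarrow> real" where "\<phi>\<^sub>t p = D\<phi> p (1, 0)"
definition \<phi>\<^sub>x :: "real \<times> 'a \<Rightarrow> 'a" where "\<phi>\<^sub>x p = (\<Sum>b\<in>Basis. D\<phi> p (0, b) *\<^sub>R b)"

lemma D\<phi>_eq: "D\<phi> p (s, v) = s * \<phi>\<^sub>t p + \<phi>\<^sub>x p \<bullet> v"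
proof -
  have l: "linear (D\<phi> p)" by (rule has_derivative_linear[OF \<phi>])
  have "linear (\<lambda>v. D\<phi> p (0, v))"
    by (rule linear_compose[OF _ l, unfolded o_def]) (auto intro!: linearI)
  from linear_eq_inner_sum[OF this, of v] have "D\<phi> p (0, v) = \<phi>\<^sub>x p \<bullet> v" by (simp add: \<phi>\<^sub>x_def)
  moreover have "D\<phi> p (s, 0) = s * \<phi>\<^sub>t p"
  proof -
    have "s *\<^sub>R (1, 0) = (s, 0::'a)" by simp
    with linear_cmul[OF l, of s "(1, 0)"] show ?thesis by (simp only: \<phi>\<^sub>t_def real_scaleR_def)
  qed
  moreover have "D\<phi> p (s, v) = D\<phi> p (s, 0) + D\<phi> p (0, v)" 
  proof -
    have "(s, 0) + (0, v) = (s, v)" by simp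
    with linear_add[OF l, of "(s, 0)" "(0, v)"] show ?thesis by (simp only:)
  qed
  ultimately show ?thesis by simp
qed

lemma deriv_\<phi>: "((\<lambda>s. \<phi> (s, x)) has_real_derivative \<phi>\<^sub>t (t, x)) (at t)"
proof -
  have "((\<lambda>s. (s, x)) has_derivative (\<lambda>s. (s, 0))) (at t)"
    by (intro has_derivative_Pair has_derivative_const has_derivative_ident)
  from has_derivative_compose[OF this \<phi>] show ?thesis
    unfolding has_field_derivative_def by (rule has_derivative_eq_rhs) (auto simp: D\<phi>_eq)
qed

lemma deriv_\<phi>_eq: "deriv (\<lambda>s. \<phi> (s, x)) t = \<phi>\<^sub>t (t, x)"
  by (rule DERIV_imp_deriv[OF deriv_\<phi>])

lemma derivative_\<phi>_x: "((\<lambda>y. \<phi> (t, y)) has_derivative (\<lambda>v. \<phi>\<^sub>x (t, x) \<bullet> v)) (at x)"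
proof -
  have "((\<lambda>y. (t, y)) has_derivative (\<lambda>v. (0, v))) (at x)"
    by (intro has_derivative_Pair has_derivative_const has_derivative_ident)
  from has_derivative_compose[OF this \<phi>] show ?thesis by (simp add: D\<phi>_eq)
qed

lemma grad_\<phi>_eq: "grad (\<lambda>y. \<phi> (t, y)) x = \<phi>\<^sub>x (t, x)"
  unfolding grad_def frechet_derivative_at[OF derivative_\<phi>_x, symmetric]
  by (rule euclidean_representation)

lemma cont_\<phi>: "continuous_on S \<phi>"
  by (intro continuous_at_imp_continuous_on ballI has_derivative_continuous[OF \<phi>])

lemma cont_\<phi>\<^sub>t: "continuous_on UNIV \<phi>\<^sub>t"
  unfolding \<phi>\<^sub>t_def[abs_def] by (rule D\<phi>) (simp add: Basis_prod_def)

lemma cont_\<phi>\<^sub>x: "continuous_on UNIV \<phi>\<^sub>x"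
  unfolding \<phi>\<^sub>x_def[abs_def] by (intro continuous_intros D\<phi>) (auto simp: Basis_prod_def)

lemma cont_f: "continuous_on cyl f"
  by (rule has_derivative_continuous_on[OF f])

lemma cont_Df: "b \<in> Basis \<Longrightarrow> continuous_on cyl (\<lambda>p. Df p b)"
  by (rule C_k_imp_continuous[OF Df])

lemma cont_dvf: "continuous_on cyl (dv Df)"
  by (rule continuous_on_dv[OF cont_Df])

lemma space_MI: "space MI = {0..T} \<times> \<Omega>"
  by (simp add: interior_measure_def space_restrict_space)

lemma space_MB: "space MB = {0..T} \<times> frontier \<Omega>"
  by (simp add: lateral_measure_def space_pair_measure space_restrict_space surface_measure_space(2)[OF \<sigma>])

lemma frontier_closure: "x \<in> frontier \<Omega> \<Longrightarrow> x \<in> closure \<Omega>" by (simp add: frontier_def)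

lemma finite_\<sigma>: "finite_measure \<sigma>" by (rule surface_measure_finite[OF \<Omega> \<sigma>])

lemma finite_MI: "finite_measure MI"
proof
  have "bounded ({0..T} \<times> \<Omega>)" by (intro bounded_Times \<Omega> bounded_closed_interval)
  then show "emeasure MI (space MI) \<noteq> \<infinity>"
    unfolding space_MI using \<Omega>(1) emeasure_bounded_finite[of "{0..T} \<times> \<Omega>"]
    by (simp add: interior_measure_def emeasure_restrict_space borel_Times)
qed

lemma finite_M0: "finite_measure M0"
proof
  show "emeasure M0 (space M0) \<noteq> \<infinity>"
    using \<Omega>(1,2) emeasure_bounded_finite[of \<Omega>] by (simp add: emeasure_restrict_space space_restrict_space)
qed

lemma finite_time: "finite_measure (restrict_space lborel {a..b::real})"
proof
  show "emeasure (restrict_space lborel {a..b}) (space (restrict_space lborel {a..b})) \<noteq> \<infinity>"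
    by (simp add: emeasure_restrict_space space_restrict_space emeasure_lborel_Icc_eq)
qed

lemma finite_MB: "finite_measure MB"
  unfolding lateral_measure_def by (rule finite_measure_pair_measure[OF finite_\<sigma> finite_time])

lemma meas_MI: "fst \<in> borel_measurable MI" "snd \<in> borel_measurable MI"
  unfolding interior_measure_def measurable_lborel1
  by (intro measurable_restrict_space1, simp, intro borel_measurable_continuous_onI continuous_intros)+

lemma meas_id_\<sigma>: "(\<lambda>x. x) \<in> borel_measurable \<sigma>"
  unfolding measurable_cong_sets[OF surface_measure_space(1)[OF \<sigma>] refl] by (intro measurable_restrict_space1) simp

lemma meas_MB: "fst \<in> borel_measurable MB" "snd \<in> borel_measurable MB"
proof -
  have "(\<lambda>t. t) \<in> borel_measurable (restrict_space lborel {0..T})"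
    by (rule measurable_restrict_space1) simp
  from measurable_compose[OF measurable_fst this, of \<sigma>] show "fst \<in> borel_measurable MB"
    by (simp add: lateral_measure_def)
  from measurable_compose[OF measurable_snd meas_id_\<sigma>, of "restrict_space lborel {0..T}"]
  show "snd \<in> borel_measurable MB" by (simp add: lateral_measure_def)
qed

lemma L_infinity_normal: "(\<lambda>y. \<nu> (snd y)) \<in> L_infinity MB"
proof (rule L_infinity_continuous[where S = "frontier \<Omega>" and K = "frontier \<Omega>", OF meas_MB(2)])
  show "snd y \<in> frontier \<Omega>" if "y \<in> space MB" for y using that by (auto simp: space_MB)
  then show "AE y in MB. snd y \<in> frontier \<Omega>" by (rule AE_I2)
qed (use \<Omega> in \<open>auto intro: continuous_on_exterior_normal compact_frontier_bounded\<close>)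

lemma L_infinity_time_space:
  fixes Q :: "real \<times> 'a \<Rightarrow> 'd::real_normed_vector"
  assumes Q: "continuous_on ({0..T} \<times> closure \<Omega>) Q" and \<tau>: "\<tau> \<in> borel_measurable N" and \<rho>: "\<rho> \<in> borel_measurable N"
    and sp: "\<And>p. p \<in> space N \<Longrightarrow> \<tau> p \<in> {0..T} \<and> \<rho> p \<in> closure \<Omega>"
  shows "(\<lambda>p. Q (\<tau> p, \<rho> p)) \<in> L_infinity N"
proof (rule L_infinity_cyl[where Q = "\<lambda>p. Q (fst p, fst (snd p))" and \<zeta> = "\<lambda>_. 0", simplified, OF _ \<tau> \<rho>])
  show "continuous_on cyl (\<lambda>p. Q (fst p, fst (snd p)))"
    by (rule continuous_on_compose2[OF Q]) (auto intro!: continuous_intros)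
qed (use sp L_infinity_const in auto)

lemma L_infinity_MI:
  fixes Q :: "real \<times> 'a \<times> real \<Rightarrow> 'd::real_normed_vector"
  assumes "continuous_on cyl Q" shows "(\<lambda>y. Q (fst y, snd y, u y)) \<in> L_infinity MI"
  by (rule L_infinity_cyl[OF assms meas_MI _ u]) (auto simp: space_MI subsetD[OF closure_subset])

lemma L_infinity_MB:
  fixes Q :: "real \<times> 'a \<times> real \<Rightarrow> 'd::real_normed_vector"
  assumes "continuous_on cyl Q" "\<zeta> \<in> L_infinity MB"
  shows "(\<lambda>y. Q (fst y, snd y, \<zeta> y)) \<in> L_infinity MB"
  by (rule L_infinity_cyl[OF assms(1) meas_MB _ assms(2)]) (auto simp: space_MB frontier_closure)

lemma L_infinity_MI':
  fixes Q :: "real \<times> 'a \<Rightarrow> 'd::real_normed_vector"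
  assumes "continuous_on UNIV Q" shows "Q \<in> L_infinity MI"
  using L_infinity_time_space[OF continuous_on_subset[OF assms subset_UNIV] meas_MI]
  by (auto simp: space_MI subsetD[OF closure_subset])

lemma L_infinity_MB':
  fixes Q :: "real \<times> 'a \<Rightarrow> 'd::real_normed_vector"
  assumes "continuous_on UNIV Q" shows "Q \<in> L_infinity MB"
  using L_infinity_time_space[OF continuous_on_subset[OF assms subset_UNIV] meas_MB]
  by (auto simp: space_MB frontier_closure)

lemma L_infinity_M0: "(\<lambda>x. \<phi> (0, x)) \<in> L_infinity M0"
proof -
  have "(\<lambda>x. x) \<in> borel_measurable M0" by (rule measurable_restrict_space1) simp
  from L_infinity_time_space[OF cont_\<phi> measurable_const this, of 0] show ?thesis
    using T by (auto simp: space_restrict_space subsetD[OF closure_subset])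
qed

lemma L_infinity_comp:
  fixes g :: "real \<Rightarrow> real"
  assumes "continuous_on UNIV g" "\<zeta> \<in> L_infinity N"
  shows "(\<lambda>y. g (\<zeta> y)) \<in> L_infinity N"
proof -
  obtain R where R: "AE p in N. norm (\<zeta> p) \<le> R" by (rule L_infinityE[OF assms(2)])
  show ?thesis
  proof (rule L_infinity_continuous[OF L_infinity_measurable[OF assms(2)] UNIV_I assms(1) compact_Icc subset_UNIV])
    show "AE p in N. \<zeta> p \<in> {-R..R}" using R by eventually_elim auto
  qed
qed

lemmas L_infinity_intros = L_infinity_add L_infinity_diff L_infinity_mult L_infinity_scaleR L_infinity_inner
  L_infinity_sgn L_infinity_abs L_infinity_const u\<^sub>o u\<^sub>b u w L_infinity_normal L_infinity_M0
  L_infinity_MI'[OF cont_\<phi>] L_infinity_MI'[OF cont_\<phi>\<^sub>t] L_infinity_MI'[OF cont_\<phi>\<^sub>x] L_infinity_MB'[OF cont_\<phi>]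
  L_infinity_MI[OF cont_f] L_infinity_MI[OF cont_dvf] L_infinity_MI[OF F] L_infinity_MB[OF cont_f]

text \<open>The entropy inequality for the entropy \<open>\<eta>\<close> with derivative \<open>\<kappa>\<close>, flux \<open>Q\<close> and divergence \<open>V\<close> of \<open>Q\<close>;
  none of the four needs to be smooth, so that Kruzhkov's entropies are covered as well.\<close>

definition JI :: "(real \<Rightarrow> real) \<Rightarrow> (real \<Rightarrow> real) \<Rightarrow> (real \<times> 'a \<times> real \<Rightarrow> 'a) \<Rightarrow> (real \<times> 'a \<times> real \<Rightarrow> real)
    \<Rightarrow> real \<times> 'a \<Rightarrow> real" where
  "JI \<eta> \<kappa> Q V y = (\<eta> (u y) * \<phi>\<^sub>t y + Q (fst y, snd y, u y) \<bullet> \<phi>\<^sub>x y)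
     + \<kappa> (u y) * (F (fst y, snd y, u y) - dv Df (fst y, snd y, u y)) * \<phi> y + V (fst y, snd y, u y) * \<phi> y"

definition J0 :: "(real \<Rightarrow> real) \<Rightarrow> 'a \<Rightarrow> real" where
  "J0 \<eta> x = \<eta> (u\<^sub>o x) * \<phi> (0, x)"

definition JL :: "(real \<Rightarrow> real) \<Rightarrow> (real \<times> 'a \<times> real \<Rightarrow> 'a) \<Rightarrow> real \<times> 'a \<Rightarrow> real" where
  "JL \<kappa> Q y = \<kappa> (u\<^sub>b y) * ((f (fst y, snd y, u\<^sub>b y) - f (fst y, snd y, w y)) \<bullet> \<nu> (snd y)) * \<phi> y
     - (Q (fst y, snd y, u\<^sub>b y) \<bullet> \<nu> (snd y)) * \<phi> y"

definition J :: "(real \<Rightarrow> real) \<Rightarrow> (real \<Rightarrow> real) \<Rightarrow> (real \<times> 'a \<times> real \<Rightarrow> 'a) \<Rightarrow> (real \<times> 'a \<times> real \<Rightarrow> real) \<Rightarrow> real" where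
  "J \<eta> \<kappa> Q V = (\<integral>y. JI \<eta> \<kappa> Q V y \<partial>MI) + (\<integral>x. J0 \<eta> x \<partial>M0) + (\<integral>y. JL \<kappa> Q y \<partial>MB)"

definition Qk :: "real \<Rightarrow> real \<times> 'a \<times> real \<Rightarrow> 'a" where
  "Qk k p = sgn (snd (snd p) - k) *\<^sub>R (f p - f (fst p, fst (snd p), k))"

text \<open>The divergence in space of \<open>Qk k\<close>: the sign does not depend on the space
  variable and is frozen with \<open>z\<close>.\<close>

definition Vk :: "real \<Rightarrow> real \<times> 'a \<times> real \<Rightarrow> real" where
  "Vk k p = sgn (snd (snd p) - k) * (dv Df p - dv Df (fst p, fst (snd p), k))"

text \<open>\<open>J\<close> gathers several integrals under one integral sign; boundedness of every
  term on a finite measure space justifies this. \<open>dv Dq\<close> replaces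
  \<open>div_x q\<close> because \<Omega> is open.\<close>

lemma J_entropy:
  assumes \<eta>: "continuous_on UNIV \<eta>" "continuous_on UNIV (deriv \<eta>)"
    and q: "\<And>p. p \<in> cyl \<Longrightarrow> (q has_derivative Dq p) (at p within cyl)"
      "\<And>b. b \<in> Basis \<Longrightarrow> continuous_on cyl (\<lambda>p. Dq p b)"
  shows "(\<integral>(t, x). \<eta> (u (t, x)) * deriv (\<lambda>s. \<phi> (s, x)) t
                 + q (t, x, u (t, x)) \<bullet> grad (\<lambda>y. \<phi> (t, y)) x \<partial>MI)
        + (\<integral>(t, x). deriv \<eta> (u (t, x)) * (F (t, x, u (t, x)) - div_x f t x (u (t, x))) * \<phi> (t, x) \<partial>MI)
        + (\<integral>(t, x). div_x q t x (u (t, x)) * \<phi> (t, x) \<partial>MI)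
        + (\<integral>x. \<eta> (u\<^sub>o x) * \<phi> (0, x) \<partial>M0)
        - (\<integral>(t, \<xi>). (q (t, \<xi>, u\<^sub>b (t, \<xi>)) \<bullet> \<nu> \<xi>) * \<phi> (t, \<xi>) \<partial>MB)
        + (\<integral>(t, \<xi>). deriv \<eta> (u\<^sub>b (t, \<xi>)) * ((f (t, \<xi>, u\<^sub>b (t, \<xi>)) - f (t, \<xi>, w (t, \<xi>))) \<bullet> \<nu> \<xi>) * \<phi> (t, \<xi>) \<partial>MB)
      = J \<eta> (deriv \<eta>) q (dv Dq)"
proof -
  have cq: "continuous_on cyl q"
    by (rule has_derivative_continuous_on[OF q(1)])
  note intr = L_infinity_intros L_infinity_MI[OF cq] L_infinity_MB[OF cq] L_infinity_comp[OF \<eta>(1)] L_infinity_comp[OF \<eta>(2)]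
    L_infinity_MI[OF continuous_on_dv[OF q(2)]]
  have cyl: "(t, x, z) \<in> cyl" if "t \<in> {0..T}" "x \<in> \<Omega>" for t x z
    using that by (simp add: subsetD[OF closure_subset])
  have 1: "(\<integral>(t, x). \<eta> (u (t, x)) * deriv (\<lambda>s. \<phi> (s, x)) t + q (t, x, u (t, x)) \<bullet> grad (\<lambda>y. \<phi> (t, y)) x \<partial>MI)
    = (\<integral>y. \<eta> (u y) * \<phi>\<^sub>t y + q (fst y, snd y, u y) \<bullet> \<phi>\<^sub>x y \<partial>MI)"
    by (rule Bochner_Integration.integral_cong) (auto simp: deriv_\<phi>_eq grad_\<phi>_eq)
  have 2: "(\<integral>(t, x). deriv \<eta> (u (t, x)) * (F (t, x, u (t, x)) - div_x f t x (u (t, x))) * \<phi> (t, x) \<partial>MI)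
    = (\<integral>y. deriv \<eta> (u y) * (F (fst y, snd y, u y) - dv Df (fst y, snd y, u y)) * \<phi> y \<partial>MI)"
    by (rule Bochner_Integration.integral_cong) (auto simp: space_MI div_x_eq[where h = f and D = Df, OF f[OF cyl]])
  have 3: "(\<integral>(t, x). div_x q t x (u (t, x)) * \<phi> (t, x) \<partial>MI) = (\<integral>y. dv Dq (fst y, snd y, u y) * \<phi> y \<partial>MI)"
    by (rule Bochner_Integration.integral_cong) (auto simp: space_MI div_x_eq[where h = q and D = Dq, OF q(1)[OF cyl]])
  have "(\<integral>y. JI \<eta> (deriv \<eta>) q (dv Dq) y \<partial>MI) =
    (\<integral>y. \<eta> (u y) * \<phi>\<^sub>t y + q (fst y, snd y, u y) \<bullet> \<phi>\<^sub>x y \<partial>MI)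
    + (\<integral>y. deriv \<eta> (u y) * (F (fst y, snd y, u y) - dv Df (fst y, snd y, u y)) * \<phi> y \<partial>MI)
    + (\<integral>y. dv Dq (fst y, snd y, u y) * \<phi> y \<partial>MI)"
    unfolding JI_def
    by (rule L_infinity_integral_add3[OF finite_MI]) (intro intr)+
  moreover have "(\<integral>y. JL (deriv \<eta>) q y \<partial>MB) =
    (\<integral>y. deriv \<eta> (u\<^sub>b y) * ((f (fst y, snd y, u\<^sub>b y) - f (fst y, snd y, w y)) \<bullet> \<nu> (snd y)) * \<phi> y \<partial>MB)
    - (\<integral>y. (q (fst y, snd y, u\<^sub>b y) \<bullet> \<nu> (snd y)) * \<phi> y \<partial>MB)"
    unfolding JL_def
    by (rule Bochner_Integration.integral_diff[OF L_infinity_integrable[OF finite_MB] L_infinity_integrable[OF finite_MB]]) (intro intr)+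
  ultimately show ?thesis
    unfolding 1 2 3 by (simp add: J_def J0_def case_prod_unfold)
qed

text \<open>With Kruzhkov's flux the divergence of \<open>f\<close> at \<open>u\<close> cancels in
  the interior and \<open>f\<close> at \<open>u\<^sub>b\<close> cancels on the boundary. What
  remains is the divergence at \<open>k\<close> and the difference between the trace and
  \<open>k\<close>, as in the BLN inequality.\<close>

lemma J_kruzhkov:
  "(\<integral>(t, x). \<bar>u (t, x) - k\<bar> * deriv (\<lambda>s. \<phi> (s, x)) t \<partial>MI)
        + (\<integral>(t, x). sgn (u (t, x) - k) *
             ((f (t, x, u (t, x)) - f (t, x, k)) \<bullet> grad (\<lambda>y. \<phi> (t, y)) x) \<partial>MI)
        + (\<integral>(t, x). sgn (u (t, x) - k) * (F (t, x, u (t, x)) - div_x f t x k) * \<phi> (t, x) \<partial>MI)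
        + (\<integral>x. \<bar>u\<^sub>o x - k\<bar> * \<phi> (0, x) \<partial>M0)
        - (\<integral>(t, \<xi>). sgn (u\<^sub>b (t, \<xi>) - k) * ((f (t, \<xi>, w (t, \<xi>)) - f (t, \<xi>, k)) \<bullet> \<nu> \<xi>) * \<phi> (t, \<xi>) \<partial>MB)
      = J (\<lambda>z. \<bar>z - k\<bar>) (\<lambda>z. sgn (z - k)) (Qk k) (Vk k)"
proof -
  have "continuous_on cyl (\<lambda>p. (fst p, fst (snd p), k))" by (intro continuous_intros)
  moreover have "(\<lambda>p. (fst p, fst (snd p), k)) ` cyl \<subseteq> cyl" by (rule image_subsetI) (simp add: mem_Times_iff)
  ultimately have ck: "continuous_on cyl (\<lambda>p. f (fst p, fst (snd p), k))" "continuous_on cyl (\<lambda>p. dv Df (fst p, fst (snd p), k))"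
    using continuous_on_compose2[OF cont_f] continuous_on_compose2[OF cont_dvf] by blast+
  note intr = L_infinity_intros L_infinity_MI[OF ck(1), simplified] L_infinity_MB[OF ck(1) L_infinity_const[of 0], simplified]
    L_infinity_MI[OF ck(2), simplified]
  have cyl: "(t, x, z) \<in> cyl" if "t \<in> {0..T}" "x \<in> \<Omega>" for t x z
    using that by (simp add: subsetD[OF closure_subset])
  have 1: "(\<integral>(t, x). \<bar>u (t, x) - k\<bar> * deriv (\<lambda>s. \<phi> (s, x)) t \<partial>MI) = (\<integral>y. \<bar>u y - k\<bar> * \<phi>\<^sub>t y \<partial>MI)"
    by (rule Bochner_Integration.integral_cong) (auto simp: deriv_\<phi>_eq)
  have 2: "(\<integral>(t, x). sgn (u (t, x) - k) * ((f (t, x, u (t, x)) - f (t, x, k)) \<bullet> grad (\<lambda>y. \<phi> (t, y)) x) \<partial>MI) =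
    (\<integral>y. sgn (u y - k) * ((f (fst y, snd y, u y) - f (fst y, snd y, k)) \<bullet> \<phi>\<^sub>x y) \<partial>MI)"
    by (rule Bochner_Integration.integral_cong) (auto simp: grad_\<phi>_eq)
  have 3: "(\<integral>(t, x). sgn (u (t, x) - k) * (F (t, x, u (t, x)) - div_x f t x k) * \<phi> (t, x) \<partial>MI) =
    (\<integral>y. sgn (u y - k) * (F (fst y, snd y, u y) - dv Df (fst y, snd y, k)) * \<phi> y \<partial>MI)"
    by (rule Bochner_Integration.integral_cong) (auto simp: space_MI div_x_eq[where h = f and D = Df, OF f[OF cyl]])
  have "(\<integral>y. JI (\<lambda>z. \<bar>z - k\<bar>) (\<lambda>z. sgn (z - k)) (Qk k) (Vk k) y \<partial>MI) =
    (\<integral>y. \<bar>u y - k\<bar> * \<phi>\<^sub>t y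
      + sgn (u y - k) * ((f (fst y, snd y, u y) - f (fst y, snd y, k)) \<bullet> \<phi>\<^sub>x y)
      + sgn (u y - k) * (F (fst y, snd y, u y) - dv Df (fst y, snd y, k)) * \<phi> y \<partial>MI)"
    by (rule Bochner_Integration.integral_cong) (simp_all add: JI_def Qk_def Vk_def algebra_simps)
  also have "\<dots> = (\<integral>y. \<bar>u y - k\<bar> * \<phi>\<^sub>t y \<partial>MI)
      + (\<integral>y. sgn (u y - k) * ((f (fst y, snd y, u y) - f (fst y, snd y, k)) \<bullet> \<phi>\<^sub>x y) \<partial>MI)
      + (\<integral>y. sgn (u y - k) * (F (fst y, snd y, u y) - dv Df (fst y, snd y, k)) * \<phi> y \<partial>MI)"
    by (rule L_infinity_integral_add3[OF finite_MI]) (intro intr)+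
  finally have i: "(\<integral>y. JI (\<lambda>z. \<bar>z - k\<bar>) (\<lambda>z. sgn (z - k)) (Qk k) (Vk k) y \<partial>MI) = \<dots>" .
  have "(\<integral>y. JL (\<lambda>z. sgn (z - k)) (Qk k) y \<partial>MB) =
    (\<integral>y. - (sgn (u\<^sub>b y - k) * ((f (fst y, snd y, w y) - f (fst y, snd y, k)) \<bullet> \<nu> (snd y)) * \<phi> y) \<partial>MB)"
    by (rule Bochner_Integration.integral_cong)
      (simp_all add: JL_def Qk_def algebra_simps)
  then show ?thesis
    unfolding 1 2 3 by (simp add: J_def J0_def i case_prod_unfold)
qed

end

section \<open>From smooth entropies to Kruzhkov's entropies\<close>

definition reg_inv :: "real \<Rightarrow> real \<Rightarrow> real \<Rightarrow> real" where
  "reg_inv k e z = inverse (sqrt ((z - k)\<^sup>2 + e\<^sup>2))"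

definition reg_abs :: "real \<Rightarrow> real \<Rightarrow> real \<Rightarrow> real" where
  "reg_abs k e z = sqrt ((z - k)\<^sup>2 + e\<^sup>2)"

definition reg_sgn :: "real \<Rightarrow> real \<Rightarrow> real \<Rightarrow> real" where
  "reg_sgn k e z = (z - k) * reg_inv k e z"

text \<open>The second derivative of \<open>reg_abs\<close>, an approximation of twice the Dirac
  mass at \<open>k\<close>.\<close>

definition reg_delta :: "real \<Rightarrow> real \<Rightarrow> real \<Rightarrow> real" where
  "reg_delta k e z = e\<^sup>2 * (reg_inv k e z * (reg_inv k e z * reg_inv k e z))"

lemma reg_pos: "e > 0 \<Longrightarrow> 0 < (z - k)\<^sup>2 + e\<^sup>2" for z k e :: real
  by (intro add_nonneg_pos) auto

lemma reg_inv_pos: "e > 0 \<Longrightarrow> 0 < reg_inv k e z"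
  using reg_pos[of e z k] by (simp add: reg_inv_def)

lemma reg_inv_square: "e > 0 \<Longrightarrow> reg_inv k e z * reg_inv k e z * ((z - k)\<^sup>2 + e\<^sup>2) = 1"
proof -
  assume "e > 0"
  define s where "s = sqrt ((z - k)\<^sup>2 + e\<^sup>2)"
  have "s > 0" "(z - k)\<^sup>2 + e\<^sup>2 = s * s" using reg_pos[OF \<open>e > 0\<close>, of z k] by (auto simp: s_def)
  then show ?thesis by (simp add: reg_inv_def s_def[symmetric] field_simps)
qed

lemma DERIV_reg_abs:
  assumes e: "e > 0" shows "(reg_abs k e has_real_derivative reg_sgn k e z) (at z)"
proof -
  have "((\<lambda>z. sqrt ((z - k)\<^sup>2 + e\<^sup>2)) has_real_derivative inverse (sqrt ((z - k)\<^sup>2 + e\<^sup>2)) / 2 * (2 * (z - k))) (at z)"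
    by (rule DERIV_chain2[where f = sqrt and g = "\<lambda>z. (z - k)\<^sup>2 + e\<^sup>2", OF DERIV_real_sqrt[OF reg_pos[OF e]]])
      (auto intro!: derivative_eq_intros)
  moreover have "inverse (sqrt ((z - k)\<^sup>2 + e\<^sup>2)) / 2 * (2 * (z - k)) = reg_sgn k e z"
    unfolding reg_sgn_def reg_inv_def by simp
  ultimately show ?thesis unfolding reg_abs_def[abs_def] by simp
qed

lemma DERIV_reg_inv:
  assumes e: "e > 0"
  shows "(reg_inv k e has_real_derivative - (z - k) * (reg_inv k e z * (reg_inv k e z * reg_inv k e z))) (at z)"
proof -
  have nz: "reg_abs k e z \<noteq> 0" using less_imp_neq[OF reg_pos[OF e, of z k]] unfolding reg_abs_def by simp
  have "((\<lambda>z. inverse (reg_abs k e z)) has_real_derivative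
      - (inverse (reg_abs k e z) * reg_sgn k e z * inverse (reg_abs k e z))) (at z)"
    by (rule DERIV_inverse'[OF DERIV_reg_abs[OF e] nz])
  moreover have "inverse (reg_abs k e z) = reg_inv k e z" for z by (simp add: reg_abs_def reg_inv_def)
  ultimately show ?thesis by (simp add: reg_sgn_def algebra_simps)
qed

lemma DERIV_reg_sgn:
  assumes e: "e > 0" shows "(reg_sgn k e has_real_derivative reg_delta k e z) (at z)"
proof -
  let ?a = "reg_inv k e z"
  have "(reg_sgn k e has_real_derivative (z - k) * (- (z - k) * (?a * (?a * ?a))) + 1 * ?a) (at z)"
    unfolding reg_sgn_def[abs_def]
    by (rule DERIV_mult'[OF _ DERIV_reg_inv[OF e]]) (auto intro!: derivative_eq_intros)
  moreover have "(z - k) * (- (z - k) * (?a * (?a * ?a))) + 1 * ?a = reg_delta k e z"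
  proof -
    have "?a = ?a * (?a * ?a * ((z - k)\<^sup>2 + e\<^sup>2))" using reg_inv_square[OF e, of k z] by simp
    then show ?thesis by (simp add: reg_delta_def algebra_simps power2_eq_square)
  qed
  ultimately show ?thesis by simp
qed

lemma C_k_real_derivative:
  assumes "\<And>z. (g has_real_derivative g' z) (at z)" "C_k n UNIV g'"
  shows "C_k (Suc n) UNIV g"
proof (rule C_k_SucI[where D = "\<lambda>z v. g' z * v"])
  show "(g has_derivative (\<lambda>v. g' z * v)) (at z)" for z
    using assms(1)[of z] by (simp add: has_field_derivative_def)
qed (use assms(2) in simp)

text \<open>The derivative of \<open>reg_inv\<close> is a polynomial in the variable and
  \<open>reg_inv\<close> itself, so one induction gives all orders; the other three functions follow
  from this one.\<close>

lemma C_k_reg_inv: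
  assumes e: "e > 0" shows "C_k n UNIV (reg_inv k e)"
proof (induction n)
  case 0
  show ?case using DERIV_reg_inv[OF e] by (auto intro: continuous_at_imp_continuous_on DERIV_isCont)
next
  case (Suc n)
  have id: "C_k n UNIV (\<lambda>z::real. z)" by (rule C_k_bounded_linear[OF bounded_linear_ident])
  have "C_k n UNIV (\<lambda>z. (k - z) * (reg_inv k e z * (reg_inv k e z * reg_inv k e z)))"
    by (intro C_k_mult C_k_diff C_k_const id Suc)
  then show ?case by (intro C_k_real_derivative[OF DERIV_reg_inv[OF e]]) simp
qed

lemma C_k_reg_sgn: "e > 0 \<Longrightarrow> C_k n UNIV (reg_sgn k e)"
  unfolding reg_sgn_def[abs_def]
  by (intro C_k_mult C_k_diff C_k_const C_k_bounded_linear[OF bounded_linear_ident] C_k_reg_inv)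

lemma C_k_reg_delta: "e > 0 \<Longrightarrow> C_k n UNIV (reg_delta k e)"
  unfolding reg_delta_def[abs_def] by (intro C_k_mult C_k_const C_k_reg_inv)

lemma C_k_reg_abs: "e > 0 \<Longrightarrow> C_k n UNIV (reg_abs k e)"
  using C_k_Suc_imp[OF C_k_real_derivative[OF DERIV_reg_abs C_k_reg_sgn]] .

lemma convex_reg_abs: "e > 0 \<Longrightarrow> convex_on UNIV (reg_abs k e)"
  by (rule f''_ge0_imp_convex[OF _ DERIV_reg_abs DERIV_reg_sgn])
    (auto simp: reg_delta_def intro!: mult_nonneg_nonneg less_imp_le[OF reg_inv_pos])

lemma abs_le_reg_abs: "\<bar>z - k\<bar> \<le> reg_abs k e z"
  unfolding reg_abs_def by (rule real_le_rsqrt) simp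

lemma reg_abs_le: "e > 0 \<Longrightarrow> reg_abs k e z \<le> \<bar>z - k\<bar> + e"
  unfolding reg_abs_def by (rule real_le_lsqrt) (auto simp: power2_sum)

lemma abs_reg_sgn_le: "e > 0 \<Longrightarrow> \<bar>reg_sgn k e z\<bar> \<le> 1"
proof -
  assume e: "e > 0"
  have r: "reg_inv k e z = inverse (reg_abs k e z)" by (simp add: reg_inv_def reg_abs_def)
  have "0 < reg_abs k e z" using reg_pos[OF e, of z k] by (simp add: reg_abs_def)
  then show ?thesis using abs_le_reg_abs[of z k e] by (simp add: reg_sgn_def r abs_mult field_simps)
qed

lemma reg_sgn_k [simp]: "reg_sgn k e k = 0" by (simp add: reg_sgn_def)

lemma reg_abs_tendsto: "(\<lambda>n. reg_abs k (inverse (real (Suc n))) z) \<longlonglongrightarrow> \<bar>z - k\<bar>"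
proof -
  have "(\<lambda>n. sqrt ((z - k)\<^sup>2 + (inverse (real (Suc n)))\<^sup>2)) \<longlonglongrightarrow> sqrt ((z - k)\<^sup>2 + 0\<^sup>2)"
    by (intro tendsto_intros LIMSEQ_inverse_real_of_nat)
  then show ?thesis by (simp add: reg_abs_def)
qed

text \<open>Convergence holds at every \<open>z\<close>. At \<open>z = k\<close> all members are
  zero, matching the convention for \<open>sgn\<close> at zero.\<close>

lemma reg_sgn_tendsto: "(\<lambda>n. reg_sgn k (inverse (real (Suc n))) z) \<longlonglongrightarrow> sgn (z - k)"
proof (cases "z = k")
  case False
  have "(\<lambda>n. (z - k) * inverse (reg_abs k (inverse (real (Suc n))) z)) \<longlonglongrightarrow> (z - k) * inverse \<bar>z - k\<bar>"
    by (intro tendsto_intros reg_abs_tendsto) (use False in simp)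
  moreover have "(z - k) * inverse \<bar>z - k\<bar> = sgn (z - k)"
    using False by (simp add: sgn_if field_simps)
  ultimately show ?thesis by (simp add: reg_sgn_def reg_abs_def reg_inv_def)
qed simp

lemma oint_bound:
  fixes w :: "real \<Rightarrow> 'b::euclidean_space"
  assumes "continuous_on UNIV w" "\<And>s. s \<in> closed_segment k z \<Longrightarrow> norm (w s) \<le> B"
  shows "norm (oint k z w) \<le> \<bar>z - k\<bar> * B"
proof -
  have c: "continuous_on {0..1} (\<lambda>\<theta>. w (k + \<theta> * (z - k)))"
    by (intro continuous_on_compose2[OF assms(1) _ subset_UNIV] continuous_intros)
  have "norm (integral {0..1} (\<lambda>\<theta>. w (k + \<theta> * (z - k)))) \<le> integral {0..1} (\<lambda>\<theta>::real. B)"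
  proof (rule integral_norm_bound_integral)
    fix \<theta> :: real assume "\<theta> \<in> {0..1}"
    then have "k + \<theta> * (z - k) \<in> closed_segment k z"
      unfolding closed_segment_def by (intro CollectI exI[of _ \<theta>]) (auto simp: algebra_simps)
    then show "norm (w (k + \<theta> * (z - k))) \<le> B" by (rule assms(2))
  qed (auto intro: integrable_continuous_interval[OF c])
  then show ?thesis by (simp add: oint_def mult_left_mono)
qed

lemma oint_same [simp]: "oint k k w = 0" by (simp add: oint_def)

text \<open>The entropy flux of \<open>reg_abs k e\<close> at a fixed \<open>(t, x)\<close>. It is defined in the form integrated by parts, because
  the form in \<open>reg_flux_eq\<close> costs one derivative of \<open>h\<close> and would be \<open>C\<^sup>1\<close> only.\<close>

definition reg_flux :: "real \<Rightarrow> real \<Rightarrow> (real \<Rightarrow> 'b::euclidean_space) \<Rightarrow> real \<Rightarrow> 'b" where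
  "reg_flux k e h z = reg_sgn k e z *\<^sub>R h z - oint k z (\<lambda>s. reg_delta k e s *\<^sub>R h s)"

lemma cont_reg: "e > 0 \<Longrightarrow> continuous_on S (reg_delta k e)" "e > 0 \<Longrightarrow> continuous_on S (reg_sgn k e)"
  by (auto intro: continuous_on_subset[OF C_k_imp_continuous[OF C_k_reg_delta[of _ 0]]]
      continuous_on_subset[OF C_k_imp_continuous[OF C_k_reg_sgn[of _ 0]]])

context
  fixes h h' :: "real \<Rightarrow> 'b::euclidean_space"
  assumes h: "\<And>s. (h has_vector_derivative h' s) (at s)" and h': "continuous_on UNIV h'"
begin

lemma cont_h: "continuous_on S h"
  by (intro continuous_at_imp_continuous_on ballI has_vector_derivative_continuous[OF h])

text \<open>In the product rule the term with \<open>reg_delta\<close> is cancelled by the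
  derivative of the integral.\<close>

lemma reg_flux_derivative:
  assumes e: "e > 0" shows "(reg_flux k e h has_vector_derivative reg_sgn k e z *\<^sub>R h' z) (at z)"
proof -
  have "continuous_on UNIV (\<lambda>s. reg_delta k e s *\<^sub>R h s)"
    by (intro continuous_intros cont_reg e cont_h)
  from has_vector_derivative_diff[OF has_vector_derivative_scaleR[OF DERIV_reg_sgn[OF e] h] oint_has_derivative[OF this]]
  have "((\<lambda>z. reg_sgn k e z *\<^sub>R h z - oint k z (\<lambda>s. reg_delta k e s *\<^sub>R h s)) has_vector_derivative
    reg_sgn k e z *\<^sub>R h' z + reg_delta k e z *\<^sub>R h z - reg_delta k e z *\<^sub>R h z) (at z)" .
  then show ?thesis unfolding reg_flux_def[abs_def] by simp
qed

text \<open>This form yields bounds uniform in \<open>e\<close>, as \<open>reg_sgn\<close> stays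
  between -1 and 1 while \<open>reg_delta\<close> blows up at \<open>k\<close> as \<open>e\<close>
  tends to zero.\<close>

lemma reg_flux_eq:
  assumes e: "e > 0" shows "reg_flux k e h z = oint k z (\<lambda>s. reg_sgn k e s *\<^sub>R h' s)"
proof -
  have "oint k z (\<lambda>s. reg_sgn k e s *\<^sub>R h' s) = reg_flux k e h z - reg_flux k e h k"
    by (rule oint_FTC) (rule has_vector_derivative_at_within[OF reg_flux_derivative[OF e]])
  then show ?thesis by (simp add: reg_flux_def)
qed

lemma reg_flux_bound:
  assumes e: "e > 0" and B: "\<And>s. s \<in> closed_segment k z \<Longrightarrow> norm (h' s) \<le> B"
  shows "norm (reg_flux k e h z) \<le> \<bar>z - k\<bar> * B"
  unfolding reg_flux_eq[OF e]
proof (rule oint_bound)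
  show "continuous_on UNIV (\<lambda>s. reg_sgn k e s *\<^sub>R h' s)" by (intro continuous_intros cont_reg e h')
  fix s assume "s \<in> closed_segment k z"
  then have "\<bar>reg_sgn k e s\<bar> * norm (h' s) \<le> 1 * B"
    by (intro mult_mono abs_reg_sgn_le e B) auto
  then show "norm (reg_sgn k e s *\<^sub>R h' s) \<le> B" by simp
qed

text \<open>Dominated convergence over the parameter interval. Between \<open>k\<close> and
  \<open>z\<close> the sign is constant and comes out of the limit integral, which the fundamental
  theorem then evaluates.\<close>

lemma reg_flux_tendsto:
  "(\<lambda>n. reg_flux k (inverse (real (Suc n))) h z) \<longlonglongrightarrow> sgn (z - k) *\<^sub>R (h z - h k)"
proof -
  define p where "p \<theta> = k + \<theta> * (z - k)" for \<theta>
  define g where "g \<theta> = h' (p \<theta>)" for \<theta>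
  have cg: "continuous_on {0..1} g"
    unfolding g_def p_def by (intro continuous_on_compose2[OF h' _ subset_UNIV] continuous_intros)
  have cp: "continuous_on {0..1} (\<lambda>\<theta>. reg_sgn k e (p \<theta>))" if "e > 0" for e
    unfolding p_def by (intro continuous_on_compose2[OF cont_reg(2)[OF that] _ subset_UNIV] continuous_intros)
  have pos: "inverse (real (Suc n)) > 0" for n by simp
  have "(\<lambda>n. integral {0..1} (\<lambda>\<theta>. reg_sgn k (inverse (real (Suc n))) (p \<theta>) *\<^sub>R g \<theta>))
      \<longlonglongrightarrow> integral {0..1} (\<lambda>\<theta>. sgn (p \<theta> - k) *\<^sub>R g \<theta>)"
  proof (rule dominated_convergence(2))
    show "(\<lambda>\<theta>. reg_sgn k (inverse (real (Suc n))) (p \<theta>) *\<^sub>R g \<theta>) integrable_on {0..1}" for n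
      by (intro integrable_continuous_interval continuous_intros cp cg pos)
    show "(\<lambda>\<theta>. norm (g \<theta>)) integrable_on {0..1}"
      by (intro integrable_continuous_interval continuous_intros cg)
    show "norm (reg_sgn k (inverse (real (Suc n))) (p \<theta>) *\<^sub>R g \<theta>) \<le> norm (g \<theta>)" for n \<theta>
      using mult_right_mono[OF abs_reg_sgn_le[OF pos[of n]], of "norm (g \<theta>)" k "p \<theta>"] by simp
    show "(\<lambda>n. reg_sgn k (inverse (real (Suc n))) (p \<theta>) *\<^sub>R g \<theta>) \<longlonglongrightarrow> sgn (p \<theta> - k) *\<^sub>R g \<theta>" for \<theta>
      by (intro tendsto_intros reg_sgn_tendsto)
  qed
  \<comment> \<open>Here \<open>p \<theta> - k\<close> is \<open>\<theta> * (z - k)\<close>, so the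
    signs agree except possibly at \<theta> = 0, a null set.\<close>
  also have "integral {0..1} (\<lambda>\<theta>. sgn (p \<theta> - k) *\<^sub>R g \<theta>) = integral {0..1} (\<lambda>\<theta>. sgn (z - k) *\<^sub>R g \<theta>)"
  proof (rule integral_spike[of "{0}"])
    fix \<theta> :: real assume "\<theta> \<in> {0..1} - {0}"
    then show "sgn (z - k) *\<^sub>R g \<theta> = sgn (p \<theta> - k) *\<^sub>R g \<theta>" by (simp add: p_def sgn_mult)
  qed simp
  finally have "(\<lambda>n. (z - k) *\<^sub>R integral {0..1} (\<lambda>\<theta>. reg_sgn k (inverse (real (Suc n))) (p \<theta>) *\<^sub>R g \<theta>))
      \<longlonglongrightarrow> (z - k) *\<^sub>R integral {0..1} (\<lambda>\<theta>. sgn (z - k) *\<^sub>R g \<theta>)"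
    by (intro tendsto_intros)
  moreover have "(z - k) *\<^sub>R integral {0..1} (\<lambda>\<theta>. sgn (z - k) *\<^sub>R g \<theta>) = sgn (z - k) *\<^sub>R oint k z h'"
    by (simp add: oint_def g_def p_def)
  moreover have "oint k z h' = h z - h k"
    by (rule oint_FTC) (rule has_vector_derivative_at_within[OF h])
  moreover have "reg_flux k (inverse (real (Suc n))) h z =
      (z - k) *\<^sub>R integral {0..1} (\<lambda>\<theta>. reg_sgn k (inverse (real (Suc n))) (p \<theta>) *\<^sub>R g \<theta>)" for n
    unfolding reg_flux_eq[OF pos] oint_def g_def p_def ..
  ultimately show ?thesis by (simp only:)
qed

end

lemma oint_inner:
  assumes "continuous_on UNIV w"
  shows "oint k z w \<bullet> b = oint k z (\<lambda>s. w s \<bullet> b)"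
proof -
  have "(\<lambda>\<theta>. w (k + \<theta> * (z - k))) integrable_on {0..1}"
    by (intro integrable_continuous_interval continuous_on_compose2[OF assms _ subset_UNIV] continuous_intros)
  from integral_linear[OF this bounded_linear_inner_left[of b]] show ?thesis
    by (simp add: oint_def o_def)
qed

lemma oint_sum:
  assumes "\<And>i. i \<in> I \<Longrightarrow> continuous_on UNIV (w i)" "finite I"
  shows "oint k z (\<lambda>s. \<Sum>i\<in>I. w i s) = (\<Sum>i\<in>I. oint k z (w i))"
proof -
  have "integral {0..1} (\<lambda>\<theta>. \<Sum>i\<in>I. w i (k + \<theta> * (z - k))) = (\<Sum>i\<in>I. integral {0..1} (\<lambda>\<theta>. w i (k + \<theta> * (z - k))))"
    by (intro integral_sum assms(2) integrable_continuous_interval continuous_on_compose2[OF assms(1) _ subset_UNIV] continuous_intros)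
  then show ?thesis by (simp add: oint_def scaleR_sum_right)
qed

section \<open>Admissible fluxes for the regularised entropies\<close>

context ibvp
begin

lemma C2_f: "C_k 2 cyl f"
  unfolding numeral_2_eq_2 by (rule C_k_SucI[OF f]) (use Df in simp_all)

lemma f_u: "t \<in> {0..T} \<Longrightarrow> x \<in> closure \<Omega> \<Longrightarrow> ((\<lambda>s. f (t, x, s)) has_vector_derivative Df (t, x, z) (0, 0, 1)) (at z)"
  by (rule partial_u_derivative[OF f]) auto

lemma cont_f_u: "continuous_on cyl (\<lambda>p. Df p (0, 0, 1))"
  by (rule cont_Df) (simp add: Basis_prod_def)

text \<open>The second derivatives of \<open>f\<close> make its divergence differentiable in the
  last variable with continuous derivative \<open>g\<close>. Thus the lemmas on
  \<open>reg_flux\<close> apply to the divergence of \<open>f\<close> just as to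
  \<open>f\<close>.\<close>

lemma dvf_u:
  obtains g where "continuous_on cyl g"
    "\<And>t x z. t \<in> {0..T} \<Longrightarrow> x \<in> closure \<Omega> \<Longrightarrow> ((\<lambda>s. dv Df (t, x, s)) has_vector_derivative g (t, x, z)) (at z)"
proof -
  have "\<forall>b\<in>Basis. \<exists>E. (\<forall>p\<in>cyl. ((\<lambda>p. Df p (0, b, 0)) has_derivative E p) (at p within cyl))
      \<and> continuous_on cyl (\<lambda>p. E p (0, 0, 1))"
  proof
    fix b :: 'a assume "b \<in> Basis"
    then have "C_k 1 cyl (\<lambda>p. Df p (0, b, 0))" by (intro Df) (simp add: Basis_prod_def)
    then obtain E where E: "\<And>p. p \<in> cyl \<Longrightarrow> ((\<lambda>p. Df p (0, b, 0)) has_derivative E p) (at p within cyl)"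
      "\<And>b. b \<in> Basis \<Longrightarrow> continuous_on cyl (\<lambda>p. E p b)" by (rule C_k_1E) (rule that, assumption+)
    have "continuous_on cyl (\<lambda>p. E p (0, 0, 1))" by (rule E(2)) (simp add: Basis_prod_def)
    then show "\<exists>E. (\<forall>p\<in>cyl. ((\<lambda>p. Df p (0, b, 0)) has_derivative E p) (at p within cyl))
      \<and> continuous_on cyl (\<lambda>p. E p (0, 0, 1))" using E(1) by (intro exI[of _ E] conjI ballI)
  qed
  from bchoice[OF this] obtain E where E: "\<forall>b\<in>Basis. (\<forall>p\<in>cyl. ((\<lambda>p. Df p (0, b, 0)) has_derivative E b p) (at p within cyl))
      \<and> continuous_on cyl (\<lambda>p. E b p (0, 0, 1))" by (rule exE)
  show ?thesis
  proof (rule that[of "\<lambda>p. \<Sum>b\<in>Basis. E b p (0, 0, 1) \<bullet> b"])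
    show "continuous_on cyl (\<lambda>p. \<Sum>b\<in>Basis. E b p (0, 0, 1) \<bullet> b)"
      using E by (intro continuous_intros) simp
    fix t x z assume tx: "t \<in> {0..T}" "x \<in> closure \<Omega>"
    have "((\<lambda>s. Df (t, x, s) (0, b, 0) \<bullet> b) has_vector_derivative E b (t, x, z) (0, 0, 1) \<bullet> b) (at z)"
      if b: "b \<in> Basis" for b
    proof -
      have "((\<lambda>p. Df p (0, b, 0)) has_derivative E b (t, x, z)) (at (t, x, z) within cyl)"
        using bspec[OF conjunct1[OF bspec[OF E b]], of "(t, x, z)"] tx by simp
      from partial_u_derivative[OF this tx]
      show ?thesis by (rule bounded_linear.has_vector_derivative[OF bounded_linear_inner_left])
    qed
    then show "((\<lambda>s. dv Df (t, x, s)) has_vector_derivative (\<Sum>b\<in>Basis. E b (t, x, z) (0, 0, 1) \<bullet> b)) (at z)"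
      unfolding dv_def by (rule has_vector_derivative_sum)
  qed
qed

lemma leibniz_x:
  fixes a g :: "real \<Rightarrow> real"
  assumes t: "t \<in> {0..T}" and x: "x \<in> \<Omega>" and a: "continuous_on {c..d} a" and g: "continuous_on {c..d} g"
  shows "((\<lambda>y. integral {c..d} (\<lambda>s. a s *\<^sub>R f (t, y, g s))) has_derivative
    (\<lambda>v. integral {c..d} (\<lambda>s. a s *\<^sub>R Df (t, x, g s) (0, v, 0)))) (at x)"
proof -
  have sub: "(\<lambda>y. (t, y)) ` \<Omega> \<subseteq> {0..T} \<times> closure \<Omega>"
    by (rule image_subsetI) (use t in \<open>simp add: subsetD[OF closure_subset]\<close>)
  have 1: "((\<lambda>y. (t, y)) has_derivative (\<lambda>v. (0, v))) (at x within \<Omega>)"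
    by (intro has_derivative_Pair has_derivative_const has_derivative_ident)
  have 2: "((\<lambda>(t, x). integral {c..d} (\<lambda>s. a s *\<^sub>R f (t, x, g s))) has_derivative
    (\<lambda>(u, v). integral {c..d} (\<lambda>s. a s *\<^sub>R Df (t, x, g s) (u, v, 0)))) (at (t, x) within {0..T} \<times> closure \<Omega>)"
    by (rule leibniz[OF f cont_Df t subsetD[OF closure_subset x] a g])
  from has_derivative_in_compose[OF 1 has_derivative_subset[OF 2 sub]]
  show ?thesis using at_within_open[OF x \<Omega>(1)] by simp
qed

definition qe :: "real \<Rightarrow> real \<Rightarrow> real \<times> 'a \<times> real \<Rightarrow> 'a" where
  "qe k e = (\<lambda>(t, x, z). reg_flux k e (\<lambda>s. f (t, x, s)) z)"

lemma C2_qe: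
  assumes e: "e > 0" shows "C_k 2 cyl (qe k e)"
proof -
  have "C_k 2 cyl (\<lambda>p. (\<lambda>(t, x, z). reg_sgn k e z) p *\<^sub>R f p
      - (\<lambda>(t, x, z). oint k z (\<lambda>s. reg_delta k e s *\<^sub>R f (t, x, s))) p)"
    by (intro C_k_diff C_k_scaleR C_k_continuous_z C_k_oint C_k_reg_sgn C_k_reg_delta e C2_f)
  then show ?thesis by (rule C_k_cong) (auto simp: qe_def reg_flux_def)
qed

text \<open>Taking the divergence in space commutes with \<open>reg_flux\<close>, by differentiation
  under the integral sign. Bounds and limits for the divergences of the fluxes are therefore
  instances of those for \<open>reg_flux\<close>.\<close>

lemma div_x_qe:
  assumes e: "e > 0" and t: "t \<in> {0..T}" and x: "x \<in> \<Omega>"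
  shows "div_x (qe k e) t x z = reg_flux k e (\<lambda>s. dv Df (t, x, s)) z"
proof -
  have xc: "x \<in> closure \<Omega>" by (rule subsetD[OF closure_subset x])
  let ?p = "\<lambda>\<theta>. k + \<theta> * (z - k)"
  have cd: "continuous_on {0..1} (\<lambda>\<theta>. reg_delta k e (?p \<theta>))" and cp: "continuous_on {0..1} ?p"
    by (intro continuous_on_compose2[OF cont_reg(1)[OF e] _ subset_UNIV] continuous_intros)+
  have 1: "((\<lambda>y. oint k z (\<lambda>s. reg_delta k e s *\<^sub>R f (t, y, s))) has_derivative
    (\<lambda>v. oint k z (\<lambda>s. reg_delta k e s *\<^sub>R Df (t, x, s) (0, v, 0)))) (at x)"
    unfolding oint_def by (intro has_derivative_scaleR_right leibniz_x[OF t x cd cp])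
  have 2: "((\<lambda>y. f (t, y, z)) has_derivative (\<lambda>v. Df (t, x, z) (0, v, 0))) (at x)"
    by (rule partial_x_derivative[OF f t x]) (use t xc in simp)
  have "((\<lambda>y. qe k e (t, y, z)) has_derivative (\<lambda>v. reg_sgn k e z *\<^sub>R Df (t, x, z) (0, v, 0)
      - oint k z (\<lambda>s. reg_delta k e s *\<^sub>R Df (t, x, s) (0, v, 0)))) (at x)"
    unfolding qe_def reg_flux_def prod.case by (intro has_derivative_diff has_derivative_scaleR_right 1 2)
  from frechet_derivative_at[OF this, symmetric]
  have "div_x (qe k e) t x z = (\<Sum>b\<in>Basis. (reg_sgn k e z *\<^sub>R Df (t, x, z) (0, b, 0)
      - oint k z (\<lambda>s. reg_delta k e s *\<^sub>R Df (t, x, s) (0, b, 0))) \<bullet> b)"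
    by (simp add: div_x_def)
  also have "\<dots> = reg_sgn k e z * dv Df (t, x, z)
      - (\<Sum>b\<in>Basis. oint k z (\<lambda>s. reg_delta k e s *\<^sub>R Df (t, x, s) (0, b, 0)) \<bullet> b)"
    by (simp add: inner_diff_left sum_subtractf dv_def sum_distrib_left)
  also have "(\<Sum>b\<in>Basis. oint k z (\<lambda>s. reg_delta k e s *\<^sub>R Df (t, x, s) (0, b, 0)) \<bullet> b)
      = oint k z (\<lambda>s. reg_delta k e s *\<^sub>R dv Df (t, x, s))"
  proof -
    have c: "continuous_on UNIV (\<lambda>s. reg_delta k e s *\<^sub>R Df (t, x, s) (0, b, 0))" if "b \<in> Basis" for b
    proof (rule continuous_on_scaleR[OF cont_reg(1)[OF e]])
      have "continuous_on cyl (\<lambda>p. Df p (0, b, 0))" by (rule cont_Df) (simp add: Basis_prod_def that)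
      from continuous_on_slice[OF this t xc continuous_on_id]
      show "continuous_on UNIV (\<lambda>s. Df (t, x, s) (0, b, 0))" by simp
    qed
    have "(\<Sum>b\<in>Basis. oint k z (\<lambda>s. reg_delta k e s *\<^sub>R Df (t, x, s) (0, b, 0)) \<bullet> b)
      = (\<Sum>b\<in>Basis. oint k z (\<lambda>s. (reg_delta k e s *\<^sub>R Df (t, x, s) (0, b, 0)) \<bullet> b))"
      by (intro sum.cong refl oint_inner c)
    also have "\<dots> = oint k z (\<lambda>s. \<Sum>b\<in>Basis. (reg_delta k e s *\<^sub>R Df (t, x, s) (0, b, 0)) \<bullet> b)"
      by (rule oint_sum[symmetric]) (intro continuous_on_inner c continuous_on_const, simp_all)
    finally show ?thesis by (simp add: dv_def sum_distrib_left)
  qed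
  finally show ?thesis by (simp add: reg_flux_def)
qed

lemma entropy_flux_pair_qe:
  assumes e: "e > 0" shows "entropy_flux_pair T \<Omega> f (reg_abs k e) (qe k e)"
  unfolding entropy_flux_pair_def
proof (intro conjI ballI allI)
  fix t x z assume t: "t \<in> {0..T}" and x: "x \<in> \<Omega>"
  have xc: "x \<in> closure \<Omega>" by (rule subsetD[OF closure_subset x])
  have "continuous_on UNIV (\<lambda>s. Df (t, x, s) (0, 0, 1))"
    by (rule continuous_on_slice[OF cont_f_u t xc continuous_on_id, unfolded id_def])
  from reg_flux_derivative[OF f_u[OF t xc] this e]
  have "((\<lambda>s. qe k e (t, x, s)) has_vector_derivative reg_sgn k e z *\<^sub>R Df (t, x, z) (0, 0, 1)) (at z)"
    by (simp add: qe_def)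
  then show "partial_u (qe k e) (t, x, z) = deriv (reg_abs k e) z *\<^sub>R partial_u f (t, x, z)"
    using vector_derivative_at[OF f_u[OF t xc]] DERIV_imp_deriv[OF DERIV_reg_abs[OF e]]
    by (simp add: partial_u_def vector_derivative_at)
qed (intro C_k_reg_abs C2_qe convex_reg_abs e)+

section \<open>Boundedness of the integrands and passage to the limit\<close>

lemma JI_L_infinity:
  assumes "(\<lambda>y. \<eta> (u y)) \<in> L_infinity MI" "(\<lambda>y. \<kappa> (u y)) \<in> L_infinity MI"
    "(\<lambda>y. Q (fst y, snd y, u y)) \<in> L_infinity MI" "(\<lambda>y. V (fst y, snd y, u y)) \<in> L_infinity MI"
  shows "JI \<eta> \<kappa> Q V \<in> L_infinity MI"
  unfolding JI_def[abs_def] by (intro L_infinity_intros assms)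

lemma J0_L_infinity:
  assumes "(\<lambda>y. \<eta> (u\<^sub>o y)) \<in> L_infinity M0" shows "J0 \<eta> \<in> L_infinity M0"
  unfolding J0_def[abs_def] by (intro L_infinity_intros assms)

lemma JL_L_infinity:
  assumes "(\<lambda>y. \<kappa> (u\<^sub>b y)) \<in> L_infinity MB" "(\<lambda>y. Q (fst y, snd y, u\<^sub>b y)) \<in> L_infinity MB"
  shows "JL \<kappa> Q \<in> L_infinity MB"
  unfolding JL_def[abs_def] by (intro L_infinity_intros assms)

lemma cont_const_z:
  assumes "continuous_on cyl (h :: _ \<Rightarrow> 'd::topological_space)"
  shows "continuous_on cyl (\<lambda>p. h (fst p, fst (snd p), k))"
proof (rule continuous_on_compose2[OF assms])
  show "continuous_on cyl (\<lambda>p. (fst p, fst (snd p), k))" by (intro continuous_intros)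
  show "(\<lambda>p. (fst p, fst (snd p), k)) ` cyl \<subseteq> cyl" by (rule image_subsetI) (simp add: mem_Times_iff)
qed

lemma JI_kruzhkov_L_infinity: "JI (\<lambda>z. \<bar>z - k\<bar>) (\<lambda>z. sgn (z - k)) (Qk k) (Vk k) \<in> L_infinity MI"
  unfolding JI_def[abs_def] Qk_def Vk_def fst_conv snd_conv
  by (intro L_infinity_intros L_infinity_MI[OF cont_const_z[OF cont_f], unfolded fst_conv snd_conv]
    L_infinity_MI[OF cont_const_z[OF cont_dvf], unfolded fst_conv snd_conv])

lemma J0_kruzhkov_L_infinity: "J0 (\<lambda>z. \<bar>z - k\<bar>) \<in> L_infinity M0"
  unfolding J0_def[abs_def] by (intro L_infinity_intros)

lemma JL_kruzhkov_L_infinity: "JL (\<lambda>z. sgn (z - k)) (Qk k) \<in> L_infinity MB"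
  unfolding JL_def[abs_def] Qk_def fst_conv snd_conv
  by (intro L_infinity_intros L_infinity_MB[OF cont_const_z[OF cont_f], unfolded fst_conv snd_conv])

lemma integral_tendsto_L_infinity:
  fixes g :: "nat \<Rightarrow> 'c \<Rightarrow> real"
  assumes M: "finite_measure M" and g: "\<And>n. g n \<in> L_infinity M" and g': "g' \<in> L_infinity M"
    and bd: "AE y in M. \<forall>n. \<bar>g n y\<bar> \<le> C" and lim: "\<And>y. y \<in> space M \<Longrightarrow> (\<lambda>n. g n y) \<longlonglongrightarrow> g' y"
  shows "(\<lambda>n. \<integral>y. g n y \<partial>M) \<longlonglongrightarrow> (\<integral>y. g' y \<partial>M)"
proof (rule integral_dominated_convergence[where w = "\<lambda>_. C"])
  show "integrable M (\<lambda>_. C)" by (rule L_infinity_integrable[OF M L_infinity_const])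
  show "AE y in M. (\<lambda>n. g n y) \<longlonglongrightarrow> g' y" by (rule AE_I2) (rule lim)
  show "AE y in M. norm (g n y) \<le> C" for n using bd by eventually_elim simp
qed (use g g' in \<open>auto intro: L_infinity_measurable\<close>)

lemma cyl_bound:
  fixes Q :: "real \<times> 'a \<times> real \<Rightarrow> 'd::real_normed_vector"
  assumes "continuous_on cyl Q"
  obtains B where "0 \<le> B" "\<And>t x z. t \<in> {0..T} \<Longrightarrow> x \<in> closure \<Omega> \<Longrightarrow> \<bar>z\<bar> \<le> R \<Longrightarrow> norm (Q (t, x, z)) \<le> B"
proof -
  have K: "compact ({0..T} \<times> closure \<Omega> \<times> {-R..R})" by (intro compact_Times compact_closure_\<Omega> compact_Icc)
  have "continuous_on ({0..T} \<times> closure \<Omega> \<times> {-R..R}) Q" by (rule continuous_on_subset[OF assms]) auto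
  from continuous_on_compact_bound[OF K this] obtain B where B: "0 \<le> B" "\<And>p. p \<in> {0..T} \<times> closure \<Omega> \<times> {-R..R} \<Longrightarrow> norm (Q p) \<le> B"
    by blast
  show ?thesis by (rule that[OF B(1)], rule B(2)) auto
qed

text \<open>The three integrals of \<open>J\<close> converge separately. Their integrands converge
  at every point, and \<open>reg_flux_bound\<close> dominates fluxes and divergences uniformly in
  the regularisation parameter.\<close>

lemma kruzhkov_of_entropies:
  assumes E: "\<And>\<eta> q Dq. entropy_flux_pair T \<Omega> f \<eta> q \<Longrightarrow> continuous_on UNIV \<eta> \<Longrightarrow> continuous_on UNIV (deriv \<eta>) \<Longrightarrow>
      (\<And>p. p \<in> cyl \<Longrightarrow> (q has_derivative Dq p) (at p within cyl)) \<Longrightarrow>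
      (\<And>b. b \<in> Basis \<Longrightarrow> continuous_on cyl (\<lambda>p. Dq p b)) \<Longrightarrow> 0 \<le> J \<eta> (deriv \<eta>) q (dv Dq)"
  shows "0 \<le> J (\<lambda>z. \<bar>z - k\<bar>) (\<lambda>z. sgn (z - k)) (Qk k) (Vk k)"
proof -
  define e where "e n = inverse (real (Suc n))" for n
  have e: "e n > 0" "e n \<le> 1" for n by (auto simp: e_def inverse_le_1_iff)
  define q where "q n = qe k (e n)" for n
  have "\<exists>D. (\<forall>p\<in>cyl. (q n has_derivative D p) (at p within cyl)) \<and> (\<forall>b\<in>Basis. continuous_on cyl (\<lambda>p. D p b))" for n
  proof -
    have "C_k 1 cyl (q n)" unfolding q_def by (rule C_k_mono[OF C2_qe[OF e(1)]]) simp
    then show ?thesis by (rule C_k_1E) (intro exI conjI ballI; assumption)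
  qed
  then have "\<exists>D. \<forall>n. (\<forall>p\<in>cyl. (q n has_derivative D n p) (at p within cyl)) \<and> (\<forall>b\<in>Basis. continuous_on cyl (\<lambda>p. D n p b))"
    by (intro choice allI)
  then obtain Dq where Dq: "\<And>n. (\<forall>p\<in>cyl. (q n has_derivative Dq n p) (at p within cyl)) \<and> (\<forall>b\<in>Basis. continuous_on cyl (\<lambda>p. Dq n p b))"
    by (elim exE) (rule that, erule spec)
  have Dq1: "\<And>p. p \<in> cyl \<Longrightarrow> (q n has_derivative Dq n p) (at p within cyl)"
    and Dq2: "\<And>b. b \<in> Basis \<Longrightarrow> continuous_on cyl (\<lambda>p. Dq n p b)" for n
    by (rule bspec[OF conjunct1[OF Dq[of n]]], assumption) (rule bspec[OF conjunct2[OF Dq[of n]]])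
  have cq: "continuous_on cyl (q n)" for n unfolding q_def by (rule C_k_imp_continuous[OF C2_qe[OF e(1)]])
  \<comment> \<open>The derivative within the cylinder was obtained abstractly; over \<Omega> its
    divergence is the explicit one of \<open>div_x_qe\<close>.\<close>
  have dvq: "dv (Dq n) (t, x, z) = reg_flux k (e n) (\<lambda>s. dv Df (t, x, s)) z" if t: "t \<in> {0..T}" and x: "x \<in> \<Omega>" for n t x z
  proof -
    have "div_x (q n) t x z = dv (Dq n) (t, x, z)"
      by (rule div_x_eq[where D = "Dq n", OF Dq1 t x]) (use t x in \<open>simp add: subsetD[OF closure_subset]\<close>)
    then show ?thesis using div_x_qe[OF e(1) t x] by (simp add: q_def)
  qed
  have d: "deriv (reg_abs k (e n)) = reg_sgn k (e n)" for n
    by (rule ext) (rule DERIV_imp_deriv[OF DERIV_reg_abs[OF e(1)]])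
  have cabs: "continuous_on UNIV (reg_abs k (e n))" for n by (rule C_k_imp_continuous[OF C_k_reg_abs[OF e(1), of 0]])
  have nonneg: "0 \<le> J (reg_abs k (e n)) (reg_sgn k (e n)) (q n) (dv (Dq n))" for n
  proof -
    have "entropy_flux_pair T \<Omega> f (reg_abs k (e n)) (q n)"
      unfolding q_def by (rule entropy_flux_pair_qe[OF e(1)])
    moreover have "continuous_on UNIV (deriv (reg_abs k (e n)))" unfolding d by (rule cont_reg(2)[OF e(1)])
    ultimately have "0 \<le> J (reg_abs k (e n)) (deriv (reg_abs k (e n))) (q n) (dv (Dq n))"
      by (rule E[OF _ cabs _ Dq1 Dq2])
    then show ?thesis unfolding d .
  qed
  obtain g where g: "continuous_on cyl g"
    "\<And>t x z. t \<in> {0..T} \<Longrightarrow> x \<in> closure \<Omega> \<Longrightarrow> ((\<lambda>s. dv Df (t, x, s)) has_vector_derivative g (t, x, z)) (at z)"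
    by (rule dvf_u) (rule that, assumption+)
  have slice: "continuous_on UNIV (\<lambda>s. Q (t, x, s))" if "continuous_on cyl Q" "t \<in> {0..T}" "x \<in> closure \<Omega>" for t x and Q :: "_ \<Rightarrow> 'd::topological_space"
    by (rule continuous_on_slice[OF that continuous_on_id, unfolded id_def])
  have q_lim: "(\<lambda>n. q n (t, x, z)) \<longlonglongrightarrow> Qk k (t, x, z)" if "t \<in> {0..T}" "x \<in> closure \<Omega>" for t x z
    using reg_flux_tendsto[OF f_u[OF that] slice[OF cont_f_u that], of k z]
    by (simp add: q_def qe_def e_def Qk_def)
  have V_lim: "(\<lambda>n. dv (Dq n) (t, x, z)) \<longlonglongrightarrow> Vk k (t, x, z)" if "t \<in> {0..T}" "x \<in> \<Omega>" for t x z
    using reg_flux_tendsto[OF g(2)[OF that(1)] slice[OF g(1) that(1)], of x k z] subsetD[OF closure_subset that(2)]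
    by (simp add: dvq[OF that] e_def Vk_def)
  \<comment> \<open>The fluxes integrate from \<open>k\<close> to \<open>z\<close>, so coefficients
    must be bounded on this whole segment, which may exceed the range of the data.\<close>
  have seg: "\<bar>s\<bar> \<le> R + \<bar>k\<bar>" if "s \<in> closed_segment k z" "\<bar>z\<bar> \<le> R" for s z R :: real
    using that by (auto simp: closed_segment_eq_real_ivl split: if_splits)
  have q_bd: "\<exists>B. \<forall>n. \<forall>t\<in>{0..T}. \<forall>x\<in>closure \<Omega>. \<forall>z. \<bar>z\<bar> \<le> R \<longrightarrow> norm (q n (t, x, z)) \<le> B" for R
  proof -
    obtain B where B: "0 \<le> B" "\<And>t x z. t \<in> {0..T} \<Longrightarrow> x \<in> closure \<Omega> \<Longrightarrow> \<bar>z\<bar> \<le> R + \<bar>k\<bar> \<Longrightarrow> norm (Df (t, x, z) (0, 0, 1)) \<le> B"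
      by (rule cyl_bound[OF cont_f_u, of "R + \<bar>k\<bar>"]) (rule that, assumption+)
    have "norm (q n (t, x, z)) \<le> (R + \<bar>k\<bar>) * B" if tx: "t \<in> {0..T}" "x \<in> closure \<Omega>" and z: "\<bar>z\<bar> \<le> R" for n t x z
    proof -
      have "norm (q n (t, x, z)) \<le> \<bar>z - k\<bar> * B"
        unfolding q_def qe_def prod.case
        by (rule reg_flux_bound[OF f_u[OF tx] slice[OF cont_f_u tx] e(1)]) (rule B(2)[OF tx seg[OF _ z]])
      also have "\<dots> \<le> (R + \<bar>k\<bar>) * B" using z B(1) by (intro mult_right_mono) auto
      finally show ?thesis .
    qed
    then show ?thesis by blast
  qed
  have V_bd: "\<exists>B. \<forall>n. \<forall>t\<in>{0..T}. \<forall>x\<in>\<Omega>. \<forall>z. \<bar>z\<bar> \<le> R \<longrightarrow> \<bar>dv (Dq n) (t, x, z)\<bar> \<le> B" for R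
  proof -
    obtain B where B: "0 \<le> B" "\<And>t x z. t \<in> {0..T} \<Longrightarrow> x \<in> closure \<Omega> \<Longrightarrow> \<bar>z\<bar> \<le> R + \<bar>k\<bar> \<Longrightarrow> norm (g (t, x, z)) \<le> B"
      by (rule cyl_bound[OF g(1), of "R + \<bar>k\<bar>"]) (rule that, assumption+)
    have "\<bar>dv (Dq n) (t, x, z)\<bar> \<le> (R + \<bar>k\<bar>) * B" if tx: "t \<in> {0..T}" "x \<in> \<Omega>" and z: "\<bar>z\<bar> \<le> R" for n t x z
    proof -
      have xc: "x \<in> closure \<Omega>" by (rule subsetD[OF closure_subset tx(2)])
      have "norm (dv (Dq n) (t, x, z)) \<le> \<bar>z - k\<bar> * B"
        unfolding dvq[OF tx]
        by (rule reg_flux_bound[OF g(2)[OF tx(1) xc] slice[OF g(1) tx(1) xc] e(1)]) (rule B(2)[OF tx(1) xc seg[OF _ z]])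
      also have "\<dots> \<le> (R + \<bar>k\<bar>) * B" using z B(1) by (intro mult_right_mono) auto
      finally show ?thesis by simp
    qed
    then show ?thesis by blast
  qed
  have abs_bd: "\<bar>reg_abs k (e n) z\<bar> \<le> R + \<bar>k\<bar> + 1" if "\<bar>z\<bar> \<le> R" for n z R
    using reg_abs_le[OF e(1), of k n z] abs_le_reg_abs[of z k "e n"] e(2)[of n] that by linarith
  have sgn_bd: "\<bar>reg_sgn k (e n) z\<bar> \<le> 1" for n z by (rule abs_reg_sgn_le[OF e(1)])
  have I: "(\<lambda>n. \<integral>y. JI (reg_abs k (e n)) (reg_sgn k (e n)) (q n) (dv (Dq n)) y \<partial>MI)
      \<longlonglongrightarrow> (\<integral>y. JI (\<lambda>z. \<bar>z - k\<bar>) (\<lambda>z. sgn (z - k)) (Qk k) (Vk k) y \<partial>MI)"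
  proof -
    obtain R where R: "0 \<le> R" "AE y in MI. norm (u y) \<le> R" by (rule L_infinityE[OF u])
    obtain C1 where C1: "0 \<le> C1" "AE y in MI. norm (\<phi>\<^sub>t y) \<le> C1" by (rule L_infinityE[OF L_infinity_MI'[OF cont_\<phi>\<^sub>t]])
    obtain C2 where C2: "0 \<le> C2" "AE y in MI. norm (\<phi>\<^sub>x y) \<le> C2" by (rule L_infinityE[OF L_infinity_MI'[OF cont_\<phi>\<^sub>x]])
    obtain C3 where C3: "0 \<le> C3" "AE y in MI. norm (\<phi> y) \<le> C3" by (rule L_infinityE[OF L_infinity_MI'[OF cont_\<phi>]])
    have "(\<lambda>y. F (fst y, snd y, u y) - dv Df (fst y, snd y, u y)) \<in> L_infinity MI" by (intro L_infinity_intros)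
    then obtain C4 where C4: "0 \<le> C4" "AE y in MI. norm (F (fst y, snd y, u y) - dv Df (fst y, snd y, u y)) \<le> C4"
      by (rule L_infinityE)
    obtain B1 where B1: "\<And>n t x z. t \<in> {0..T} \<Longrightarrow> x \<in> closure \<Omega> \<Longrightarrow> \<bar>z\<bar> \<le> R \<Longrightarrow> norm (q n (t, x, z)) \<le> B1"
      using q_bd[of R] by blast
    obtain B2 where B2: "\<And>n t x z. t \<in> {0..T} \<Longrightarrow> x \<in> \<Omega> \<Longrightarrow> \<bar>z\<bar> \<le> R \<Longrightarrow> \<bar>dv (Dq n) (t, x, z)\<bar> \<le> B2"
      using V_bd[of R] by blast
    have sp: "AE y in MI. fst y \<in> {0..T} \<and> snd y \<in> \<Omega>" by (rule AE_I2) (auto simp: space_MI)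
    show ?thesis
    proof (rule integral_tendsto_L_infinity[OF finite_MI _ JI_kruzhkov_L_infinity])
      show "JI (reg_abs k (e n)) (reg_sgn k (e n)) (q n) (dv (Dq n)) \<in> L_infinity MI" for n
        by (rule JI_L_infinity[OF L_infinity_comp[OF cabs u] L_infinity_comp[OF cont_reg(2)[OF e(1)] u]
            L_infinity_MI[OF cq] L_infinity_MI[OF continuous_on_dv[OF Dq2]]])
      show "AE y in MI. \<forall>n. \<bar>JI (reg_abs k (e n)) (reg_sgn k (e n)) (q n) (dv (Dq n)) y\<bar>
          \<le> (R + \<bar>k\<bar> + 1) * C1 + B1 * C2 + 1 * C4 * C3 + B2 * C3"
        using R(2) C1(2) C2(2) C3(2) C4(2) sp
      proof eventually_elim
        case (elim y)
        have tx: "fst y \<in> {0..T}" "snd y \<in> \<Omega>" "snd y \<in> closure \<Omega>" and uy: "\<bar>u y\<bar> \<le> R"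
          using elim by (auto simp: subsetD[OF closure_subset])
        show ?case
        proof
          fix n
          have 1: "\<bar>reg_abs k (e n) (u y) * \<phi>\<^sub>t y\<bar> \<le> (R + \<bar>k\<bar> + 1) * C1"
            unfolding abs_mult using elim R(1) by (intro mult_mono abs_bd uy) auto
          have "\<bar>q n (fst y, snd y, u y) \<bullet> \<phi>\<^sub>x y\<bar> \<le> norm (q n (fst y, snd y, u y)) * norm (\<phi>\<^sub>x y)"
            by (rule Cauchy_Schwarz_ineq2)
          also have "\<dots> \<le> B1 * C2"
            using elim order_trans[OF norm_ge_zero B1[OF tx(1,3) uy, of n]] by (intro mult_mono B1 tx uy) auto
          finally have 2: "\<bar>q n (fst y, snd y, u y) \<bullet> \<phi>\<^sub>x y\<bar> \<le> B1 * C2" .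
          have 3: "\<bar>reg_sgn k (e n) (u y) * (F (fst y, snd y, u y) - dv Df (fst y, snd y, u y)) * \<phi> y\<bar> \<le> 1 * C4 * C3"
            unfolding abs_mult using elim C4(1) by (intro mult_mono sgn_bd mult_nonneg_nonneg) auto
          have 4: "\<bar>dv (Dq n) (fst y, snd y, u y) * \<phi> y\<bar> \<le> B2 * C3"
            unfolding abs_mult using elim order_trans[OF abs_ge_zero B2[OF tx(1,2) uy, of n]] by (intro mult_mono B2 tx uy) auto
          show "\<bar>JI (reg_abs k (e n)) (reg_sgn k (e n)) (q n) (dv (Dq n)) y\<bar>
            \<le> (R + \<bar>k\<bar> + 1) * C1 + B1 * C2 + 1 * C4 * C3 + B2 * C3"
            using 1 2 3 4 unfolding JI_def by linarith
        qed
      qed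
      fix y assume "y \<in> space MI"
      then have tx: "fst y \<in> {0..T}" "snd y \<in> \<Omega>" by (auto simp: space_MI)
      show "(\<lambda>n. JI (reg_abs k (e n)) (reg_sgn k (e n)) (q n) (dv (Dq n)) y)
          \<longlonglongrightarrow> JI (\<lambda>z. \<bar>z - k\<bar>) (\<lambda>z. sgn (z - k)) (Qk k) (Vk k) y"
        unfolding JI_def
        by (intro tendsto_intros V_lim q_lim tx subsetD[OF closure_subset tx(2)]
          reg_abs_tendsto[folded e_def] reg_sgn_tendsto[folded e_def])
    qed
  qed
  have O: "(\<lambda>n. \<integral>y. J0 (reg_abs k (e n)) y \<partial>M0) \<longlonglongrightarrow> (\<integral>y. J0 (\<lambda>z. \<bar>z - k\<bar>) y \<partial>M0)"
  proof -
    obtain R where R: "0 \<le> R" "AE y in M0. norm (u\<^sub>o y) \<le> R" by (rule L_infinityE[OF u\<^sub>o])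
    obtain C where C: "0 \<le> C" "AE x in M0. norm (\<phi> (0, x)) \<le> C" by (rule L_infinityE[OF L_infinity_M0])
    show ?thesis
    proof (rule integral_tendsto_L_infinity[OF finite_M0 _ J0_kruzhkov_L_infinity])
      show "J0 (reg_abs k (e n)) \<in> L_infinity M0" for n
        by (rule J0_L_infinity[OF L_infinity_comp[OF cabs u\<^sub>o]])
      show "AE x in M0. \<forall>n. \<bar>J0 (reg_abs k (e n)) x\<bar> \<le> (R + \<bar>k\<bar> + 1) * C"
        using R(2) C(2)
      proof eventually_elim
        case (elim x)
        show ?case
          unfolding J0_def abs_mult using elim R(1) by (intro allI mult_mono abs_bd) auto
      qed
      show "(\<lambda>n. J0 (reg_abs k (e n)) x) \<longlonglongrightarrow> J0 (\<lambda>z. \<bar>z - k\<bar>) x" for x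
        unfolding J0_def by (intro tendsto_intros reg_abs_tendsto[folded e_def])
    qed
  qed
  have L: "(\<lambda>n. \<integral>y. JL (reg_sgn k (e n)) (q n) y \<partial>MB) \<longlonglongrightarrow> (\<integral>y. JL (\<lambda>z. sgn (z - k)) (Qk k) y \<partial>MB)"
  proof -
    obtain R where R: "0 \<le> R" "AE y in MB. norm (u\<^sub>b y) \<le> R" by (rule L_infinityE[OF u\<^sub>b])
    obtain C1 where C1: "0 \<le> C1" "AE y in MB. norm (\<nu> (snd y)) \<le> C1" by (rule L_infinityE[OF L_infinity_normal])
    obtain C3 where C3: "0 \<le> C3" "AE y in MB. norm (\<phi> y) \<le> C3" by (rule L_infinityE[OF L_infinity_MB'[OF cont_\<phi>]])
    have "(\<lambda>y. (f (fst y, snd y, u\<^sub>b y) - f (fst y, snd y, w y)) \<bullet> \<nu> (snd y)) \<in> L_infinity MB" by (intro L_infinity_intros)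
    then obtain C4 where C4: "0 \<le> C4" "AE y in MB. norm ((f (fst y, snd y, u\<^sub>b y) - f (fst y, snd y, w y)) \<bullet> \<nu> (snd y)) \<le> C4"
      by (rule L_infinityE)
    obtain B1 where B1: "\<And>n t x z. t \<in> {0..T} \<Longrightarrow> x \<in> closure \<Omega> \<Longrightarrow> \<bar>z\<bar> \<le> R \<Longrightarrow> norm (q n (t, x, z)) \<le> B1"
      using q_bd[of R] by blast
    have sp: "AE y in MB. fst y \<in> {0..T} \<and> snd y \<in> closure \<Omega>"
      by (rule AE_I2) (auto simp: space_MB frontier_closure)
    show ?thesis
    proof (rule integral_tendsto_L_infinity[OF finite_MB _ JL_kruzhkov_L_infinity])
      show "JL (reg_sgn k (e n)) (q n) \<in> L_infinity MB" for n
        by (rule JL_L_infinity[OF L_infinity_comp[OF cont_reg(2)[OF e(1)] u\<^sub>b] L_infinity_MB[OF cq u\<^sub>b]])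
      show "AE y in MB. \<forall>n. \<bar>JL (reg_sgn k (e n)) (q n) y\<bar> \<le> 1 * C4 * C3 + (B1 * C1) * C3"
        using R(2) C1(2) C3(2) C4(2) sp
      proof eventually_elim
        case (elim y)
        have tx: "fst y \<in> {0..T}" "snd y \<in> closure \<Omega>" and uy: "\<bar>u\<^sub>b y\<bar> \<le> R"
          using elim by auto
        show ?case
        proof
          fix n
          have B1n: "0 \<le> B1" by (rule order_trans[OF norm_ge_zero B1[OF tx uy, of n]])
          have "\<bar>q n (fst y, snd y, u\<^sub>b y) \<bullet> \<nu> (snd y)\<bar> \<le> norm (q n (fst y, snd y, u\<^sub>b y)) * norm (\<nu> (snd y))"
            by (rule Cauchy_Schwarz_ineq2)
          also have "\<dots> \<le> B1 * C1"
            using elim B1n by (intro mult_mono B1 tx uy) auto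
          finally have 2: "\<bar>(q n (fst y, snd y, u\<^sub>b y) \<bullet> \<nu> (snd y)) * \<phi> y\<bar> \<le> (B1 * C1) * C3"
            unfolding abs_mult using elim B1n C1(1) by (intro mult_mono mult_nonneg_nonneg) auto
          have 3: "\<bar>reg_sgn k (e n) (u\<^sub>b y) * ((f (fst y, snd y, u\<^sub>b y) - f (fst y, snd y, w y)) \<bullet> \<nu> (snd y)) * \<phi> y\<bar> \<le> 1 * C4 * C3"
            unfolding abs_mult using elim C4(1) by (intro mult_mono sgn_bd mult_nonneg_nonneg) auto
          show "\<bar>JL (reg_sgn k (e n)) (q n) y\<bar> \<le> 1 * C4 * C3 + (B1 * C1) * C3"
            using 2 3 unfolding JL_def by linarith
        qed
      qed
      fix y assume "y \<in> space MB"
      then have tx: "fst y \<in> {0..T}" "snd y \<in> closure \<Omega>" by (auto simp: space_MB frontier_closure)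
      show "(\<lambda>n. JL (reg_sgn k (e n)) (q n) y) \<longlonglongrightarrow> JL (\<lambda>z. sgn (z - k)) (Qk k) y"
        unfolding JL_def by (intro tendsto_intros q_lim tx reg_sgn_tendsto[folded e_def])
    qed
  qed
  have "(\<lambda>n. J (reg_abs k (e n)) (reg_sgn k (e n)) (q n) (dv (Dq n)))
      \<longlonglongrightarrow> J (\<lambda>z. \<bar>z - k\<bar>) (\<lambda>z. sgn (z - k)) (Qk k) (Vk k)"
    unfolding J_def by (intro tendsto_add I O L)
  then show ?thesis by (rule LIMSEQ_le_const) (use nonneg in blast)
qed

end

section \<open>The divergence theorem on the cylinder\<close>

context ibvp
begin

text \<open>Both orders are needed: space inside for the divergence theorem at fixed time, time
  inside for the fundamental theorem at a fixed point.\<close>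

lemma interior_fubini:
  fixes g :: "real \<times> 'a \<Rightarrow> real"
  assumes "integrable MI g"
  shows "(\<integral>y. g y \<partial>MI) = (\<integral>t. indicator {0..T} t * (\<integral>x. indicator \<Omega> x * g (t, x) \<partial>lborel) \<partial>lborel)"
    and "(\<integral>y. g y \<partial>MI) = (\<integral>x. indicator \<Omega> x * (\<integral>t. indicator {0..T} t * g (t, x) \<partial>lborel) \<partial>lborel)"
proof -
  let ?G = "\<lambda>t x. indicator {0..T} t * (indicator \<Omega> x * g (t, x))"
  have S: "{0..T} \<times> \<Omega> \<inter> space lborel \<in> sets (lborel :: (real \<times> 'a) measure)"
    using \<Omega>(1) by (simp add: borel_Times)
  have eq: "(\<lambda>y. indicator ({0..T} \<times> \<Omega>) y *\<^sub>R g y) = case_prod ?G"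
    by (auto simp: indicator_def fun_eq_iff)
  have int: "integrable (lborel \<Otimes>\<^sub>M lborel) (case_prod ?G)"
    using assms unfolding interior_measure_def integrable_restrict_space[OF S] eq lborel_prod .
  have I: "(\<integral>y. g y \<partial>MI) = integral\<^sup>L (lborel \<Otimes>\<^sub>M lborel) (case_prod ?G)"
    unfolding interior_measure_def integral_restrict_space[OF S] eq lborel_prod ..
  also have "\<dots> = (\<integral>t. \<integral>x. ?G t x \<partial>lborel \<partial>lborel)" by (rule lborel_pair.integral_fst[OF int, symmetric])
  finally show "(\<integral>y. g y \<partial>MI) = (\<integral>t. indicator {0..T} t * (\<integral>x. indicator \<Omega> x * g (t, x) \<partial>lborel) \<partial>lborel)"
    by simp
  note I
  also have "integral\<^sup>L (lborel \<Otimes>\<^sub>M lborel) (case_prod ?G) = (\<integral>x. \<integral>t. ?G t x \<partial>lborel \<partial>lborel)"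
    by (rule lborel_pair.integral_snd[OF int, symmetric])
  also have "\<dots> = (\<integral>x. indicator \<Omega> x * (\<integral>t. indicator {0..T} t * g (t, x) \<partial>lborel) \<partial>lborel)"
    by (subst Bochner_Integration.integral_mult_right_zero[symmetric]) (simp add: mult.left_commute)
  finally show "(\<integral>y. g y \<partial>MI) = (\<integral>x. indicator \<Omega> x * (\<integral>t. indicator {0..T} t * g (t, x) \<partial>lborel) \<partial>lborel)" .
qed

lemma lateral_fubini:
  fixes g :: "real \<times> 'a \<Rightarrow> real"
  assumes "integrable MB g"
  shows "(\<integral>y. g y \<partial>MB) = (\<integral>t. indicator {0..T} t * (\<integral>\<xi>. g (t, \<xi>) \<partial>\<sigma>) \<partial>lborel)"
proof -
  interpret \<sigma>: finite_measure \<sigma> by (rule finite_\<sigma>)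
  interpret t: finite_measure "restrict_space lborel {0..T}" by (rule finite_time)
  interpret pair_sigma_finite "restrict_space lborel {0..T}" \<sigma> ..
  have int: "integrable (restrict_space lborel {0..T} \<Otimes>\<^sub>M \<sigma>) (case_prod (\<lambda>t \<xi>. g (t, \<xi>)))"
    using assms by (simp add: lateral_measure_def)
  have "(\<integral>y. g y \<partial>MB) = (\<integral>t. \<integral>\<xi>. g (t, \<xi>) \<partial>\<sigma> \<partial>restrict_space lborel {0..T})"
    using integral_fst[OF int] by (simp add: lateral_measure_def)
  also have "\<dots> = (\<integral>t. indicator {0..T} t * (\<integral>\<xi>. g (t, \<xi>) \<partial>\<sigma>) \<partial>lborel)"
    by (subst integral_restrict_space) auto
  finally show ?thesis .
qed

lemma integrable_frechet:
  fixes g :: "'a \<Rightarrow> real"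
  assumes "C_k 1 (closure \<Omega>) g" "b \<in> Basis"
  shows "integrable lborel (\<lambda>x. indicator \<Omega> x * frechet_derivative g (at x) b)"
proof -
  obtain D where D: "\<And>x. x \<in> \<Omega> \<Longrightarrow> (g has_derivative D x) (at x)"
    "\<And>b. b \<in> Basis \<Longrightarrow> integrable lborel (\<lambda>x. indicator \<Omega> x * D x b)"
    by (rule C_k_1_closure[OF \<Omega>(1,2) assms(1)]) (rule that, assumption+)
  have "(\<lambda>x. indicator \<Omega> x * frechet_derivative g (at x) b) = (\<lambda>x. indicator \<Omega> x * D x b)"
  proof
    fix x show "indicator \<Omega> x * frechet_derivative g (at x) b = indicator \<Omega> x * D x b"
      using frechet_derivative_at[OF D(1), of x] by (cases "x \<in> \<Omega>") auto
  qed
  then show ?thesis using D(2)[OF assms(2)] by (simp only:)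
qed

lemma integrable_\<sigma>:
  fixes h :: "'a \<Rightarrow> real"
  assumes h: "continuous_on (frontier \<Omega>) h"
  shows "integrable \<sigma> h"
proof (rule L_infinity_integrable[OF finite_\<sigma>])
  show "h \<in> L_infinity \<sigma>"
    by (rule L_infinity_continuous[OF meas_id_\<sigma> _ h compact_frontier_bounded[OF \<Omega>(2)]])
      (auto simp: surface_measure_space(2)[OF \<sigma>] intro: AE_I2)
qed

text \<open>At each time the divergence theorem is applied to the components of \<open>c\<close>
  times the test function; the product rule gives the integrand on the left.\<close>

lemma divergence_cylinder:
  fixes c :: "real \<times> 'a \<Rightarrow> 'a"
  assumes c: "\<And>p. p \<in> {0..T} \<times> closure \<Omega> \<Longrightarrow> (c has_derivative Dc p) (at p within {0..T} \<times> closure \<Omega>)"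
    and Dc: "\<And>b. b \<in> Basis \<Longrightarrow> continuous_on ({0..T} \<times> closure \<Omega>) (\<lambda>p. Dc p b)"
  defines "d \<equiv> (\<lambda>y. \<Sum>b\<in>Basis. Dc y (0, b) \<bullet> b)"
  shows "(\<lambda>y. c y \<bullet> \<phi>\<^sub>x y + d y * \<phi> y) \<in> L_infinity MI" "(\<lambda>y. (c y \<bullet> \<nu> (snd y)) * \<phi> y) \<in> L_infinity MB"
    and "(\<integral>y. c y \<bullet> \<phi>\<^sub>x y + d y * \<phi> y \<partial>MI) = (\<integral>y. (c y \<bullet> \<nu> (snd y)) * \<phi> y \<partial>MB)"
proof -
  let ?P = "{0..T} \<times> closure \<Omega>"
  have cc: "continuous_on ?P c" by (rule has_derivative_continuous_on[OF c])
  have cd: "continuous_on ?P d"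
    unfolding d_def by (intro continuous_intros Dc) (auto simp: Basis_prod_def)
  have lift: "(\<lambda>y. h (fst y, snd y)) \<in> L_infinity MI \<and> (\<lambda>y. h (fst y, snd y)) \<in> L_infinity MB"
    if "continuous_on ?P h" for h :: "real \<times> 'a \<Rightarrow> 'd::real_normed_vector"
    by (intro conjI L_infinity_time_space[OF that] meas_MI meas_MB)
      (auto simp: space_MI space_MB frontier_closure subsetD[OF closure_subset])
  have cI: "c \<in> L_infinity MI" "c \<in> L_infinity MB" "d \<in> L_infinity MI"
    using lift[OF cc] lift[OF cd] by simp_all
  show I: "(\<lambda>y. c y \<bullet> \<phi>\<^sub>x y + d y * \<phi> y) \<in> L_infinity MI" by (intro L_infinity_intros cI)
  show L: "(\<lambda>y. (c y \<bullet> \<nu> (snd y)) * \<phi> y) \<in> L_infinity MB" by (intro L_infinity_intros cI)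
  have inner: "(\<integral>x. indicator \<Omega> x * (c (t, x) \<bullet> \<phi>\<^sub>x (t, x) + d (t, x) * \<phi> (t, x)) \<partial>lborel) =
      (\<integral>\<xi>. (c (t, \<xi>) \<bullet> \<nu> \<xi>) * \<phi> (t, \<xi>) \<partial>\<sigma>)" if t: "t \<in> {0..T}" for t
  proof -
    define g where "g b x = (c (t, x) \<bullet> b) * \<phi> (t, x)" for b x
    define E where "E b x v = (c (t, x) \<bullet> b) * (\<phi>\<^sub>x (t, x) \<bullet> v) + (Dc (t, x) (0, v) \<bullet> b) * \<phi> (t, x)" for b x v
    have cont_t: "continuous_on (closure \<Omega>) (\<lambda>x. h (t, x))" if "continuous_on ?P h" for h :: "real \<times> 'a \<Rightarrow> 'd::topological_space"
      by (rule continuous_on_compose2[OF that]) (use t in \<open>auto intro!: continuous_intros\<close>)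
    have der: "(g b has_derivative E b x) (at x within closure \<Omega>)" if x: "x \<in> closure \<Omega>" for b x
    proof -
      have "(\<lambda>y. (t, y)) ` closure \<Omega> \<subseteq> ?P" using t by auto
      moreover have "((\<lambda>y. (t, y)) has_derivative (\<lambda>v. (0, v))) (at x within closure \<Omega>)"
        by (intro has_derivative_Pair has_derivative_const has_derivative_ident)
      moreover have "(c has_derivative Dc (t, x)) (at (t, x) within ?P)" using c t x by simp
      ultimately have "((\<lambda>y. c (t, y)) has_derivative (\<lambda>v. Dc (t, x) (0, v))) (at x within closure \<Omega>)"
        by (metis has_derivative_in_compose has_derivative_subset)
      from has_derivative_mult[OF bounded_linear.has_derivative[OF bounded_linear_inner_left[of b] this]
          has_derivative_at_withinI[OF derivative_\<phi>_x]]
      show ?thesis by (simp add: g_def[abs_def] E_def[abs_def])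
    qed
    have Cg: "C_k 1 (closure \<Omega>) (g b)" for b
    proof (rule C_k_1I[OF der])
      fix v :: 'a assume "v \<in> Basis"
      then have "continuous_on ?P (\<lambda>p. Dc p (0, v))" by (intro Dc) (simp add: Basis_prod_def)
      note cont_t[OF this]
      then show "continuous_on (closure \<Omega>) (\<lambda>x. E b x v)"
        unfolding E_def
        by (intro continuous_on_add continuous_on_mult continuous_on_inner continuous_on_const cont_t[OF cc]
            cont_t[OF continuous_on_subset[OF cont_\<phi>\<^sub>x subset_UNIV]] cont_t[OF cont_\<phi>])
    qed
    have fr: "frechet_derivative (g b) (at x) = E b x" if x: "x \<in> \<Omega>" for b x
    proof -
      have "(g b has_derivative E b x) (at x within \<Omega>)"
        by (rule has_derivative_subset[OF der closure_subset]) (rule subsetD[OF closure_subset x])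
      then show ?thesis using at_within_open[OF x \<Omega>(1)] frechet_derivative_at by metis
    qed
    have "(\<integral>x. indicator \<Omega> x * (c (t, x) \<bullet> \<phi>\<^sub>x (t, x) + d (t, x) * \<phi> (t, x)) \<partial>lborel) =
        (\<integral>x. (\<Sum>b\<in>Basis. indicator \<Omega> x * frechet_derivative (g b) (at x) b) \<partial>lborel)"
    proof (rule Bochner_Integration.integral_cong[OF refl])
      fix x
      show "indicator \<Omega> x * (c (t, x) \<bullet> \<phi>\<^sub>x (t, x) + d (t, x) * \<phi> (t, x)) =
        (\<Sum>b\<in>Basis. indicator \<Omega> x * frechet_derivative (g b) (at x) b)"
      proof (cases "x \<in> \<Omega>")
        case True
        have "(\<Sum>b\<in>Basis. E b x b) = c (t, x) \<bullet> \<phi>\<^sub>x (t, x) + d (t, x) * \<phi> (t, x)"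
          by (subst euclidean_inner) (simp add: E_def d_def sum.distrib sum_distrib_right)
        then show ?thesis using True by (simp add: fr)
      qed simp
    qed
    also have "\<dots> = (\<Sum>b\<in>Basis. \<integral>x. indicator \<Omega> x * frechet_derivative (g b) (at x) b \<partial>lborel)"
      by (rule Bochner_Integration.integral_sum) (rule integrable_frechet[OF Cg])
    also have "\<dots> = (\<Sum>b\<in>Basis. \<integral>\<xi>. g b \<xi> * (\<nu> \<xi> \<bullet> b) \<partial>\<sigma>)"
      by (intro sum.cong refl divergence_theorem \<Omega> \<sigma> Cg)
    also have "\<dots> = (\<integral>\<xi>. (\<Sum>b\<in>Basis. g b \<xi> * (\<nu> \<xi> \<bullet> b)) \<partial>\<sigma>)"
    proof (rule Bochner_Integration.integral_sum[symmetric])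
      fix b :: 'a
      have "frontier \<Omega> \<subseteq> closure \<Omega>" by (auto simp: frontier_def)
      then show "integrable \<sigma> (\<lambda>\<xi>. g b \<xi> * (\<nu> \<xi> \<bullet> b))"
        by (intro integrable_\<sigma> continuous_intros continuous_on_subset[OF C_k_imp_continuous[OF Cg]]
            continuous_on_exterior_normal \<Omega>)
    qed
    also have "\<dots> = (\<integral>\<xi>. (c (t, \<xi>) \<bullet> \<nu> \<xi>) * \<phi> (t, \<xi>) \<partial>\<sigma>)"
    proof (rule Bochner_Integration.integral_cong[OF refl])
      fix \<xi>
      show "(\<Sum>b\<in>Basis. g b \<xi> * (\<nu> \<xi> \<bullet> b)) = (c (t, \<xi>) \<bullet> \<nu> \<xi>) * \<phi> (t, \<xi>)"
        by (subst euclidean_inner[of "c (t, \<xi>)"]) (simp add: g_def sum_distrib_right sum_distrib_left mult.commute mult.left_commute)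
    qed
    finally show ?thesis .
  qed
  have "(\<integral>y. c y \<bullet> \<phi>\<^sub>x y + d y * \<phi> y \<partial>MI) =
      (\<integral>t. indicator {0..T} t * (\<integral>x. indicator \<Omega> x * (c (t, x) \<bullet> \<phi>\<^sub>x (t, x) + d (t, x) * \<phi> (t, x)) \<partial>lborel) \<partial>lborel)"
    by (rule interior_fubini(1)[OF L_infinity_integrable[OF finite_MI I]])
  also have "\<dots> = (\<integral>t. indicator {0..T} t * (\<integral>\<xi>. (c (t, \<xi>) \<bullet> \<nu> \<xi>) * \<phi> (t, \<xi>) \<partial>\<sigma>) \<partial>lborel)"
  proof (rule Bochner_Integration.integral_cong[OF refl])
    fix t
    show "indicator {0..T} t * (\<integral>x. indicator \<Omega> x * (c (t, x) \<bullet> \<phi>\<^sub>x (t, x) + d (t, x) * \<phi> (t, x)) \<partial>lborel) =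
        indicator {0..T} t * (\<integral>\<xi>. (c (t, \<xi>) \<bullet> \<nu> \<xi>) * \<phi> (t, \<xi>) \<partial>\<sigma>)"
      using inner[of t] by (cases "t \<in> {0..T}") auto
  qed
  also have "\<dots> = (\<integral>y. (c y \<bullet> \<nu> (snd y)) * \<phi> y \<partial>MB)"
    by (subst lateral_fubini[OF L_infinity_integrable[OF finite_MB L]]) simp
  finally show "(\<integral>y. c y \<bullet> \<phi>\<^sub>x y + d y * \<phi> y \<partial>MI) = (\<integral>y. (c y \<bullet> \<nu> (snd y)) * \<phi> y \<partial>MB)" .
qed

text \<open>At each point of \<Omega> the time derivative integrates to a boundary term at time 0
  only, as the test function vanishes at time \<open>T\<close>.\<close>

lemma integral_\<phi>\<^sub>t: "(\<integral>y. \<phi>\<^sub>t y \<partial>MI) + (\<integral>x. \<phi> (0, x) \<partial>M0) = 0"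
proof -
  have inner: "(\<integral>t. indicator {0..T} t * \<phi>\<^sub>t (t, x) \<partial>lborel) = - \<phi> (0, x)" for x
  proof -
    have "continuous_on UNIV (\<lambda>t. \<phi>\<^sub>t (t, x))"
      by (rule continuous_on_compose2[OF cont_\<phi>\<^sub>t _ subset_UNIV]) (intro continuous_intros)
    then have c: "isCont (\<lambda>t. \<phi>\<^sub>t (t, x)) t" for t by (simp add: continuous_on_eq_continuous_at)
    have "(LBINT t. \<phi>\<^sub>t (t, x) * indicator {0..T} t) = \<phi> (T, x) - \<phi> (0, x)"
      using T by (intro integral_FTC_Icc_real deriv_\<phi> c) auto
    then show ?thesis using \<phi>_zero[of T x] by (simp add: mult.commute)
  qed
  have "(\<integral>y. \<phi>\<^sub>t y \<partial>MI) = (\<integral>x. indicator \<Omega> x * (- \<phi> (0, x)) \<partial>lborel)"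
    by (subst interior_fubini(2)[OF L_infinity_integrable[OF finite_MI L_infinity_MI'[OF cont_\<phi>\<^sub>t]]]) (simp add: inner)
  moreover have "(\<integral>x. \<phi> (0, x) \<partial>M0) = (\<integral>x. indicator \<Omega> x * \<phi> (0, x) \<partial>lborel)"
    by (subst integral_restrict_space) (use \<Omega>(1) in auto)
  ultimately show ?thesis by simp
qed

end

section \<open>From Kruzhkov's entropies to smooth entropies\<close>

lemma C_k_real_derivativeE:
  fixes g :: "real \<Rightarrow> real"
  assumes "C_k (Suc n) UNIV g"
  shows "(g has_real_derivative deriv g z) (at z)" "C_k n UNIV (deriv g)"
proof -
  from assms obtain D where D: "\<And>z. z \<in> UNIV \<Longrightarrow> (g has_derivative D z) (at z)"
    "\<And>b. b \<in> Basis \<Longrightarrow> C_k n UNIV (\<lambda>z. D z b)" by (rule C_k_SucE) (rule that, assumption+)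
  have d: "(g has_real_derivative D z 1) (at z)" for z
  proof -
    have "D z v = D z 1 * v" for v
      using linear_cmul[OF has_derivative_linear[OF D(1)[OF UNIV_I]], of z v 1] by (simp add: mult.commute)
    then have "D z = (*) (D z 1)" by (rule ext)
    then show ?thesis using D(1)[OF UNIV_I, of z] unfolding has_field_derivative_def by simp
  qed
  have "deriv g = (\<lambda>z. D z 1)" by (rule ext) (rule DERIV_imp_deriv[OF d])
  then show "(g has_real_derivative deriv g z) (at z)" "C_k n UNIV (deriv g)" using d D(2)[of 1] by simp_all
qed

text \<open>A negative value would make \<open>g'\<close> smaller at some later point, whereas
  adding the tangent inequalities at two points shows that \<open>g'\<close> is monotone.\<close>

lemma convex_second_derivative_nonneg:
  fixes g :: "real \<Rightarrow> real"
  assumes g: "convex_on UNIV g" and d1: "\<And>z. (g has_real_derivative g' z) (at z)"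
    and d2: "(g' has_real_derivative l) (at z)"
  shows "0 \<le> l"
proof (rule ccontr)
  assume "\<not> 0 \<le> l"
  then obtain r where r: "r > 0" "\<forall>h>0. h < r \<longrightarrow> g' (z + h) < g' z"
    using DERIV_neg_dec_right[OF d2] by auto
  define y where "y = z + r / 2"
  have "g' y < g' z" using r by (simp add: y_def)
  have "g' z * (y - z) \<le> g y - g z" "g' y * (z - y) \<le> g z - g y"
    by (rule convex_on_imp_above_tangent[OF g connected_UNIV]; use d1 in simp)+
  then have "g' z * (y - z) \<le> g' y * (y - z)" by (simp add: algebra_simps)
  then show False using \<open>g' y < g' z\<close> r(1) by (simp add: y_def)
qed

lemma interval_lebesgue_eq_integral:
  fixes g :: "real \<Rightarrow> real"
  assumes "integrable (restrict_space lborel {a..b}) g"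
  shows "(\<integral>k. g k \<partial>restrict_space lborel {a..b}) = integral {a..b} g"
proof -
  have "set_integrable lborel {a..b} g"
    using assms by (simp add: integrable_restrict_space set_integrable_def)
  from set_borel_integral_eq_integral(2)[OF this] show ?thesis
    by (simp add: integral_restrict_space set_lebesgue_integral_def)
qed

lemma continuous_L_infinity_interval:
  fixes g :: "real \<Rightarrow> real"
  assumes "continuous_on {a..b} g"
  shows "g \<in> L_infinity (restrict_space lborel {a..b})"
proof (rule L_infinity_continuous[OF _ _ assms compact_Icc subset_refl])
  show "(\<lambda>k. k) \<in> borel_measurable (restrict_space lborel {a..b})"
    by (rule measurable_restrict_space1) simp
qed (auto simp: space_restrict_space intro: AE_I2)

lemma integral_sgn:
  fixes g :: "real \<Rightarrow> real"
  assumes g: "continuous_on UNIV g" and z: "a \<le> z" "z \<le> b"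
    and fin: "finite_measure (restrict_space lborel {a..b})"
  shows "(\<integral>k. sgn (z - k) * g k \<partial>restrict_space lborel {a..b}) = integral {a..z} g - integral {z..b} g"
proof -
  have "(\<lambda>k. sgn (z - k) * g k) \<in> L_infinity (restrict_space lborel {a..b})"
    by (intro L_infinity_mult L_infinity_sgn continuous_L_infinity_interval continuous_intros continuous_on_subset[OF g]) auto
  then have "(\<integral>k. sgn (z - k) * g k \<partial>restrict_space lborel {a..b}) = integral {a..b} (\<lambda>k. sgn (z - k) * g k)"
    by (intro interval_lebesgue_eq_integral L_infinity_integrable[OF fin])
  also have "((\<lambda>k. sgn (z - k) * g k) has_integral (integral {a..z} g + - integral {z..b} g)) {a..b}"
  proof (rule has_integral_combine[OF z])
    have i: "g integrable_on {c..d}" for c d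
      by (intro integrable_continuous_interval continuous_on_subset[OF g]) auto
    show "((\<lambda>k. sgn (z - k) * g k) has_integral integral {a..z} g) {a..z}"
      by (rule has_integral_spike[OF _ _ integrable_integral[OF i], of "{z}"]) auto
    show "((\<lambda>k. sgn (z - k) * g k) has_integral - integral {z..b} g) {z..b}"
      by (rule has_integral_spike[OF _ _ has_integral_neg[OF integrable_integral[OF i]], of "{z}"]) auto
  qed
  then have "integral {a..b} (\<lambda>k. sgn (z - k) * g k) = integral {a..z} g - integral {z..b} g"
    by (simp add: integral_unique)
  finally show ?thesis .
qed

text \<open>On \<open>[-K, K]\<close> the entropy \<open>\<eta>\<close> is, up to a constant, a superposition of the functions \<open>\<bar>z - k\<bar>\<close> with
  nonnegative weights: density \<open>\<eta>'' / 2\<close> on \<open>[-K, K]\<close>, and atoms \<open>\<beta>\<^sub>p\<close> at \<open>-K\<close> and \<open>\<beta>\<^sub>m\<close> at \<open>K\<close> which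
  produce the affine part.\<close>

locale entropy =
  fixes \<eta> \<eta>' \<eta>'' :: "real \<Rightarrow> real" and K :: real
  assumes d1: "\<And>z. (\<eta> has_real_derivative \<eta>' z) (at z)" and d2: "\<And>z. (\<eta>' has_real_derivative \<eta>'' z) (at z)"
    and cont: "continuous_on UNIV \<eta>''" and nonneg: "\<And>z. 0 \<le> \<eta>'' z" and K: "0 < K"
begin

text \<open>The density alone produces slope \<open>(\<eta>' z - \<eta>' (- K)) / 2 - (\<eta>' K -
  \<eta>' z) / 2\<close>, which is \<open>\<eta>' z - \<beta>\<close>. The missing slope comes from
  the end points: on the interval, the modulus centred at \<open>- K\<close> has slope 1 and the one
  centred at \<open>K\<close> has slope -1.\<close>

definition \<beta> :: real where "\<beta> = (\<eta>' K + \<eta>' (- K)) / 2"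
definition \<beta>\<^sub>p :: real where "\<beta>\<^sub>p = max \<beta> 0"
definition \<beta>\<^sub>m :: real where "\<beta>\<^sub>m = max (- \<beta>) 0"

lemma \<beta>: "0 \<le> \<beta>\<^sub>p" "0 \<le> \<beta>\<^sub>m" "\<beta>\<^sub>p - \<beta>\<^sub>m = \<beta>"
  by (auto simp: \<beta>\<^sub>p_def \<beta>\<^sub>m_def)

text \<open>The integral of \<open>\<eta>'\<close> times the derivative of \<open>h\<close> from
  \<open>- K\<close> to \<open>z\<close>, integrated by parts: the flux for \<open>h\<close>,
  normalised to vanish at \<open>- K\<close>.\<close>

definition flux_part :: "(real \<Rightarrow> 'b::euclidean_space) \<Rightarrow> real \<Rightarrow> 'b" where
  "flux_part h z = \<eta>' z *\<^sub>R h z - integral {- K..z} (\<lambda>s. \<eta>'' s *\<^sub>R h s) - \<eta>' (- K) *\<^sub>R h (- K)"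

text \<open>The excess of the superposition of \<open>sgn (z - k) *\<^sub>R (h z - h k)\<close> over
  \<open>flux_part h z\<close>, which does not depend on \<open>z\<close>.\<close>

definition offset :: "(real \<Rightarrow> 'b::euclidean_space) \<Rightarrow> 'b" where
  "offset h = integral {- K..K} (\<lambda>s. (\<eta>'' s / 2) *\<^sub>R h s) - \<beta>\<^sub>p *\<^sub>R h (- K) + \<beta>\<^sub>m *\<^sub>R h K + \<eta>' (- K) *\<^sub>R h (- K)"

abbreviation "N \<equiv> restrict_space lborel {- K..K} :: real measure"

lemma finite_N: "finite_measure N"
proof
  show "emeasure N (space N) \<noteq> \<infinity>"
    by (simp add: emeasure_restrict_space space_restrict_space emeasure_lborel_Icc_eq)
qed

lemma cont_\<eta>': "continuous_on S \<eta>'" and cont_\<eta>: "continuous_on S \<eta>"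
  by (intro continuous_at_imp_continuous_on ballI DERIV_isCont[OF d2] DERIV_isCont[OF d1])+

lemma int:
  fixes h :: "real \<Rightarrow> 'b::euclidean_space"
  assumes "continuous_on UNIV h"
  shows "(\<lambda>s. \<eta>'' s *\<^sub>R h s) integrable_on {c..d}" "(\<lambda>s. (\<eta>'' s / 2) *\<^sub>R h s) integrable_on {c..d}"
  by (intro integrable_continuous_interval continuous_intros continuous_on_subset[OF cont] continuous_on_subset[OF assms]; auto)+

lemma integral_\<eta>'': "c \<le> d \<Longrightarrow> integral {c..d} \<eta>'' = \<eta>' d - \<eta>' c"
  by (rule integral_unique, rule fundamental_theorem_of_calculus)
    (auto intro: has_field_derivative_at_within d2 simp: has_real_derivative_iff_has_vector_derivative[symmetric])

lemma integral_\<eta>''_half: "integral {c..d} (\<lambda>s. \<eta>'' s / 2 * h s) = integral {c..d} (\<lambda>s. \<eta>'' s * h s) / 2"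
  using integral_divide[of "{c..d}" "\<lambda>s. \<eta>'' s * h s" 2] by simp

text \<open>Splitting the density integral at \<open>z\<close> fixes the sign on each half, and
  strictness of the bound on \<open>z\<close> fixes it for the atoms. \<open>h\<close> will collect
  the entropy, flux and divergence terms and \<open>m\<close> the terms multiplied by the derivative
  of the entropy, so one identity serves every integrand.\<close>

lemma superposition:
  assumes h: "continuous_on UNIV h" and z: "\<bar>z\<bar> < K"
  shows "(\<integral>k. \<eta>'' k / 2 * (sgn (z - k) * (h z - h k + m)) \<partial>N)
      + \<beta>\<^sub>p * (sgn (z - (- K)) * (h z - h (- K) + m)) + \<beta>\<^sub>m * (sgn (z - K) * (h z - h K + m))
    = flux_part h z + offset h + \<eta>' z * m"
proof -
  have zK: "- K \<le> z" "z \<le> K" "sgn (z - (- K)) = 1" "sgn (z - K) = - 1" using z by auto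
  let ?I = "\<lambda>c d. integral {c..d} (\<lambda>s. \<eta>'' s * h s)"
  have part: "integral {c..d} (\<lambda>k. \<eta>'' k / 2 * (h z - h k + m)) = ((\<eta>' d - \<eta>' c) * (h z + m) - ?I c d) / 2"
    if "c \<le> d" for c d
  proof -
    have "integral {c..d} (\<lambda>k. \<eta>'' k / 2 * (h z - h k + m)) =
        integral {c..d} (\<lambda>k. \<eta>'' k * ((h z + m) / 2) - (\<eta>'' k / 2) * h k)"
      by (intro integral_cong) (simp add: algebra_simps add_divide_distrib diff_divide_distrib)
    also have "\<dots> = integral {c..d} (\<lambda>k. \<eta>'' k * ((h z + m) / 2)) - integral {c..d} (\<lambda>k. (\<eta>'' k / 2) * h k)"
      using int[OF continuous_on_const[of _ "(h z + m) / 2"]] int[OF h] by (intro integral_diff) simp_all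
    also have "\<dots> = ((\<eta>' d - \<eta>' c) * (h z + m) - ?I c d) / 2"
      using integral_\<eta>''[OF that] by (simp add: integral_\<eta>''_half diff_divide_distrib)
    finally show ?thesis .
  qed
  have "(\<integral>k. \<eta>'' k / 2 * (sgn (z - k) * (h z - h k + m)) \<partial>N) =
      (\<integral>k. sgn (z - k) * (\<eta>'' k / 2 * (h z - h k + m)) \<partial>N)"
    by (simp only: mult.left_commute)
  also have "\<dots> = integral {- K..z} (\<lambda>k. \<eta>'' k / 2 * (h z - h k + m)) - integral {z..K} (\<lambda>k. \<eta>'' k / 2 * (h z - h k + m))"
    by (intro integral_sgn zK finite_N continuous_intros cont h) simp
  also have "\<dots> = ((\<eta>' z - \<eta>' (- K)) * (h z + m) - ?I (- K) z) / 2 - ((\<eta>' K - \<eta>' z) * (h z + m) - ?I z K) / 2"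
    unfolding part[OF zK(1)] part[OF zK(2)] ..
  also have "?I z K = ?I (- K) K - ?I (- K) z"
    using Henstock_Kurzweil_Integration.integral_combine[OF zK(1,2), of "\<lambda>s. \<eta>'' s * h s"] int(1)[OF h] by simp
  also have "((\<eta>' z - \<eta>' (- K)) * (h z + m) - ?I (- K) z) / 2 - ((\<eta>' K - \<eta>' z) * (h z + m) - (?I (- K) K - ?I (- K) z)) / 2
      = \<eta>' z * (h z + m) - \<beta> * (h z + m) - ?I (- K) z + ?I (- K) K / 2"
    unfolding \<beta>_def by (simp add: algebra_simps add_divide_distrib diff_divide_distrib)
  finally show ?thesis
    unfolding zK(3,4) \<beta>(3)[symmetric] by (simp add: flux_part_def offset_def integral_\<eta>''_half algebra_simps)
qed

text \<open>The derivative of \<open>\<eta>' s *\<^sub>R h s - q s\<close> is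
  \<open>\<eta>'' s *\<^sub>R h s\<close>, from which \<open>h'\<close> has disappeared.\<close>

lemma flux_part_FTC:
  fixes h h' :: "real \<Rightarrow> 'b::euclidean_space"
  assumes h: "\<And>s. (h has_vector_derivative h' s) (at s)"
    and q: "\<And>s. (q has_vector_derivative \<eta>' s *\<^sub>R h' s) (at s)" and z: "- K \<le> z"
  shows "q z = q (- K) + flux_part h z"
proof -
  have "((\<lambda>s. \<eta>' s *\<^sub>R h s - q s) has_vector_derivative \<eta>'' s *\<^sub>R h s) (at s within {- K..z})" for s
  proof (rule has_vector_derivative_at_within)
    have "((\<lambda>s. \<eta>' s *\<^sub>R h s - q s) has_vector_derivative (\<eta>' s *\<^sub>R h' s + \<eta>'' s *\<^sub>R h s) - \<eta>' s *\<^sub>R h' s) (at s)"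
      by (intro has_vector_derivative_diff has_vector_derivative_scaleR d2 h q)
    moreover have "(\<eta>' s *\<^sub>R h' s + \<eta>'' s *\<^sub>R h s) - \<eta>' s *\<^sub>R h' s = \<eta>'' s *\<^sub>R h s" by simp
    ultimately show "((\<lambda>s. \<eta>' s *\<^sub>R h s - q s) has_vector_derivative \<eta>'' s *\<^sub>R h s) (at s)" by (simp only:)
  qed
  then have "((\<lambda>s. \<eta>'' s *\<^sub>R h s) has_integral ((\<eta>' z *\<^sub>R h z - q z) - (\<eta>' (- K) *\<^sub>R h (- K) - q (- K)))) {- K..z}"
    by (intro fundamental_theorem_of_calculus z) 
  then show ?thesis by (simp add: flux_part_def integral_unique algebra_simps)
qed

lemma inner_integral:
  fixes h :: "real \<Rightarrow> 'b::euclidean_space"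
  assumes "(\<lambda>s. a s *\<^sub>R h s) integrable_on S"
  shows "integral S (\<lambda>s. a s *\<^sub>R h s) \<bullet> v = integral S (\<lambda>s. a s * (h s \<bullet> v))"
  using integral_linear[OF assms bounded_linear_inner_left[of v]] by (simp add: o_def)

lemma flux_part_inner: "continuous_on UNIV h \<Longrightarrow> flux_part h z \<bullet> v = flux_part (\<lambda>s. h s \<bullet> v) z"
  by (simp add: flux_part_def inner_diff_left inner_integral[OF int(1)])

lemma offset_inner: "continuous_on UNIV h \<Longrightarrow> offset h \<bullet> v = offset (\<lambda>s. h s \<bullet> v)"
  using inner_integral[OF int(2)[of h], of "- K" K v]
  by (simp add: offset_def inner_diff_left inner_add_left)

lemma flux_part_add:
  assumes "continuous_on UNIV g" "continuous_on UNIV h"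
  shows "flux_part (\<lambda>s. g s + h s) z = flux_part g z + flux_part h z"
  by (simp add: flux_part_def scaleR_add_right integral_add[OF int(1)[OF assms(1)] int(1)[OF assms(2)]])

lemma offset_add:
  assumes "continuous_on UNIV g" "continuous_on UNIV h"
  shows "offset (\<lambda>s. g s + h s) = offset g + offset h"
  by (simp add: offset_def scaleR_add_right integral_add[OF int(2)[OF assms(1)] int(2)[OF assms(2)]])

lemma offset_sum:
  assumes "\<And>i. i \<in> I \<Longrightarrow> continuous_on UNIV (h i)" "finite I"
  shows "offset (\<lambda>s. \<Sum>i\<in>I. h i s) = (\<Sum>i\<in>I. offset (h i))"
  using assms(2,1)
proof (induction I)
  case empty
  show ?case by (simp add: offset_def)
next
  case (insert i I)
  have "continuous_on UNIV (\<lambda>s. \<Sum>i\<in>I. h i s)" using insert by (intro continuous_on_sum) auto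
  then show ?case using insert by (simp add: offset_add)
qed

lemma flux_part_sum:
  assumes "\<And>i. i \<in> I \<Longrightarrow> continuous_on UNIV (h i)" "finite I"
  shows "flux_part (\<lambda>s. \<Sum>i\<in>I. h i s) z = (\<Sum>i\<in>I. flux_part (h i) z)"
  using assms(2,1)
proof (induction I)
  case empty
  show ?case by (simp add: flux_part_def)
next
  case (insert i I)
  have "continuous_on UNIV (\<lambda>s. \<Sum>i\<in>I. h i s)" using insert by (intro continuous_on_sum) auto
  then show ?case using insert by (simp add: flux_part_add)
qed

lemma flux_part_mult: "flux_part (\<lambda>s. h s * r) z = flux_part h z * (r::real)"
  by (simp add: flux_part_def left_diff_distrib mult.assoc[symmetric])

lemma offset_mult: "offset (\<lambda>s. h s * r) = offset h * (r::real)"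
proof -
  have "integral {- K..K} (\<lambda>s. \<eta>'' s / 2 * (h s * r)) = integral {- K..K} (\<lambda>s. \<eta>'' s / 2 * h s) * r"
    by (rule trans[OF _ integral_mult_left]) (simp only: mult.assoc)
  then show ?thesis unfolding offset_def real_scaleR_def by (simp only: distrib_right left_diff_distrib mult.assoc)
qed

text \<open>Fubini for the pointwise identity \<open>superposition\<close>, to be used once for each
  of the three integrals in \<open>J\<close>. The remainder \<open>r\<close> receives the
  contribution of the free constant and the free field.\<close>

lemma superposition_integral:
  fixes G :: "real \<Rightarrow> 'c \<Rightarrow> real"
  assumes M: "finite_measure M"
    and joint: "(\<lambda>p. G (fst p) (snd p)) \<in> L_infinity (N \<Otimes>\<^sub>M M)" and Gk: "\<And>k. G k \<in> L_infinity M"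
    and g: "g \<in> L_infinity M" and r: "r \<in> L_infinity M"
    and G: "\<And>k y. y \<in> space M \<Longrightarrow> G k y = sgn (z y - k) * (h y (z y) - h y k + m y)"
    and h: "\<And>y. y \<in> space M \<Longrightarrow> continuous_on UNIV (h y)"
    and AE: "AE y in M. \<bar>z y\<bar> < K \<and> g y = flux_part (h y) (z y) + offset (h y) + \<eta>' (z y) * m y + r y"
  shows "integrable N (\<lambda>k. \<eta>'' k / 2 * (\<integral>y. G k y \<partial>M)) \<and> (\<integral>y. g y \<partial>M) = (\<integral>k. \<eta>'' k / 2 * (\<integral>y. G k y \<partial>M) \<partial>N)
      + \<beta>\<^sub>p * (\<integral>y. G (- K) y \<partial>M) + \<beta>\<^sub>m * (\<integral>y. G K y \<partial>M) + (\<integral>y. r y \<partial>M)"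
proof -
  interpret N: finite_measure N by (rule finite_N)
  interpret M: finite_measure M by (rule M)
  interpret pair_sigma_finite N M ..
  have "(\<lambda>k. \<eta>'' k / 2) \<in> L_infinity N"
    by (intro continuous_L_infinity_interval continuous_intros continuous_on_subset[OF cont]) auto
  then obtain C where C: "(\<lambda>k. \<eta>'' k / 2) \<in> borel_measurable N" "AE k in N. norm (\<eta>'' k / 2) \<le> C"
    by (auto simp: L_infinity_def)
  have "(\<lambda>p. \<eta>'' (fst p) / 2) \<in> L_infinity (N \<Otimes>\<^sub>M M)"
  proof (rule L_infinityI)
    have m: "(\<lambda>p. \<eta>'' (fst p) / 2) \<in> borel_measurable (N \<Otimes>\<^sub>M M)"
      using measurable_compose[OF measurable_fst C(1)] .
    then show "(\<lambda>p. \<eta>'' (fst p) / 2) \<in> borel_measurable (N \<Otimes>\<^sub>M M)" .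
    show "AE p in N \<Otimes>\<^sub>M M. norm (\<eta>'' (fst p) / 2) \<le> C"
    proof (rule AE_pair_measure)
      show "{p \<in> space (N \<Otimes>\<^sub>M M). norm (\<eta>'' (fst p) / 2) \<le> C} \<in> sets (N \<Otimes>\<^sub>M M)"
        using m by measurable
      show "AE k in N. AE y in M. norm (\<eta>'' (fst (k, y)) / 2) \<le> C" using C(2) by eventually_elim simp
    qed
  qed
  then have "(\<lambda>p. \<eta>'' (fst p) / 2 * G (fst p) (snd p)) \<in> L_infinity (N \<Otimes>\<^sub>M M)"
    by (rule L_infinity_mult[OF _ joint])
  then have "integrable (N \<Otimes>\<^sub>M M) (\<lambda>p. \<eta>'' (fst p) / 2 * G (fst p) (snd p))"
    by (rule L_infinity_integrable[OF finite_measure_pair_measure[OF M finite_N]])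
  then have int: "integrable (N \<Otimes>\<^sub>M M) (case_prod (\<lambda>k y. \<eta>'' k / 2 * G k y))"
    by (simp add: case_prod_unfold)
  have iN: "integrable N (\<lambda>k. \<eta>'' k / 2 * (\<integral>y. G k y \<partial>M))"
    using integrable_fst[OF int] by simp
  define A where "A y = (\<integral>k. \<eta>'' k / 2 * G k y \<partial>N)" for y
  have iA: "integrable M A" unfolding A_def by (rule integrable_snd[OF int])
  have iG: "integrable M (G k)" for k by (rule L_infinity_integrable[OF M Gk])
  have ir: "integrable M r" by (rule L_infinity_integrable[OF M r])
  \<comment> \<open>The formulas for \<open>G\<close> and the continuity of \<open>h\<close> hold on
    the space of \<open>M\<close>, so membership is added to the almost everywhere
    statement.\<close>
  have "AE y in M. y \<in> space M" by (rule AE_space)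
  with AE have "AE y in M. g y = A y + \<beta>\<^sub>p * G (- K) y + \<beta>\<^sub>m * G K y + r y"
  proof eventually_elim
    case (elim y)
    have "A y = (\<integral>k. \<eta>'' k / 2 * (sgn (z y - k) * (h y (z y) - h y k + m y)) \<partial>N)"
      by (simp add: A_def G[OF elim(2)])
    then show ?case
      using superposition[OF h[OF elim(2)], of "z y" "m y"] elim(1) unfolding G[OF elim(2)] by linarith
  qed
  moreover have "(\<lambda>y. A y + \<beta>\<^sub>p * G (- K) y + \<beta>\<^sub>m * G K y + r y) \<in> borel_measurable M"
    using iA iG ir by (intro borel_measurable_add borel_measurable_times borel_measurable_const borel_measurable_integrable)
  ultimately have "(\<integral>y. g y \<partial>M) = (\<integral>y. A y + \<beta>\<^sub>p * G (- K) y + \<beta>\<^sub>m * G K y + r y \<partial>M)"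
    by (intro integral_cong_AE L_infinity_measurable[OF g])
  also have "\<dots> = (\<integral>y. A y \<partial>M) + \<beta>\<^sub>p * (\<integral>y. G (- K) y \<partial>M) + \<beta>\<^sub>m * (\<integral>y. G K y \<partial>M) + (\<integral>y. r y \<partial>M)"
    using iA iG ir by simp
  also have "(\<integral>y. A y \<partial>M) = (\<integral>k. \<integral>y. \<eta>'' k / 2 * G k y \<partial>M \<partial>N)"
    unfolding A_def by (rule Fubini_integral[OF int])
  also have "\<dots> = (\<integral>k. \<eta>'' k / 2 * (\<integral>y. G k y \<partial>M) \<partial>N)" by simp
  finally show ?thesis using iN by blast
qed

end

lemma L_infinity_snd:
  fixes g :: "'c \<Rightarrow> 'd::{second_countable_topology, real_normed_vector}"
  assumes N: "finite_measure N" and M: "finite_measure M" and g: "g \<in> L_infinity M"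
  shows "(\<lambda>p. g (snd p)) \<in> L_infinity (N \<Otimes>\<^sub>M M)"
proof -
  interpret N: finite_measure N by (rule N)
  interpret M: finite_measure M by (rule M)
  interpret pair_sigma_finite N M ..
  obtain C where C: "AE y in M. norm (g y) \<le> C" by (rule L_infinityE[OF g])
  show ?thesis
  proof (rule L_infinityI)
    have m: "(\<lambda>p. g (snd p)) \<in> borel_measurable (N \<Otimes>\<^sub>M M)"
      using measurable_compose[OF measurable_snd L_infinity_measurable[OF g]] .
    then show "(\<lambda>p. g (snd p)) \<in> borel_measurable (N \<Otimes>\<^sub>M M)" .
    show "AE p in N \<Otimes>\<^sub>M M. norm (g (snd p)) \<le> C"
    proof (rule AE_pair_measure)
      show "{p \<in> space (N \<Otimes>\<^sub>M M). norm (g (snd p)) \<le> C} \<in> sets (N \<Otimes>\<^sub>M M)"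
        using m by measurable
      show "AE k in N. AE y in M. norm (g (snd (k, y))) \<le> C" using C by simp
    qed
  qed
qed

lemma (in entropy) L_infinity_fst:
  assumes M: "finite_measure M"
  shows "fst \<in> L_infinity (N \<Otimes>\<^sub>M M)"
proof (rule L_infinity_continuous[where Q = "\<lambda>k. k" and S = "{- K..K}" and K = "{- K..K}"])
  have "(\<lambda>k. k) \<in> borel_measurable N" by (rule measurable_restrict_space1) simp
  from measurable_compose[OF measurable_fst this, of M] show "fst \<in> borel_measurable (N \<Otimes>\<^sub>M M)" by simp
  show "fst p \<in> {- K..K}" if "p \<in> space (N \<Otimes>\<^sub>M M)" for p
    using that by (auto simp: space_pair_measure space_restrict_space)
  then show "AE p in N \<Otimes>\<^sub>M M. fst p \<in> {- K..K}" by (rule AE_I2)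
qed (auto intro: continuous_intros)

section \<open>Superposition in the entropy inequality\<close>

context ibvp
begin

lemma derivative_slice_z:
  assumes h: "(h has_derivative D) (at (t, x, z) within cyl)"
  shows "((\<lambda>(t, x). h (t, x, z)) has_derivative (\<lambda>(s, v). D (s, v, 0))) (at (t, x) within {0..T} \<times> closure \<Omega>)"
proof -
  have 1: "((\<lambda>p. (fst p, snd p, z)) has_derivative (\<lambda>p. (fst p, snd p, 0))) (at (t, x) within {0..T} \<times> closure \<Omega>)"
    by (intro derivative_intros)
  have sub: "(\<lambda>p. (fst p, snd p, z)) ` ({0..T} \<times> closure \<Omega>) \<subseteq> cyl"
    by (rule image_subsetI) (simp add: mem_Times_iff)
  have "(h has_derivative D) (at ((\<lambda>p. (fst p, snd p, z)) (t, x)) within (\<lambda>p. (fst p, snd p, z)) ` ({0..T} \<times> closure \<Omega>))"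
    using has_derivative_subset[OF h sub] by simp
  from has_derivative_in_compose[OF 1 this] show ?thesis by (simp add: case_prod_unfold)
qed

lemma continuous_on_slice_z:
  assumes "continuous_on cyl h"
  shows "continuous_on ({0..T} \<times> closure \<Omega>) (\<lambda>(t, x). h (t, x, z))"
  unfolding case_prod_unfold
proof (rule continuous_on_compose2[OF assms])
  show "(\<lambda>p. (fst p, snd p, z)) ` ({0..T} \<times> closure \<Omega>) \<subseteq> cyl"
    by (rule image_subsetI) (simp add: mem_Times_iff)
qed (intro continuous_intros)

lemma slice:
  "t \<in> {0..T} \<Longrightarrow> x \<in> closure \<Omega> \<Longrightarrow> continuous_on cyl h \<Longrightarrow> continuous_on UNIV (\<lambda>s. h (t, x, s))"
  using continuous_on_slice[OF _ _ _ continuous_on_id] by simp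

lemma cont_Df_v: "continuous_on cyl (\<lambda>p. Df p v)"
  by (rule continuous_on_linear_Basis[OF has_derivative_linear[OF f] cont_Df continuous_on_const])

text \<open>In each integral of \<open>J\<close> the integrand for \<eta> is the superposition of
  those for Kruzhkov's entropies plus a remainder. The three remainders together are
  \<open>J\<close> of the constant \<alpha> with derivative zero, flux \<open>c\<close> and
  divergence \<open>d\<close>, and this is zero.\<close>

lemma entropies_of_kruzhkov:
  assumes kruzhkov: "\<And>k. 0 \<le> J (\<lambda>z. \<bar>z - k\<bar>) (\<lambda>z. sgn (z - k)) (Qk k) (Vk k)"
    and \<eta>: "C_k 2 UNIV \<eta>" "convex_on UNIV \<eta>"
    and q: "\<And>p. p \<in> cyl \<Longrightarrow> (q has_derivative Dq p) (at p within cyl)"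
    and Dq: "\<And>b. b \<in> Basis \<Longrightarrow> continuous_on cyl (\<lambda>p. Dq p b)"
    and flux: "\<And>t x z. t \<in> {0..T} \<Longrightarrow> x \<in> \<Omega> \<Longrightarrow> partial_u q (t, x, z) = deriv \<eta> z *\<^sub>R partial_u f (t, x, z)"
  shows "0 \<le> J \<eta> (deriv \<eta>) q (dv Dq)"
proof -
  obtain R1 where R1: "0 \<le> R1" "AE y in MI. norm (u y) \<le> R1" by (rule L_infinityE[OF u])
  obtain R2 where R2: "0 \<le> R2" "AE y in M0. norm (u\<^sub>o y) \<le> R2" by (rule L_infinityE[OF u\<^sub>o])
  obtain R3 where R3: "0 \<le> R3" "AE y in MB. norm (u\<^sub>b y) \<le> R3" by (rule L_infinityE[OF u\<^sub>b])
  \<comment> \<open>Adding 1 makes all bounds strict, so that no value meets the atoms at the ends,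
    and makes \<open>K\<close> positive even for zero data.\<close>
  define K where "K = R1 + R2 + R3 + 1"
  have RK: "0 < K" "R1 < K" "R2 < K" "R3 < K" using R1(1) R2(1) R3(1) by (auto simp: K_def)
  define \<eta>' where "\<eta>' = deriv \<eta>"
  define \<eta>'' where "\<eta>'' = deriv \<eta>'"
  have d1: "(\<eta> has_real_derivative \<eta>' z) (at z)" and C1: "C_k (Suc 0) UNIV \<eta>'" for z
    using C_k_real_derivativeE[OF \<eta>(1)[unfolded numeral_2_eq_2]] by (simp_all add: \<eta>'_def)
  have d2: "(\<eta>' has_real_derivative \<eta>'' z) (at z)" and c\<eta>'': "continuous_on UNIV \<eta>''" for z
    using C_k_real_derivativeE[OF C1] by (simp_all add: \<eta>''_def)
  interpret entropy \<eta> \<eta>' \<eta>'' K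
    by unfold_locales (rule d1 d2 c\<eta>'' RK(1) convex_second_derivative_nonneg[OF \<eta>(2) d1 d2])+
  have cq: "continuous_on cyl q" by (rule has_derivative_continuous_on[OF q])
  have q_u: "((\<lambda>s. q (t, x, s)) has_vector_derivative \<eta>' z *\<^sub>R Df (t, x, z) (0, 0, 1)) (at z)"
    if t: "t \<in> {0..T}" and x: "x \<in> closure \<Omega>" for t x z
  proof -
    have d: "((\<lambda>s. q (t, y, s)) has_vector_derivative Dq (t, y, z) (0, 0, 1)) (at z)" if "y \<in> closure \<Omega>" for y
      by (rule partial_u_derivative[OF q t that]) (use t that in simp)
    \<comment> \<open>The compatibility of flux and entropy is given over \<Omega>; the boundary
      integrals need it on the closure, where it follows by continuity.\<close>
    have "Dq (t, x, z) (0, 0, 1) - \<eta>' z *\<^sub>R Df (t, x, z) (0, 0, 1) = 0"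
    proof (rule continuous_constant_on_closure[OF _ _ x])
      have "continuous_on cyl (\<lambda>p. Dq p (0, 0, 1))" by (rule Dq) (simp add: Basis_prod_def)
      then have "continuous_on cyl (\<lambda>p. Dq p (0, 0, 1) - \<eta>' z *\<^sub>R Df p (0, 0, 1))"
        by (intro continuous_intros cont_f_u)
      then show "continuous_on (closure \<Omega>) (\<lambda>x. Dq (t, x, z) (0, 0, 1) - \<eta>' z *\<^sub>R Df (t, x, z) (0, 0, 1))"
        by (rule continuous_on_compose2) (use t in \<open>auto intro!: continuous_intros\<close>)
      fix y assume y: "y \<in> \<Omega>"
      then have yc: "y \<in> closure \<Omega>" by (rule subsetD[OF closure_subset])
      have "partial_u q (t, y, z) = Dq (t, y, z) (0, 0, 1)"
        by (simp add: partial_u_def vector_derivative_at[OF d[OF yc]])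
      moreover have "partial_u f (t, y, z) = Df (t, y, z) (0, 0, 1)"
        by (simp add: partial_u_def vector_derivative_at[OF f_u[OF t yc]])
      ultimately show "Dq (t, y, z) (0, 0, 1) - \<eta>' z *\<^sub>R Df (t, y, z) (0, 0, 1) = 0"
        using flux[OF t y, of z] by (simp add: \<eta>'_def)
    qed
    then show ?thesis using d[OF x] by simp
  qed
  have q_eq: "q (t, x, z) = q (t, x, - K) + flux_part (\<lambda>s. f (t, x, s)) z"
    if t: "t \<in> {0..T}" and x: "x \<in> closure \<Omega>" and z: "- K \<le> z" for t x z
    by (rule flux_part_FTC[OF f_u[OF t x] q_u[OF t x] z])
  have \<eta>_eq: "\<eta> z = \<eta> (- K) + flux_part (\<lambda>s. s) z" if "- K \<le> z" for z
  proof (rule flux_part_FTC[OF _ _ that])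
    show "((\<lambda>s. s) has_vector_derivative 1) (at s)" for s :: real by (rule has_vector_derivative_id)
    show "(\<eta> has_vector_derivative \<eta>' s *\<^sub>R 1) (at s)" for s
      using d1[of s] by (simp add: has_real_derivative_iff_has_vector_derivative)
  qed
  \<comment> \<open>The representation of \<open>q\<close> holds near \<open>x\<close> for fixed
    \<open>z\<close>, so it may be differentiated in space, under the integral sign.\<close>
  have Dq_eq: "Dq (t, x, z) (0, v, 0) = Dq (t, x, - K) (0, v, 0) + flux_part (\<lambda>s. Df (t, x, s) (0, v, 0)) z"
    if t: "t \<in> {0..T}" and x: "x \<in> \<Omega>" and z: "- K \<le> z" for t x z v
  proof -
    have m: "(t, x, s) \<in> cyl" for s using t x by (simp add: subsetD[OF closure_subset])
    have "((\<lambda>y. q (t, y, - K) + (\<eta>' z *\<^sub>R f (t, y, z) - integral {- K..z} (\<lambda>s. \<eta>'' s *\<^sub>R f (t, y, s)) - \<eta>' (- K) *\<^sub>R f (t, y, - K)))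
      has_derivative (\<lambda>v. Dq (t, x, - K) (0, v, 0) + (\<eta>' z *\<^sub>R Df (t, x, z) (0, v, 0)
        - integral {- K..z} (\<lambda>s. \<eta>'' s *\<^sub>R Df (t, x, s) (0, v, 0)) - \<eta>' (- K) *\<^sub>R Df (t, x, - K) (0, v, 0)))) (at x)"
      by (intro has_derivative_add has_derivative_diff has_derivative_scaleR_right partial_x_derivative[OF q[OF m] t x]
          partial_x_derivative[OF f[OF m] t x] leibniz_x[OF t x] continuous_on_subset[OF c\<eta>'' subset_UNIV] continuous_on_id)
    then have "((\<lambda>y. q (t, y, z)) has_derivative (\<lambda>v. Dq (t, x, - K) (0, v, 0) + flux_part (\<lambda>s. Df (t, x, s) (0, v, 0)) z)) (at x)"
      unfolding flux_part_def
      by (rule has_derivative_transform_within_open[OF _ \<Omega>(1) x])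
        (rule q_eq[symmetric, OF t subsetD[OF closure_subset] z, unfolded flux_part_def])
    from has_derivative_unique[OF partial_x_derivative[OF q[OF m] t x] this] show ?thesis by (rule fun_cong)
  qed
  have sum_flux: "(\<Sum>b\<in>Basis. flux_part (\<lambda>s. Df (t, x, s) (0, b, 0)) z \<bullet> b) = flux_part (\<lambda>s. dv Df (t, x, s)) z"
    and sum_offset: "(\<Sum>b\<in>Basis. offset (\<lambda>s. Df (t, x, s) (0, b, 0)) \<bullet> b) = offset (\<lambda>s. dv Df (t, x, s))"
    if t: "t \<in> {0..T}" and x: "x \<in> closure \<Omega>" for t x z
  proof -
    have c: "continuous_on UNIV (\<lambda>s. Df (t, x, s) (0, b, 0))" for b by (rule slice[OF t x cont_Df_v])
    have c': "continuous_on UNIV (\<lambda>s. Df (t, x, s) (0, b, 0) \<bullet> b)" for b by (intro continuous_intros c)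
    show "(\<Sum>b\<in>Basis. flux_part (\<lambda>s. Df (t, x, s) (0, b, 0)) z \<bullet> b) = flux_part (\<lambda>s. dv Df (t, x, s)) z"
      unfolding dv_def flux_part_inner[OF c] by (rule flux_part_sum[symmetric]) (rule c' finite_Basis)+
    show "(\<Sum>b\<in>Basis. offset (\<lambda>s. Df (t, x, s) (0, b, 0)) \<bullet> b) = offset (\<lambda>s. dv Df (t, x, s))"
      unfolding dv_def offset_inner[OF c] by (rule offset_sum[symmetric]) (rule c' finite_Basis)+
  qed
  have V_eq: "dv Dq (t, x, z) = dv Dq (t, x, - K) + flux_part (\<lambda>s. dv Df (t, x, s)) z"
    if t: "t \<in> {0..T}" and x: "x \<in> \<Omega>" and z: "- K \<le> z" for t x z
    using sum_flux[OF t subsetD[OF closure_subset x], of z]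
    unfolding dv_def[of Dq] Dq_eq[OF t x z] by (simp add: inner_add_left sum.distrib)
  \<comment> \<open>The field by which \<open>q\<close> differs from the superposed Kruzhkov fluxes:
    its value at \<open>- K\<close> less the offset of \<open>f\<close>. \<open>Dc\<close> is its
    derivative within the closed cylinder.\<close>
  define c where "c = (\<lambda>(t, x). q (t, x, - K) - offset (\<lambda>s. f (t, x, s)))"
  define Dc where "Dc = (\<lambda>(t, x) (s, v). Dq (t, x, - K) (s, v, 0) - offset (\<lambda>r. Df (t, x, r) (s, v, 0)))"
  have c_der: "(c has_derivative Dc p) (at p within {0..T} \<times> closure \<Omega>)" if pP: "p \<in> {0..T} \<times> closure \<Omega>" for p
  proof -
    obtain t x where p: "p = (t, x)" and t: "t \<in> {0..T}" and x: "x \<in> closure \<Omega>"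
      by (rule SigmaE[OF pP]) (rule that)
    have m: "(t, x, s) \<in> cyl" for s using t x by simp
    have "continuous_on {- K..K} (\<lambda>s. \<eta>'' s / 2)"
      by (intro continuous_intros continuous_on_subset[OF c\<eta>'' subset_UNIV]) simp
    from leibniz[OF f cont_Df t x this continuous_on_id]
    have l: "((\<lambda>(t, x). integral {- K..K} (\<lambda>s. (\<eta>'' s / 2) *\<^sub>R f (t, x, s))) has_derivative
      (\<lambda>(u, v). integral {- K..K} (\<lambda>s. (\<eta>'' s / 2) *\<^sub>R Df (t, x, s) (u, v, 0)))) (at (t, x) within {0..T} \<times> closure \<Omega>)"
      by simp
    note s = derivative_slice_z[OF f[OF m], unfolded case_prod_unfold]
    show ?thesis
      unfolding p c_def Dc_def offset_def case_prod_unfold fst_conv snd_conv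
      by (intro has_derivative_diff has_derivative_add has_derivative_scaleR_right s[unfolded fst_conv snd_conv]
          derivative_slice_z[OF q[OF m], unfolded case_prod_unfold] l[unfolded case_prod_unfold fst_conv snd_conv])
  qed
  have c_Dc: "continuous_on ({0..T} \<times> closure \<Omega>) (\<lambda>p. Dc p b)" if "b \<in> Basis" for b
  proof -
    obtain s v where b: "b = (s, v)" by (cases b)
    have "(s, v, 0) \<in> Basis" using that by (auto simp: b Basis_prod_def zero_prod_def)
    then have cDq: "continuous_on cyl (\<lambda>p. Dq p (s, v, 0))" by (rule Dq)
    have "continuous_on (({0..T} \<times> closure \<Omega>) \<times> cbox (- K) K) (\<lambda>(p, r). (\<eta>'' r / 2) *\<^sub>R Df (fst p, snd p, r) (s, v, 0))"
      unfolding case_prod_unfold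
    proof (rule continuous_on_scaleR)
      show "continuous_on (({0..T} \<times> closure \<Omega>) \<times> cbox (- K) K) (\<lambda>p. \<eta>'' (snd p) / 2)"
        by (intro continuous_intros continuous_on_compose2[OF c\<eta>'' _ subset_UNIV]) simp
      show "continuous_on (({0..T} \<times> closure \<Omega>) \<times> cbox (- K) K) (\<lambda>p. Df (fst (fst p), snd (fst p), snd p) (s, v, 0))"
      proof (rule continuous_on_compose2[OF cont_Df_v])
        show "(\<lambda>p. (fst (fst p), snd (fst p), snd p)) ` (({0..T} \<times> closure \<Omega>) \<times> cbox (- K) K) \<subseteq> cyl"
          by (rule image_subsetI) (simp add: mem_Times_iff)
      qed (intro continuous_intros)
    qed
    from integral_continuous_on_param[OF this]
    have "continuous_on ({0..T} \<times> closure \<Omega>) (\<lambda>p. integral {- K..K} (\<lambda>r. (\<eta>'' r / 2) *\<^sub>R Df (fst p, snd p, r) (s, v, 0)))"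
      by simp
    then show ?thesis
      unfolding b Dc_def offset_def case_prod_unfold fst_conv snd_conv
      by (intro continuous_intros continuous_on_slice_z[OF cDq, unfolded case_prod_unfold]
          continuous_on_slice_z[OF cont_Df_v, unfolded case_prod_unfold])
  qed
  note div = divergence_cylinder[OF c_der c_Dc]
  define d where "d y = (\<Sum>b\<in>Basis. Dc y (0, b) \<bullet> b)" for y
  have d_eq: "d (t, x) = dv Dq (t, x, - K) - offset (\<lambda>s. dv Df (t, x, s))"
    if "t \<in> {0..T}" "x \<in> closure \<Omega>" for t x
    using sum_offset[OF that] by (simp add: d_def Dc_def dv_def[of Dq] inner_diff_left sum_subtractf)
  \<comment> \<open>The counterpart of \<open>c\<close> for the entropy, which plays the role of a
    flux for the identity function.\<close>
  define \<alpha> where "\<alpha> = \<eta> (- K) - offset (\<lambda>s. s)"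
  define J1 where "J1 k = J (\<lambda>z. \<bar>z - k\<bar>) (\<lambda>z. sgn (z - k)) (Qk k) (Vk k)" for k
  have abs_sgn: "\<bar>z\<bar> = sgn z * z" for z :: real by (simp add: abs_sgn mult.commute)
  note lift = L_infinity_snd[OF finite_N]
  have \<eta>u: "continuous_on UNIV \<eta>" "continuous_on UNIV \<eta>'" by (rule cont_\<eta> cont_\<eta>')+
  have JI_eta: "JI \<eta> \<eta>' q (dv Dq) \<in> L_infinity MI"
    by (rule JI_L_infinity[OF L_infinity_comp[OF \<eta>u(1) u] L_infinity_comp[OF \<eta>u(2) u]
            L_infinity_MI[OF cq] L_infinity_MI[OF continuous_on_dv[OF Dq]]])
  have J0_eta: "J0 \<eta> \<in> L_infinity M0" by (rule J0_L_infinity[OF L_infinity_comp[OF \<eta>u(1) u\<^sub>o]])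
  have JL_eta: "JL \<eta>' q \<in> L_infinity MB"
    by (rule JL_L_infinity[OF L_infinity_comp[OF \<eta>u(2) u\<^sub>b] L_infinity_MB[OF cq u\<^sub>b]])
  define A1 where "A1 k = (\<integral>y. JI (\<lambda>z. \<bar>z - k\<bar>) (\<lambda>z. sgn (z - k)) (Qk k) (Vk k) y \<partial>MI)" for k
  define A2 where "A2 k = (\<integral>y. J0 (\<lambda>z. \<bar>z - k\<bar>) y \<partial>M0)" for k
  define A3 where "A3 k = (\<integral>y. JL (\<lambda>z. sgn (z - k)) (Qk k) y \<partial>MB)" for k
  define r1 where "r1 y = \<alpha> * \<phi>\<^sub>t y + (c y \<bullet> \<phi>\<^sub>x y + d y * \<phi> y)" for y
  define r2 where "r2 x = \<alpha> * \<phi> (0, x)" for x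
  define r3 where "r3 y = (-1) * ((c y \<bullet> \<nu> (snd y)) * \<phi> y)" for y
  have r1: "r1 \<in> L_infinity MI"
    unfolding r1_def[abs_def] d_def[abs_def] by (intro L_infinity_intros div(1))
  have r2: "r2 \<in> L_infinity M0" unfolding r2_def[abs_def] by (intro L_infinity_intros)
  have r3: "r3 \<in> L_infinity MB"
    unfolding r3_def[abs_def] by (rule L_infinity_mult[OF L_infinity_const div(2)])
  have I: "integrable N (\<lambda>k. \<eta>'' k / 2 * A1 k) \<and> (\<integral>y. JI \<eta> \<eta>' q (dv Dq) y \<partial>MI) =
      (\<integral>k. \<eta>'' k / 2 * A1 k \<partial>N) + \<beta>\<^sub>p * A1 (- K) + \<beta>\<^sub>m * A1 K + (\<integral>y. r1 y \<partial>MI)"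
  proof -
    \<comment> \<open>At a fixed \<open>y\<close> the Kruzhkov integrand depends on \<open>k\<close>
      only through \<open>sgn (u y - k)\<close> and \<open>h y k\<close>; source and divergence of
      \<open>f\<close> at \<open>u\<close> form \<open>m\<close>.\<close>
    define h where "h y s = s * \<phi>\<^sub>t y + f (fst y, snd y, s) \<bullet> \<phi>\<^sub>x y + dv Df (fst y, snd y, s) * \<phi> y" for y s
    define m where "m y = (F (fst y, snd y, u y) - dv Df (fst y, snd y, u y)) * \<phi> y" for y
    have tx: "fst y \<in> {0..T}" "snd y \<in> \<Omega>" "snd y \<in> closure \<Omega>" if "y \<in> space MI" for y
      using that by (auto simp: space_MI subsetD[OF closure_subset])
    have cf: "continuous_on UNIV (\<lambda>s. f (fst y, snd y, s))" and cdv: "continuous_on UNIV (\<lambda>s. dv Df (fst y, snd y, s))"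
      if "y \<in> space MI" for y
      by (rule slice[OF tx(1,3)[OF that]], rule cont_f cont_dvf)+
    show ?thesis
      unfolding A1_def
    proof (rule superposition_integral[where z = u and h = h and m = m, OF finite_MI])
      have sp: "fst (snd p) \<in> {0..T} \<and> snd (snd p) \<in> closure \<Omega>" if "p \<in> space (N \<Otimes>\<^sub>M MI)" for p
        using that tx[of "snd p"] by (auto simp: space_pair_measure)
      have m: "(\<lambda>p. fst (snd p)) \<in> borel_measurable (N \<Otimes>\<^sub>M MI)" "(\<lambda>p. snd (snd p)) \<in> borel_measurable (N \<Otimes>\<^sub>M MI)"
        using measurable_compose[OF measurable_snd meas_MI(1)] measurable_compose[OF measurable_snd meas_MI(2)] .
      note k = L_infinity_cyl[OF _ m sp L_infinity_fst[OF finite_MI]]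
      note l = lift[OF finite_MI]
      show "(\<lambda>p. JI (\<lambda>z. \<bar>z - fst p\<bar>) (\<lambda>z. sgn (z - fst p)) (Qk (fst p)) (Vk (fst p)) (snd p)) \<in> L_infinity (N \<Otimes>\<^sub>M MI)"
        unfolding JI_def Qk_def Vk_def fst_conv snd_conv
        by (intro L_infinity_add L_infinity_diff L_infinity_mult L_infinity_scaleR L_infinity_inner
          L_infinity_sgn L_infinity_abs L_infinity_fst[OF finite_MI] l[OF u] k[OF cont_f] k[OF cont_dvf]
          l[OF L_infinity_MI'[OF cont_\<phi>]] l[OF L_infinity_MI'[OF cont_\<phi>\<^sub>t]] l[OF L_infinity_MI'[OF cont_\<phi>\<^sub>x]]
          l[OF L_infinity_MI[OF cont_f]] l[OF L_infinity_MI[OF cont_dvf]] l[OF L_infinity_MI[OF F]])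
      show "JI (\<lambda>z. \<bar>z - k\<bar>) (\<lambda>z. sgn (z - k)) (Qk k) (Vk k) y = sgn (u y - k) * (h y (u y) - h y k + m y)" for k y
        unfolding JI_def Qk_def Vk_def h_def m_def abs_sgn[of "u y - k"]
        by (simp add: algebra_simps)
      show "continuous_on UNIV (h y)" if "y \<in> space MI" for y
        unfolding h_def by (intro continuous_intros cf[OF that] cdv[OF that])
      have "AE y in MI. y \<in> space MI" by (rule AE_space)
      with R1(2) show "AE y in MI. \<bar>u y\<bar> < K \<and>
          JI \<eta> \<eta>' q (dv Dq) y = flux_part (h y) (u y) + offset (h y) + \<eta>' (u y) * m y + r1 y"
      proof eventually_elim
        case (elim y)
        have uK: "\<bar>u y\<bar> < K" "- K \<le> u y" using elim(1) RK(2) by auto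
        note cfy = cf[OF elim(2)] and cdy = cdv[OF elim(2)] and txy = tx[OF elim(2)]
        have c1: "continuous_on UNIV (\<lambda>s. s * \<phi>\<^sub>t y)" and c2: "continuous_on UNIV (\<lambda>s. f (fst y, snd y, s) \<bullet> \<phi>\<^sub>x y)"
          and c3: "continuous_on UNIV (\<lambda>s. dv Df (fst y, snd y, s) * \<phi> y)"
          by (intro continuous_intros cfy cdy)+
        have "flux_part (h y) (u y) = flux_part (\<lambda>s. s) (u y) * \<phi>\<^sub>t y + flux_part (\<lambda>s. f (fst y, snd y, s)) (u y) \<bullet> \<phi>\<^sub>x y
            + flux_part (\<lambda>s. dv Df (fst y, snd y, s)) (u y) * \<phi> y"
          unfolding h_def[abs_def] flux_part_add[OF continuous_on_add[OF c1 c2] c3] flux_part_add[OF c1 c2]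
            flux_part_mult flux_part_inner[OF cfy] ..
        moreover have "offset (h y) = offset (\<lambda>s. s) * \<phi>\<^sub>t y + offset (\<lambda>s. f (fst y, snd y, s)) \<bullet> \<phi>\<^sub>x y
            + offset (\<lambda>s. dv Df (fst y, snd y, s)) * \<phi> y"
          unfolding h_def[abs_def] offset_add[OF continuous_on_add[OF c1 c2] c3] offset_add[OF c1 c2]
            offset_mult offset_inner[OF cfy] ..
        moreover have "q (fst y, snd y, - K) = c y + offset (\<lambda>s. f (fst y, snd y, s))"
          by (simp add: c_def case_prod_unfold)
        moreover have "dv Dq (fst y, snd y, - K) = d y + offset (\<lambda>s. dv Df (fst y, snd y, s))"
          using d_eq[OF txy(1,3)] by simp
        ultimately show ?case
          using uK(1) unfolding JI_def m_def r1_def \<alpha>_def \<eta>_eq[OF uK(2)] q_eq[OF txy(1,3) uK(2)] V_eq[OF txy(1,2) uK(2)]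
          by (simp add: algebra_simps inner_add_left)
      qed
    qed (rule JI_kruzhkov_L_infinity JI_eta r1)+
  qed
  have O: "integrable N (\<lambda>k. \<eta>'' k / 2 * A2 k) \<and> (\<integral>y. J0 \<eta> y \<partial>M0) =
      (\<integral>k. \<eta>'' k / 2 * A2 k \<partial>N) + \<beta>\<^sub>p * A2 (- K) + \<beta>\<^sub>m * A2 K + (\<integral>y. r2 y \<partial>M0)"
  proof -
    define h where "h x s = s * \<phi> (0, x)" for s and x :: 'a
    show ?thesis
      unfolding A2_def
    proof (rule superposition_integral[where z = u\<^sub>o and h = h and m = "\<lambda>_. 0", OF finite_M0])
      show "(\<lambda>p. J0 (\<lambda>z. \<bar>z - fst p\<bar>) (snd p)) \<in> L_infinity (N \<Otimes>\<^sub>M M0)"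
        unfolding J0_def
        by (intro L_infinity_diff L_infinity_mult L_infinity_abs L_infinity_fst[OF finite_M0] lift[OF finite_M0 u\<^sub>o] lift[OF finite_M0 L_infinity_M0])
      show "J0 (\<lambda>z. \<bar>z - k\<bar>) x = sgn (u\<^sub>o x - k) * (h x (u\<^sub>o x) - h x k + 0)" for k x
        unfolding J0_def h_def abs_sgn[of "u\<^sub>o x - k"] by (simp add: algebra_simps)
      show "continuous_on UNIV (h x)" for x unfolding h_def by (intro continuous_intros)
      show "AE x in M0. \<bar>u\<^sub>o x\<bar> < K \<and> J0 \<eta> x = flux_part (h x) (u\<^sub>o x) + offset (h x) + \<eta>' (u\<^sub>o x) * 0 + r2 x"
        using R2(2)
      proof eventually_elim
        case (elim x)
        have uK: "\<bar>u\<^sub>o x\<bar> < K" "- K \<le> u\<^sub>o x" using elim RK(3) by auto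
        show ?case
          using uK(1) unfolding J0_def r2_def \<alpha>_def \<eta>_eq[OF uK(2)] h_def[abs_def] flux_part_mult offset_mult
          by (simp add: algebra_simps inner_add_left)
      qed
    qed (rule J0_kruzhkov_L_infinity J0_eta r2)+
  qed
  have L: "integrable N (\<lambda>k. \<eta>'' k / 2 * A3 k) \<and> (\<integral>y. JL \<eta>' q y \<partial>MB) =
      (\<integral>k. \<eta>'' k / 2 * A3 k \<partial>N) + \<beta>\<^sub>p * A3 (- K) + \<beta>\<^sub>m * A3 K + (\<integral>y. r3 y \<partial>MB)"
  proof -
    \<comment> \<open>The minus sign reflects that the flux enters the lateral integrand negatively.
      The trace occurs only in \<open>m\<close>.\<close>
    define \<psi> where "\<psi> y = - (\<phi> y *\<^sub>R \<nu> (snd y))" for y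
    define h where "h y s = f (fst y, snd y, s) \<bullet> \<psi> y" for y s
    define m where "m y = ((f (fst y, snd y, u\<^sub>b y) - f (fst y, snd y, w y)) \<bullet> \<nu> (snd y)) * \<phi> y" for y
    have tx: "fst y \<in> {0..T}" "snd y \<in> closure \<Omega>" if "y \<in> space MB" for y
      using that by (auto simp: space_MB frontier_closure)
    have cf: "continuous_on UNIV (\<lambda>s. f (fst y, snd y, s))" if "y \<in> space MB" for y
      by (rule slice[OF tx[OF that] cont_f])
    have \<psi>: "v \<bullet> \<psi> y = - ((v \<bullet> \<nu> (snd y)) * \<phi> y)" for v y by (simp add: \<psi>_def mult.commute)
    show ?thesis
      unfolding A3_def
    proof (rule superposition_integral[where z = u\<^sub>b and h = h and m = m, OF finite_MB])
      have sp: "fst (snd p) \<in> {0..T} \<and> snd (snd p) \<in> closure \<Omega>" if "p \<in> space (N \<Otimes>\<^sub>M MB)" for p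
        using that tx[of "snd p"] by (auto simp: space_pair_measure)
      have m: "(\<lambda>p. fst (snd p)) \<in> borel_measurable (N \<Otimes>\<^sub>M MB)" "(\<lambda>p. snd (snd p)) \<in> borel_measurable (N \<Otimes>\<^sub>M MB)"
        using measurable_compose[OF measurable_snd meas_MB(1)] measurable_compose[OF measurable_snd meas_MB(2)] .
      note k = L_infinity_cyl[OF _ m sp L_infinity_fst[OF finite_MB]]
      note l = lift[OF finite_MB]
      show "(\<lambda>p. JL (\<lambda>z. sgn (z - fst p)) (Qk (fst p)) (snd p)) \<in> L_infinity (N \<Otimes>\<^sub>M MB)"
        unfolding JL_def Qk_def fst_conv snd_conv
        by (intro L_infinity_add L_infinity_diff L_infinity_mult L_infinity_scaleR L_infinity_inner
          L_infinity_sgn L_infinity_fst[OF finite_MB] l[OF u\<^sub>b] k[OF cont_f] l[OF L_infinity_MB'[OF cont_\<phi>]] l[OF L_infinity_normal]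
          l[OF L_infinity_MB[OF cont_f u\<^sub>b]] l[OF L_infinity_MB[OF cont_f w]])
      show "JL (\<lambda>z. sgn (z - k)) (Qk k) y = sgn (u\<^sub>b y - k) * (h y (u\<^sub>b y) - h y k + m y)" for k y
        unfolding JL_def Qk_def h_def m_def \<psi> by (simp add: algebra_simps)
      show "continuous_on UNIV (h y)" if "y \<in> space MB" for y
        unfolding h_def by (intro continuous_intros cf[OF that])
      have "AE y in MB. y \<in> space MB" by (rule AE_space)
      with R3(2) show "AE y in MB. \<bar>u\<^sub>b y\<bar> < K \<and>
          JL \<eta>' q y = flux_part (h y) (u\<^sub>b y) + offset (h y) + \<eta>' (u\<^sub>b y) * m y + r3 y"
      proof eventually_elim
        case (elim y)
        have uK: "\<bar>u\<^sub>b y\<bar> < K" "- K \<le> u\<^sub>b y" using elim(1) RK(4) by auto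
        have "flux_part (h y) (u\<^sub>b y) = flux_part (\<lambda>s. f (fst y, snd y, s)) (u\<^sub>b y) \<bullet> \<psi> y"
          unfolding h_def[abs_def] flux_part_inner[OF cf[OF elim(2)]] ..
        moreover have "offset (h y) = offset (\<lambda>s. f (fst y, snd y, s)) \<bullet> \<psi> y"
          unfolding h_def[abs_def] offset_inner[OF cf[OF elim(2)]] ..
        moreover have "q (fst y, snd y, - K) = c y + offset (\<lambda>s. f (fst y, snd y, s))"
          by (simp add: c_def case_prod_unfold)
        ultimately show ?case
          using uK(1) unfolding JL_def m_def r3_def q_eq[OF tx[OF elim(2)] uK(2)] \<psi>
          by (simp add: algebra_simps inner_add_left)
      qed
    qed (rule JL_kruzhkov_L_infinity JL_eta r3)+
  qed
  \<comment> \<open>The terms with \<alpha> cancel by \<open>integral_\<phi>\<^sub>t\<close>, those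
    with \<open>c\<close> by \<open>divergence_cylinder\<close>.\<close>
  have rest: "(\<integral>y. r1 y \<partial>MI) + (\<integral>x. r2 x \<partial>M0) + (\<integral>y. r3 y \<partial>MB) = 0"
  proof -
    have "(\<integral>y. r1 y \<partial>MI) = \<alpha> * (\<integral>y. \<phi>\<^sub>t y \<partial>MI) + (\<integral>y. c y \<bullet> \<phi>\<^sub>x y + d y * \<phi> y \<partial>MI)"
      unfolding r1_def
      using L_infinity_integrable[OF finite_MI L_infinity_MI'[OF cont_\<phi>\<^sub>t]] L_infinity_integrable[OF finite_MI div(1)]
      by (subst Bochner_Integration.integral_add) (simp_all add: d_def)
    moreover have "(\<integral>y. c y \<bullet> \<phi>\<^sub>x y + d y * \<phi> y \<partial>MI) = (\<integral>y. (c y \<bullet> \<nu> (snd y)) * \<phi> y \<partial>MB)"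
      unfolding d_def by (rule div(3))
    moreover have "(\<integral>y. r3 y \<partial>MB) = - (\<integral>y. (c y \<bullet> \<nu> (snd y)) * \<phi> y \<partial>MB)"
      unfolding r3_def by simp
    moreover have "(\<integral>x. r2 x \<partial>M0) = \<alpha> * (\<integral>x. \<phi> (0, x) \<partial>M0)" unfolding r2_def by simp
    moreover have "\<alpha> * (\<integral>y. \<phi>\<^sub>t y \<partial>MI) + \<alpha> * (\<integral>x. \<phi> (0, x) \<partial>M0) = 0"
      using integral_\<phi>\<^sub>t by (simp add: distrib_left[symmetric])
    ultimately show ?thesis by linarith
  qed
  have J1: "J1 k = A1 k + A2 k + A3 k" for k by (simp add: J1_def J_def A1_def A2_def A3_def)
  have "(\<integral>k. \<eta>'' k / 2 * J1 k \<partial>N) = (\<integral>k. \<eta>'' k / 2 * A1 k + \<eta>'' k / 2 * A2 k + \<eta>'' k / 2 * A3 k \<partial>N)"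
    by (simp add: J1 distrib_left)
  also have "\<dots> = (\<integral>k. \<eta>'' k / 2 * A1 k \<partial>N) + (\<integral>k. \<eta>'' k / 2 * A2 k \<partial>N) + (\<integral>k. \<eta>'' k / 2 * A3 k \<partial>N)"
    using conjunct1[OF I] conjunct1[OF O] conjunct1[OF L] by simp
  finally have "J \<eta> \<eta>' q (dv Dq) = (\<integral>k. \<eta>'' k / 2 * J1 k \<partial>N) + \<beta>\<^sub>p * J1 (- K) + \<beta>\<^sub>m * J1 K"
    using conjunct2[OF I] conjunct2[OF O] conjunct2[OF L] rest
    unfolding J_def[of \<eta>] J1 by (simp add: distrib_left)
  also have "\<dots> \<ge> 0"
  \<comment> \<open>Convexity enters here, through the sign of the density; the atoms are
    nonnegative by construction.\<close>
  proof (intro add_nonneg_nonneg mult_nonneg_nonneg \<beta>)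
    have J1n: "0 \<le> J1 k" for k unfolding J1_def by (rule kruzhkov)
    then show "0 \<le> J1 (- K)" "0 \<le> J1 K" by blast+
    show "0 \<le> (\<integral>k. \<eta>'' k / 2 * J1 k \<partial>N)"
      by (rule Bochner_Integration.integral_nonneg) (intro mult_nonneg_nonneg divide_nonneg_nonneg nonneg J1n, simp)
  qed
  finally show ?thesis by (simp add: \<eta>'_def)
qed

end

theorem theorem5p4:
  fixes \<Omega> :: "'a::euclidean_space set" and \<sigma> :: "'a measure" and T :: real
    and f :: "real \<times> 'a \<times> real \<Rightarrow> 'a" and F :: "real \<times> 'a \<times> real \<Rightarrow> real"
    and u\<^sub>o :: "'a \<Rightarrow> real" and u\<^sub>b u :: "real \<times> 'a \<Rightarrow> real"
  assumes "T > 0"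
    and "open \<Omega>" and "bounded \<Omega>" and "smooth_boundary \<Omega>" and "surface_measure \<Omega> \<sigma>"
    and "u\<^sub>o \<in> L_infinity (restrict_space lborel \<Omega>)"
    and "u\<^sub>b \<in> L_infinity (lateral_measure T \<sigma>)"
    and "C_k 2 ({0..T} \<times> closure \<Omega> \<times> UNIV) f"
    and "partial_u f \<in> L_infinity_loc ({0..T} \<times> \<Omega> \<times> UNIV)"
    and "\<forall>b\<in>Basis. partial_x b (partial_u f)
           \<in> L_infinity (restrict_space lborel ({0..T} \<times> \<Omega> \<times> UNIV))"
    and "C_k 2 ({0..T} \<times> closure \<Omega> \<times> UNIV) F"
    and "partial_u F \<in> L_infinity (restrict_space lborel ({0..T} \<times> \<Omega> \<times> UNIV))"
    and "u \<in> L_infinity (interior_measure T \<Omega>) \<inter> TR_infinity T \<Omega> \<sigma>"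
  shows "E_solution T \<Omega> \<sigma> f F u\<^sub>o u\<^sub>b u \<longleftrightarrow> BLN_solution T \<Omega> \<sigma> f F u\<^sub>o u\<^sub>b u"
proof -
  let ?cyl = "{0..T} \<times> closure \<Omega> \<times> (UNIV :: real set)"
  from assms(8)[unfolded numeral_2_eq_2]
  obtain Df where Df: "\<And>p. p \<in> ?cyl \<Longrightarrow> (f has_derivative Df p) (at p within ?cyl)"
    "\<And>b. b \<in> Basis \<Longrightarrow> C_k (Suc 0) ?cyl (\<lambda>p. Df p b)" by (rule C_k_SucE) (rule that, assumption+)
  have "\<exists>w. is_trace T \<Omega> \<sigma> u w" using assms(13) by (simp add: TR_infinity_def)
  \<comment> \<open>Both solution notions use this same selected representative, so its boundedness
    is all that is passed on.\<close>
  then have "is_trace T \<Omega> \<sigma> u (tr T \<Omega> \<sigma> u)" unfolding tr_def by (rule someI_ex)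
  then have tr: "tr T \<Omega> \<sigma> u \<in> L_infinity (lateral_measure T \<sigma>)" by (simp add: is_trace_def)
  \<comment> \<open>The locale is instantiated separately for every test function, because
    \<open>J\<close> has the test function built in.\<close>
  have ibvp: "\<exists>D\<phi>. ibvp \<Omega> T \<sigma> f Df F u\<^sub>o u\<^sub>b u (tr T \<Omega> \<sigma> u) \<phi> D\<phi>" if \<phi>: "test_function T \<phi>" for \<phi>
  proof -
    obtain D where D: "\<And>p. (\<phi> has_derivative D p) (at p)" "\<And>b. b \<in> Basis \<Longrightarrow> continuous_on UNIV (\<lambda>p. D p b)"
      "\<And>t x. T \<le> t \<Longrightarrow> \<phi> (t, x) = 0"
      by (rule test_functionE[OF \<phi>]) (rule that, assumption+)
    show ?thesis
      by (rule exI[of _ D], unfold_locales)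
        (use assms Df tr D C_k_imp_continuous[OF assms(11)] in simp_all)
  qed
  show ?thesis
  proof
    assume E: "E_solution T \<Omega> \<sigma> f F u\<^sub>o u\<^sub>b u"
    show "BLN_solution T \<Omega> \<sigma> f F u\<^sub>o u\<^sub>b u"
      unfolding BLN_solution_def
    proof (intro conjI assms(13) allI impI)
      fix k and \<phi> :: "real \<times> 'a \<Rightarrow> real" assume test: "test_function T \<phi>"
      obtain D\<phi> where "ibvp \<Omega> T \<sigma> f Df F u\<^sub>o u\<^sub>b u (tr T \<Omega> \<sigma> u) \<phi> D\<phi>" using ibvp[OF test] by (rule exE)
      then interpret ibvp \<Omega> T \<sigma> f Df F u\<^sub>o u\<^sub>b u "tr T \<Omega> \<sigma> u" \<phi> D\<phi> .
      have "0 \<le> J (\<lambda>z. \<bar>z - k\<bar>) (\<lambda>z. sgn (z - k)) (Qk k) (Vk k)"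
      proof (rule kruzhkov_of_entropies)
        fix \<eta> q Dq
        assume a: "entropy_flux_pair T \<Omega> f \<eta> q" "continuous_on UNIV \<eta>" "continuous_on UNIV (deriv \<eta>)"
          "\<And>p. p \<in> cyl \<Longrightarrow> (q has_derivative Dq p) (at p within cyl)"
          "\<And>b. b \<in> Basis \<Longrightarrow> continuous_on cyl (\<lambda>p. Dq p b)"
        show "0 \<le> J \<eta> (deriv \<eta>) q (dv Dq)"
          by (subst J_entropy[OF a(2-5), symmetric])
            (assumption | rule conjunct2[OF E[unfolded E_solution_def], rule_format, OF conjI[OF a(1) test]])+
      qed
      then show "0 \<le> (\<integral>(t, x). \<bar>u (t, x) - k\<bar> * deriv (\<lambda>s. \<phi> (s, x)) t \<partial>interior_measure T \<Omega>)
        + (\<integral>(t, x). sgn (u (t, x) - k) *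
             ((f (t, x, u (t, x)) - f (t, x, k)) \<bullet> grad (\<lambda>y. \<phi> (t, y)) x) \<partial>interior_measure T \<Omega>)
        + (\<integral>(t, x). sgn (u (t, x) - k) * (F (t, x, u (t, x)) - div_x f t x k) * \<phi> (t, x)
             \<partial>interior_measure T \<Omega>)
        + (\<integral>x. \<bar>u\<^sub>o x - k\<bar> * \<phi> (0, x) \<partial>restrict_space lborel \<Omega>)
        - (\<integral>(t, \<xi>). sgn (u\<^sub>b (t, \<xi>) - k) *
             ((f (t, \<xi>, tr T \<Omega> \<sigma> u (t, \<xi>)) - f (t, \<xi>, k)) \<bullet> exterior_normal \<Omega> \<xi>) * \<phi> (t, \<xi>)
             \<partial>lateral_measure T \<sigma>)"
        unfolding J_kruzhkov .
    qed
  next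
    assume B: "BLN_solution T \<Omega> \<sigma> f F u\<^sub>o u\<^sub>b u"
    show "E_solution T \<Omega> \<sigma> f F u\<^sub>o u\<^sub>b u"
      unfolding E_solution_def
    proof (intro conjI assms(13) allI impI)
      fix \<eta> q and \<phi> :: "real \<times> 'a \<Rightarrow> real" assume a: "entropy_flux_pair T \<Omega> f \<eta> q \<and> test_function T \<phi>"
      then have test: "test_function T \<phi>" and \<eta>: "C_k 2 UNIV \<eta>" "convex_on UNIV \<eta>" and q: "C_k 2 ?cyl q"
        and flux: "\<And>t x z. t \<in> {0..T} \<Longrightarrow> x \<in> \<Omega> \<Longrightarrow> partial_u q (t, x, z) = deriv \<eta> z *\<^sub>R partial_u f (t, x, z)"
        by (simp_all add: entropy_flux_pair_def)
      obtain D\<phi> where "ibvp \<Omega> T \<sigma> f Df F u\<^sub>o u\<^sub>b u (tr T \<Omega> \<sigma> u) \<phi> D\<phi>" using ibvp[OF test] by (rule exE)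
      then interpret ibvp \<Omega> T \<sigma> f Df F u\<^sub>o u\<^sub>b u "tr T \<Omega> \<sigma> u" \<phi> D\<phi> .
      from C_k_mono[OF q, of 1, simplified]
      obtain Dq where Dq: "\<And>p. p \<in> cyl \<Longrightarrow> (q has_derivative Dq p) (at p within cyl)"
        "\<And>b. b \<in> Basis \<Longrightarrow> continuous_on cyl (\<lambda>p. Dq p b)"
        unfolding One_nat_def[symmetric] by (rule C_k_1E) (rule that, assumption+)
      have k: "0 \<le> J (\<lambda>z. \<bar>z - k\<bar>) (\<lambda>z. sgn (z - k)) (Qk k) (Vk k)" for k
        using conjunct2[OF B[unfolded BLN_solution_def], rule_format, OF test, of k] unfolding J_kruzhkov .
      have c: "continuous_on UNIV \<eta>" "continuous_on UNIV (deriv \<eta>)"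
        using C_k_imp_continuous[OF \<eta>(1)] C_k_imp_continuous[OF C_k_real_derivativeE(2)[OF \<eta>(1)[unfolded numeral_2_eq_2]]] .
      have "0 \<le> J \<eta> (deriv \<eta>) q (dv Dq)"
        by (rule entropies_of_kruzhkov[OF k \<eta> Dq flux])
      then show "0 \<le> (\<integral>(t, x). \<eta> (u (t, x)) * deriv (\<lambda>s. \<phi> (s, x)) t
                 + q (t, x, u (t, x)) \<bullet> grad (\<lambda>y. \<phi> (t, y)) x \<partial>interior_measure T \<Omega>)
        + (\<integral>(t, x). deriv \<eta> (u (t, x)) * (F (t, x, u (t, x)) - div_x f t x (u (t, x))) * \<phi> (t, x)
             \<partial>interior_measure T \<Omega>)
        + (\<integral>(t, x). div_x q t x (u (t, x)) * \<phi> (t, x) \<partial>interior_measure T \<Omega>)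
        + (\<integral>x. \<eta> (u\<^sub>o x) * \<phi> (0, x) \<partial>restrict_space lborel \<Omega>)
        - (\<integral>(t, \<xi>). (q (t, \<xi>, u\<^sub>b (t, \<xi>)) \<bullet> exterior_normal \<Omega> \<xi>) * \<phi> (t, \<xi>) \<partial>lateral_measure T \<sigma>)
        + (\<integral>(t, \<xi>). deriv \<eta> (u\<^sub>b (t, \<xi>)) *
             ((f (t, \<xi>, u\<^sub>b (t, \<xi>)) - f (t, \<xi>, tr T \<Omega> \<sigma> u (t, \<xi>))) \<bullet> exterior_normal \<Omega> \<xi>) * \<phi> (t, \<xi>)
             \<partial>lateral_measure T \<sigma>)"
        by (subst J_entropy[OF c Dq]) (assumption+)
    qed
  qed
qed

end
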